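(* Assume determinacy maximum. Let $X\subseteq 2^{\omega_1}$ be a set that is definable from a countable sequence of ordinals. Then either $X$ has cardinality at most that of the continuum $2^{\omega}$, or $X$ has a perfect subset.
   Context: We work in ZFC. Here $2^{\omega_1}$ denotes the set of all sequences of zeros and ones of length $\omega_1$ (identified with subsets of $\omega_1$). Games: a game is given by an ordinal $\theta$ (its length), a nonempty set $S$ (the move set; one says the game is "on $S$"), and a payoff set $A$ of sequences of moves. It is a perfect information game of two players who move in turns, and at limit ordinals the first player moves (so the first player makes the moves with index $\lambda+2n$ and the second player those with index $\lambda+2n+1$, for $\lambda$ zero or a limit ordinal and $n<\omega$). Each move consists of picking an element of $S$. A position is the sequence of moves made so far at a point before the game ends. The game ends once the sequence of moves has length $\theta$; this sequence is the play. The first player wins if the play belongs to $A$; otherwise the second player wins. A strategy for a player is a mapping that assigns a valid move to every position at which it is that player's turn. A strategy is winning if the player wins whenever he follows it, regardless of the choices of the other player. A game is determined if one of the players has a winning strategy, and undetermined otherwise. A set is ordinal definable if there is an ordinal $\lambda$ such that the set is definable in $V_\lambda$ by a first-order formula with ordinal parameters. A set is definable from a countable sequence of ordinals if, for some countable sequence $x$ of ordinals, it is ordinal definable in this sense with $x$ allowed as an additional parameter. Determinacy maximum is the following hypothesis: every game of length $\omega_1$ with ordinal definable payoff set and with the set of allowed moves (the move set) being an ordinal is determined. Perfect subsets: a tree is a set of sequences, ordered by inclusion (end-extension), that is closed under initial segments. For an infinite regular cardinal $\kappa$, a tree $T$ of height $\kappa$ (here consisting of sequences of zeros and ones of length less than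 $\kappa$) is perfect if every totally ordered subset of $T$ is contained in a path (a totally ordered subset of $T$ of order type $\kappa$), and every path has $\kappa$ points at which the tree branches. A set of sequences of zeros and ones of length $\kappa$ (equivalently, a set of subsets of $\kappa$) is perfect if it is the set of paths through a perfect tree of height $\kappa$, each path being identified with the sequence of length $\kappa$ that is its union. In the claim, $\kappa=\omega_1$. *)

theory Defs
  imports Main
begin

text \<open>
  The ambient set theory is rendered by an arbitrary model of first-order ZFC: a type of ``sets''
  with a membership relation. Separation and Replacement are schemes over genuine first-order
  formulas (not over arbitrary HOL predicates), so a statement about all such models is a
  statement about what follows from ZFC. Every set-theoretic notion below is
  evaluated inside the model: in particular the formulas used for ordinal definability are
  the model's own (coded) formulas, and all functions, strategies, injections, trees etc. are
  elements of the model.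
\<close>

section \<open>First-order formulas of the language of set theory\<close>

datatype fm = Mem nat nat | Eq nat nat | Neg fm | Conj fm fm | Ex nat fm

primrec sat :: "('v \<Rightarrow> 'v \<Rightarrow> bool) \<Rightarrow> fm \<Rightarrow> (nat \<Rightarrow> 'v) \<Rightarrow> bool" where
  "sat E (Mem i j) s \<longleftrightarrow> E (s i) (s j)"
| "sat E (Eq i j) s \<longleftrightarrow> s i = s j"
| "sat E (Neg p) s \<longleftrightarrow> \<not> sat E p s"
| "sat E (Conj p q) s \<longleftrightarrow> sat E p s \<and> sat E q s"
| "sat E (Ex i p) s \<longleftrightarrow> (\<exists>a. sat E p (s(i := a)))"


section \<open>Set-theoretic notions inside a structure for the language of set theory\<close>

locale set_universe =
  fixes mem :: "'v \<Rightarrow> 'v \<Rightarrow> bool"  (infix \<open>\<^bold>\<in>\<close> 50)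
begin

subsection \<open>Basic notions\<close>

definition sub :: "'v \<Rightarrow> 'v \<Rightarrow> bool"  (infix \<open>\<^bold>\<subseteq>\<close> 50) where
  "x \<^bold>\<subseteq> y \<longleftrightarrow> (\<forall>z. z \<^bold>\<in> x \<longrightarrow> z \<^bold>\<in> y)"

definition is_empty :: "'v \<Rightarrow> bool" where
  "is_empty x \<longleftrightarrow> (\<forall>z. \<not> z \<^bold>\<in> x)"

definition is_upair :: "'v \<Rightarrow> 'v \<Rightarrow> 'v \<Rightarrow> bool" where
  "is_upair p a b \<longleftrightarrow> (\<forall>z. z \<^bold>\<in> p \<longleftrightarrow> z = a \<or> z = b)"

definition is_pair :: "'v \<Rightarrow> 'v \<Rightarrow> 'v \<Rightarrow> bool" where
  "is_pair p a b \<longleftrightarrow> (\<exists>u v. is_upair u a a \<and> is_upair v a b \<and> is_upair p u v)"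

definition is_union :: "'v \<Rightarrow> 'v \<Rightarrow> bool" where
  "is_union u x \<longleftrightarrow> (\<forall>z. z \<^bold>\<in> u \<longleftrightarrow> (\<exists>y. y \<^bold>\<in> x \<and> z \<^bold>\<in> y))"

definition is_power :: "'v \<Rightarrow> 'v \<Rightarrow> bool" where
  "is_power p x \<longleftrightarrow> (\<forall>z. z \<^bold>\<in> p \<longleftrightarrow> z \<^bold>\<subseteq> x)"

definition is_succ :: "'v \<Rightarrow> 'v \<Rightarrow> bool" where
  "is_succ s x \<longleftrightarrow> (\<forall>z. z \<^bold>\<in> s \<longleftrightarrow> z \<^bold>\<in> x \<or> z = x)"

text \<open>Foundation makes it unnecessary to demand well-foundedness of membership on an ordinal.\<close>

definition is_ordinal :: "'v \<Rightarrow> bool" where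
  "is_ordinal x \<longleftrightarrow> (\<forall>y. y \<^bold>\<in> x \<longrightarrow> y \<^bold>\<subseteq> x) \<and>
     (\<forall>y z. y \<^bold>\<in> x \<and> z \<^bold>\<in> x \<longrightarrow> y \<^bold>\<in> z \<or> y = z \<or> z \<^bold>\<in> y)"

definition is_limit :: "'v \<Rightarrow> bool" where
  "is_limit x \<longleftrightarrow> is_ordinal x \<and> \<not> is_empty x \<and>
     (\<forall>y. y \<^bold>\<in> x \<longrightarrow> (\<exists>s. is_succ s y \<and> s \<^bold>\<in> x))"

definition is_omega :: "'v \<Rightarrow> bool" where
  "is_omega w \<longleftrightarrow> is_limit w \<and> (\<forall>y. y \<^bold>\<in> w \<longrightarrow> \<not> is_limit y)"

definition is_nat :: "'v \<Rightarrow> bool" where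
  "is_nat n \<longleftrightarrow> (\<exists>w. is_omega w \<and> n \<^bold>\<in> w)"

primrec is_numeral :: "nat \<Rightarrow> 'v \<Rightarrow> bool" where
  "is_numeral 0 x \<longleftrightarrow> is_empty x"
| "is_numeral (Suc k) x \<longleftrightarrow> (\<exists>y. is_numeral k y \<and> is_succ x y)"

subsection \<open>Functions and cardinality\<close>

definition pair_in :: "'v \<Rightarrow> 'v \<Rightarrow> 'v \<Rightarrow> bool" where
  "pair_in r a b \<longleftrightarrow> (\<exists>p. is_pair p a b \<and> p \<^bold>\<in> r)"

definition is_fun_on :: "'v \<Rightarrow> 'v \<Rightarrow> bool" where
  "is_fun_on f d \<longleftrightarrow> (\<forall>p. p \<^bold>\<in> f \<longrightarrow> (\<exists>a b. a \<^bold>\<in> d \<and> is_pair p a b)) \<and>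
     (\<forall>a. a \<^bold>\<in> d \<longrightarrow> (\<exists>!b. pair_in f a b))"

definition is_function :: "'v \<Rightarrow> 'v \<Rightarrow> 'v \<Rightarrow> bool" where
  "is_function f d c \<longleftrightarrow> is_fun_on f d \<and> (\<forall>a b. pair_in f a b \<longrightarrow> b \<^bold>\<in> c)"

definition is_restriction :: "'v \<Rightarrow> 'v \<Rightarrow> 'v \<Rightarrow> bool" where
  "is_restriction g f d \<longleftrightarrow> (\<forall>p. p \<^bold>\<in> g \<longleftrightarrow> p \<^bold>\<in> f \<and> (\<exists>a b. a \<^bold>\<in> d \<and> is_pair p a b))"

definition is_injection :: "'v \<Rightarrow> 'v \<Rightarrow> 'v \<Rightarrow> bool" where
  "is_injection f d c \<longleftrightarrow> is_function f d c \<and>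
     (\<forall>a a' b. pair_in f a b \<and> pair_in f a' b \<longrightarrow> a = a')"

definition is_bijection :: "'v \<Rightarrow> 'v \<Rightarrow> 'v \<Rightarrow> bool" where
  "is_bijection f d c \<longleftrightarrow> is_injection f d c \<and> (\<forall>b. b \<^bold>\<in> c \<longrightarrow> (\<exists>a. pair_in f a b))"

definition is_countable :: "'v \<Rightarrow> bool" where
  "is_countable x \<longleftrightarrow> (\<exists>w f. is_omega w \<and> is_injection f x w)"

definition is_omega1 :: "'v \<Rightarrow> bool" where
  "is_omega1 w1 \<longleftrightarrow> is_ordinal w1 \<and> \<not> is_countable w1 \<and>
     (\<forall>\<alpha>. \<alpha> \<^bold>\<in> w1 \<longrightarrow> is_countable \<alpha>)"

definition is_binary_seq :: "'v \<Rightarrow> 'v \<Rightarrow> bool" where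
  "is_binary_seq x d \<longleftrightarrow> (\<exists>t. is_numeral 2 t \<and> is_function x d t)"

definition card_at_most_continuum :: "'v \<Rightarrow> bool" where
  "card_at_most_continuum x \<longleftrightarrow> (\<exists>w c f. is_omega w \<and>
     (\<forall>z. z \<^bold>\<in> c \<longleftrightarrow> is_binary_seq z w) \<and> is_injection f x c)"

subsection \<open>The cumulative hierarchy\<close>

definition is_V :: "'v \<Rightarrow> 'v \<Rightarrow> bool" where
  "is_V v l \<longleftrightarrow> is_ordinal l \<and>
     (\<exists>f d. is_succ d l \<and> is_fun_on f d \<and> pair_in f l v \<and>
       (\<forall>\<alpha> u. pair_in f \<alpha> u \<longrightarrow>
          (is_empty \<alpha> \<longrightarrow> is_empty u) \<and>
          (\<forall>\<beta> w. is_succ \<alpha> \<beta> \<and> pair_in f \<beta> w \<longrightarrow> is_power u w) \<and>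
          (is_limit \<alpha> \<longrightarrow> (\<forall>z. z \<^bold>\<in> u \<longleftrightarrow> (\<exists>\<beta> w. \<beta> \<^bold>\<in> \<alpha> \<and> pair_in f \<beta> w \<and> z \<^bold>\<in> w)))))"

subsection \<open>Coded first-order formulas and satisfaction in a set\<close>

text \<open>
  Codes: \<open>\<langle>0,\<langle>i,j\<rangle>\<rangle>\<close> for \<open>v\<^sub>i \<in> v\<^sub>j\<close>, \<open>\<langle>1,\<langle>i,j\<rangle>\<rangle>\<close> for \<open>v\<^sub>i = v\<^sub>j\<close>,
  \<open>\<langle>2,p\<rangle>\<close> for negation, \<open>\<langle>3,\<langle>p,q\<rangle>\<rangle>\<close> for conjunction, \<open>\<langle>4,\<langle>i,p\<rangle>\<rangle>\<close> for \<open>\<exists>v\<^sub>i. p\<close>.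
\<close>

definition is_tagged :: "nat \<Rightarrow> 'v \<Rightarrow> 'v \<Rightarrow> bool" where
  "is_tagged k c a \<longleftrightarrow> (\<exists>t. is_numeral k t \<and> is_pair c t a)"

definition is_tagged2 :: "nat \<Rightarrow> 'v \<Rightarrow> 'v \<Rightarrow> 'v \<Rightarrow> bool" where
  "is_tagged2 k c a b \<longleftrightarrow> (\<exists>q. is_pair q a b \<and> is_tagged k c q)"

definition code_Mem :: "'v \<Rightarrow> 'v \<Rightarrow> 'v \<Rightarrow> bool" where
  "code_Mem c i j \<longleftrightarrow> is_nat i \<and> is_nat j \<and> is_tagged2 0 c i j"

definition code_Eq :: "'v \<Rightarrow> 'v \<Rightarrow> 'v \<Rightarrow> bool" where
  "code_Eq c i j \<longleftrightarrow> is_nat i \<and> is_nat j \<and> is_tagged2 1 c i j"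

definition code_Neg :: "'v \<Rightarrow> 'v \<Rightarrow> bool" where
  "code_Neg c p \<longleftrightarrow> is_tagged 2 c p"

definition code_Conj :: "'v \<Rightarrow> 'v \<Rightarrow> 'v \<Rightarrow> bool" where
  "code_Conj c p q \<longleftrightarrow> is_tagged2 3 c p q"

definition code_Ex :: "'v \<Rightarrow> 'v \<Rightarrow> 'v \<Rightarrow> bool" where
  "code_Ex c i p \<longleftrightarrow> is_nat i \<and> is_tagged2 4 c i p"

definition formula_closed :: "'v \<Rightarrow> bool" where
  "formula_closed F \<longleftrightarrow>
     (\<forall>c i j. code_Mem c i j \<longrightarrow> c \<^bold>\<in> F) \<and>
     (\<forall>c i j. code_Eq c i j \<longrightarrow> c \<^bold>\<in> F) \<and>
     (\<forall>c p. p \<^bold>\<in> F \<and> code_Neg c p \<longrightarrow> c \<^bold>\<in> F) \<and>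
     (\<forall>c p q. p \<^bold>\<in> F \<and> q \<^bold>\<in> F \<and> code_Conj c p q \<longrightarrow> c \<^bold>\<in> F) \<and>
     (\<forall>c i p. p \<^bold>\<in> F \<and> code_Ex c i p \<longrightarrow> c \<^bold>\<in> F)"

text \<open>In ZFC there are sets closed under the formation rules, for instance \<open>V\<^sub>\<omega>\<close>.\<close>

definition is_formula :: "'v \<Rightarrow> bool" where
  "is_formula p \<longleftrightarrow> (\<forall>F. formula_closed F \<longrightarrow> p \<^bold>\<in> F)"

definition is_assignment :: "'v \<Rightarrow> 'v \<Rightarrow> bool" where
  "is_assignment e A \<longleftrightarrow> (\<exists>w. is_omega w \<and> is_function e w A)"

definition is_update :: "'v \<Rightarrow> 'v \<Rightarrow> 'v \<Rightarrow> 'v \<Rightarrow> 'v \<Rightarrow> bool" where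
  "is_update A e' e i a \<longleftrightarrow> is_assignment e' A \<and>
     (\<forall>j b. pair_in e' j b \<longleftrightarrow> (if j = i then b = a else pair_in e j b))"

text \<open>
  \<open>S\<close> is a satisfaction relation, in the sense of Tarski, for the structure \<open>A\<close> with membership.
\<close>

definition is_satisfaction :: "'v \<Rightarrow> 'v \<Rightarrow> bool" where
  "is_satisfaction A S \<longleftrightarrow> (\<forall>e. is_assignment e A \<longrightarrow>
     (\<forall>c i j. code_Mem c i j \<longrightarrow>
        (pair_in S c e \<longleftrightarrow> (\<exists>x y. pair_in e i x \<and> pair_in e j y \<and> x \<^bold>\<in> y))) \<and>
     (\<forall>c i j. code_Eq c i j \<longrightarrow>
        (pair_in S c e \<longleftrightarrow> (\<exists>x. pair_in e i x \<and> pair_in e j x))) \<and>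
     (\<forall>c p. is_formula p \<and> code_Neg c p \<longrightarrow>
        (pair_in S c e \<longleftrightarrow> \<not> pair_in S p e)) \<and>
     (\<forall>c p q. is_formula p \<and> is_formula q \<and> code_Conj c p q \<longrightarrow>
        (pair_in S c e \<longleftrightarrow> pair_in S p e \<and> pair_in S q e)) \<and>
     (\<forall>c i p. is_formula p \<and> code_Ex c i p \<longrightarrow>
        (pair_in S c e \<longleftrightarrow> (\<exists>a e'. a \<^bold>\<in> A \<and> is_update A e' e i a \<and> pair_in S p e'))))"

definition satisfies :: "'v \<Rightarrow> 'v \<Rightarrow> 'v \<Rightarrow> bool" where
  "satisfies A p e \<longleftrightarrow> (\<exists>S. is_satisfaction A S \<and> pair_in S p e)"

subsection \<open>Definability\<close>

text \<open>
  \<open>X = {z \<in> A. A \<Turnstile> p[z, parameters]}\<close>, where \<open>z\<close> is the value of variable 0 and all parameters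
  satisfy \<open>P\<close>. Assignments are total on \<open>\<omega>\<close>, but a formula has only finitely many free variables,
  so only finitely many parameters matter.
\<close>

definition definable_in :: "'v \<Rightarrow> ('v \<Rightarrow> bool) \<Rightarrow> 'v \<Rightarrow> bool" where
  "definable_in A P X \<longleftrightarrow> (\<exists>p e. is_formula p \<and> is_assignment e A \<and>
     (\<forall>i a. pair_in e i a \<longrightarrow> P a) \<and>
     (\<forall>z. z \<^bold>\<in> X \<longleftrightarrow> z \<^bold>\<in> A \<and> (\<exists>o' e'. is_empty o' \<and> is_update A e' e o' z \<and> satisfies A p e')))"

definition ordinal_definable :: "'v \<Rightarrow> bool" where
  "ordinal_definable X \<longleftrightarrow> (\<exists>l v. is_V v l \<and> definable_in v is_ordinal X)"

definition ordinal_definable_from :: "'v \<Rightarrow> 'v \<Rightarrow> bool" where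
  "ordinal_definable_from x X \<longleftrightarrow> (\<exists>l v. is_V v l \<and> definable_in v (\<lambda>a. is_ordinal a \<or> a = x) X)"

definition is_countable_ordinal_seq :: "'v \<Rightarrow> bool" where
  "is_countable_ordinal_seq x \<longleftrightarrow> (\<exists>d. is_ordinal d \<and> is_countable d \<and> is_fun_on x d) \<and>
     (\<forall>i a. pair_in x i a \<longrightarrow> is_ordinal a)"

definition definable_from_countable_ordinal_seq :: "'v \<Rightarrow> bool" where
  "definable_from_countable_ordinal_seq X \<longleftrightarrow>
     (\<exists>x. is_countable_ordinal_seq x \<and> ordinal_definable_from x X)"

subsection \<open>Games of transfinite length\<close>

definition is_game :: "'v \<Rightarrow> 'v \<Rightarrow> 'v \<Rightarrow> bool" where
  "is_game \<theta> S A \<longleftrightarrow> is_ordinal \<theta> \<and> \<not> is_empty S \<and> (\<forall>p. p \<^bold>\<in> A \<longrightarrow> is_function p \<theta> S)"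

text \<open>\<open>\<alpha> = l + 2n\<close>, witnessed by the sequence \<open>l, l + 2, l + 4, \<dots>, l + 2n\<close>.\<close>

definition is_plus_twice :: "'v \<Rightarrow> 'v \<Rightarrow> 'v \<Rightarrow> bool" where
  "is_plus_twice \<alpha> l n \<longleftrightarrow> (\<exists>d s. is_succ d n \<and> is_fun_on s d \<and>
     (\<forall>z. is_empty z \<longrightarrow> pair_in s z l) \<and>
     (\<forall>k k' \<beta> \<gamma> \<delta>. k \<^bold>\<in> n \<and> is_succ k' k \<and> pair_in s k \<beta> \<and> is_succ \<gamma> \<beta> \<and> is_succ \<delta> \<gamma> \<longrightarrow>
        pair_in s k' \<delta>) \<and>
     pair_in s n \<alpha>)"

definition first_turn :: "'v \<Rightarrow> bool" where
  "first_turn \<alpha> \<longleftrightarrow> (\<exists>l n. (is_empty l \<or> is_limit l) \<and> is_nat n \<and> is_plus_twice \<alpha> l n)"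

definition second_turn :: "'v \<Rightarrow> bool" where
  "second_turn \<alpha> \<longleftrightarrow> (\<exists>\<beta>. first_turn \<beta> \<and> is_succ \<alpha> \<beta>)"

definition is_position :: "('v \<Rightarrow> bool) \<Rightarrow> 'v \<Rightarrow> 'v \<Rightarrow> 'v \<Rightarrow> bool" where
  "is_position turn \<theta> S q \<longleftrightarrow> (\<exists>\<alpha>. \<alpha> \<^bold>\<in> \<theta> \<and> turn \<alpha> \<and> is_function q \<alpha> S)"

definition is_strategy :: "('v \<Rightarrow> bool) \<Rightarrow> 'v \<Rightarrow> 'v \<Rightarrow> 'v \<Rightarrow> bool" where
  "is_strategy turn \<theta> S \<sigma> \<longleftrightarrow>
     (\<forall>z. z \<^bold>\<in> \<sigma> \<longrightarrow> (\<exists>q m. is_position turn \<theta> S q \<and> m \<^bold>\<in> S \<and> is_pair z q m)) \<and>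
     (\<forall>q. is_position turn \<theta> S q \<longrightarrow> (\<exists>!m. pair_in \<sigma> q m))"

definition follows :: "('v \<Rightarrow> bool) \<Rightarrow> 'v \<Rightarrow> 'v \<Rightarrow> 'v \<Rightarrow> bool" where
  "follows turn \<theta> \<sigma> p \<longleftrightarrow> (\<forall>\<alpha> q m. \<alpha> \<^bold>\<in> \<theta> \<and> turn \<alpha> \<and> is_restriction q p \<alpha> \<and> pair_in p \<alpha> m \<longrightarrow>
     pair_in \<sigma> q m)"

definition first_has_winning_strategy :: "'v \<Rightarrow> 'v \<Rightarrow> 'v \<Rightarrow> bool" where
  "first_has_winning_strategy \<theta> S A \<longleftrightarrow> (\<exists>\<sigma>. is_strategy first_turn \<theta> S \<sigma> \<and>
     (\<forall>p. is_function p \<theta> S \<and> follows first_turn \<theta> \<sigma> p \<longrightarrow> p \<^bold>\<in> A))"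

definition second_has_winning_strategy :: "'v \<Rightarrow> 'v \<Rightarrow> 'v \<Rightarrow> bool" where
  "second_has_winning_strategy \<theta> S A \<longleftrightarrow> (\<exists>\<sigma>. is_strategy second_turn \<theta> S \<sigma> \<and>
     (\<forall>p. is_function p \<theta> S \<and> follows second_turn \<theta> \<sigma> p \<longrightarrow> \<not> p \<^bold>\<in> A))"

definition determined :: "'v \<Rightarrow> 'v \<Rightarrow> 'v \<Rightarrow> bool" where
  "determined \<theta> S A \<longleftrightarrow> first_has_winning_strategy \<theta> S A \<or> second_has_winning_strategy \<theta> S A"

definition determinacy_maximum :: bool where
  "determinacy_maximum \<longleftrightarrow> (\<forall>w1 S A. is_omega1 w1 \<and> is_game w1 S A \<and> is_ordinal S \<and>
     ordinal_definable A \<longrightarrow> determined w1 S A)"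

subsection \<open>Perfect trees and perfect sets\<close>

definition closed_under_initial_segments :: "'v \<Rightarrow> bool" where
  "closed_under_initial_segments T \<longleftrightarrow> (\<forall>t \<alpha> \<beta> r. t \<^bold>\<in> T \<and> is_ordinal \<alpha> \<and> is_fun_on t \<alpha> \<and>
     \<beta> \<^bold>\<in> \<alpha> \<and> is_restriction r t \<beta> \<longrightarrow> r \<^bold>\<in> T)"

definition is_chain :: "'v \<Rightarrow> bool" where
  "is_chain b \<longleftrightarrow> (\<forall>s t. s \<^bold>\<in> b \<and> t \<^bold>\<in> b \<longrightarrow> s \<^bold>\<subseteq> t \<or> t \<^bold>\<subseteq> s)"

definition is_binary_tree :: "'v \<Rightarrow> 'v \<Rightarrow> bool" where
  "is_binary_tree \<kappa> T \<longleftrightarrow> closed_under_initial_segments T \<and>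
     (\<forall>t. t \<^bold>\<in> T \<longrightarrow> (\<exists>\<alpha>. \<alpha> \<^bold>\<in> \<kappa> \<and> is_binary_seq t \<alpha>)) \<and>
     (\<forall>\<alpha>. \<alpha> \<^bold>\<in> \<kappa> \<longrightarrow> (\<exists>t. t \<^bold>\<in> T \<and> is_binary_seq t \<alpha>))"

text \<open>
  Paths are full branches, i.e. closed under initial segments: otherwise one could thin out a
  chain so that it avoids branching nodes, and distinct paths could have the same union.
\<close>

definition is_path :: "'v \<Rightarrow> 'v \<Rightarrow> 'v \<Rightarrow> bool" where
  "is_path \<kappa> T b \<longleftrightarrow> b \<^bold>\<subseteq> T \<and> is_chain b \<and> closed_under_initial_segments b \<and>
     (\<exists>f. is_bijection f \<kappa> b \<and>
       (\<forall>\<alpha> \<beta> s t. pair_in f \<alpha> s \<and> pair_in f \<beta> t \<longrightarrow> (\<alpha> \<^bold>\<in> \<beta> \<longleftrightarrow> s \<^bold>\<subseteq> t \<and> s \<noteq> t)))"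

definition branches_at :: "'v \<Rightarrow> 'v \<Rightarrow> bool" where
  "branches_at T t \<longleftrightarrow> (\<exists>\<alpha> \<beta> u v. is_ordinal \<alpha> \<and> is_fun_on t \<alpha> \<and> is_succ \<beta> \<alpha> \<and>
     u \<^bold>\<in> T \<and> is_fun_on u \<beta> \<and> t \<^bold>\<subseteq> u \<and> v \<^bold>\<in> T \<and> is_fun_on v \<beta> \<and> t \<^bold>\<subseteq> v \<and> u \<noteq> v)"

definition is_perfect_tree :: "'v \<Rightarrow> 'v \<Rightarrow> bool" where
  "is_perfect_tree \<kappa> T \<longleftrightarrow> is_binary_tree \<kappa> T \<and>
     (\<forall>c. c \<^bold>\<subseteq> T \<and> is_chain c \<longrightarrow> (\<exists>b. is_path \<kappa> T b \<and> c \<^bold>\<subseteq> b)) \<and>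
     (\<forall>b. is_path \<kappa> T b \<longrightarrow>
        (\<exists>B f. (\<forall>t. t \<^bold>\<in> B \<longleftrightarrow> t \<^bold>\<in> b \<and> branches_at T t) \<and> is_bijection f \<kappa> B))"

definition is_perfect_set :: "'v \<Rightarrow> 'v \<Rightarrow> bool" where
  "is_perfect_set \<kappa> P \<longleftrightarrow> (\<exists>T. is_perfect_tree \<kappa> T \<and>
     (\<forall>x. x \<^bold>\<in> P \<longleftrightarrow> (\<exists>b. is_path \<kappa> T b \<and> is_union x b)))"

end


section \<open>Models of ZFC\<close>

locale zfc = set_universe +
  assumes extensionality: "(\<And>z. z \<^bold>\<in> x \<longleftrightarrow> z \<^bold>\<in> y) \<Longrightarrow> x = y"
    and foundation: "\<not> is_empty x \<Longrightarrow> \<exists>y. y \<^bold>\<in> x \<and> (\<forall>z. z \<^bold>\<in> y \<longrightarrow> \<not> z \<^bold>\<in> x)"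
    and pairing: "\<exists>p. is_upair p x y"
    and union: "\<exists>u. is_union u x"
    and power_set: "\<exists>p. is_power p x"
    and infinity: "\<exists>w. (\<exists>z. is_empty z \<and> z \<^bold>\<in> w) \<and> (\<forall>y. y \<^bold>\<in> w \<longrightarrow> (\<exists>s. is_succ s y \<and> s \<^bold>\<in> w))"
    and separation: "\<exists>y. \<forall>z. z \<^bold>\<in> y \<longleftrightarrow> z \<^bold>\<in> x \<and> sat mem \<phi> (s(0 := z))"
    and replacement: "(\<And>a. a \<^bold>\<in> x \<Longrightarrow> \<exists>!b. sat mem \<phi> (s(0 := a, 1 := b))) \<Longrightarrow>
          \<exists>y. \<forall>b. b \<^bold>\<in> y \<longleftrightarrow> (\<exists>a. a \<^bold>\<in> x \<and> sat mem \<phi> (s(0 := a, 1 := b)))"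
    and choice: "(\<And>y. y \<^bold>\<in> x \<Longrightarrow> \<not> is_empty y) \<Longrightarrow>
          (\<And>y y' z. y \<^bold>\<in> x \<Longrightarrow> y' \<^bold>\<in> x \<Longrightarrow> z \<^bold>\<in> y \<Longrightarrow> z \<^bold>\<in> y' \<Longrightarrow> y = y') \<Longrightarrow>
          \<exists>c. \<forall>y. y \<^bold>\<in> x \<longrightarrow> (\<exists>!z. z \<^bold>\<in> y \<and> z \<^bold>\<in> c)"

end

theory Submission
  imports Defs
begin

text \<open>
  Suppose that \<open>X\<close> is a counterexample. Consider the game in which the second player first names,
  by \<open>\<omega>\<close> moves that are ordinals, some counterexample, and the players then produce a binary sequence
  of length \<open>\<omega>\<^sub>1\<close>, each bit being either played by the first player or left to the second; the
  first player wins if the sequence lies in the named set and uncountably many bits were left to the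
  second player. Since the counterexample is named during the play, the payoff set is ordinal
  definable although \<open>X\<close> is not. If the first player has a winning strategy, its answers to a
  second player who names \<open>X\<close> form a perfect subset of \<open>X\<close>. If the second player has one, it names a
  counterexample \<open>Y\<close>, and against it the first player tries to produce a given element of \<open>Y\<close>, leaving
  a bit to the second player exactly when the answer would be right. Each attempt loses, so from some
  countable stage on the answers are always wrong, and the element is determined by a countable
  initial segment; hence \<open>Y\<close> has at most the cardinality of the continuum. In both cases the named set was
  not a counterexample. Ordinal definability of the payoff set follows from the reflection principle.
\<close>

section \<open>Definability by formulas with parameters\<close>

text \<open>The payoff may use ordinal parameters only. After the second player has supplied the
  countable sequence, what is left of \<open>X\<close> in the game is the level \<open>l\<close> in
  which \<open>X\<close> is defined, the index \<open>n\<close> of its definition in the decoding,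
  and an ordinal \<open>S\<close> that bounds the moves required. Naming a countable object takes
  \<open>om\<close> moves, so \<open>w1\<close> rounds remain. The condition on the number of bits
  left to the second player serves both cases: it makes every path of the tree branch
  \<open>w1\<close> times, and when it fails it leaves a countable bound. The other obstacle is that
  separation and replacement are schemes over first-order formulas, whereas operations are HOL
  functions. Every predicate and operation therefore carries a certificate, \<open>Df\<close> or
  \<open>Tf\<close>, and the rules \<open>defi\<close> derive it from the shape of a term. With
  arbitrary parameters the certificates license comprehension, recursion and induction; with ordinal
  parameters they yield, through reflection, the ordinal definability of the payoff.\<close>

primrec var_bound :: "fm \<Rightarrow> nat" where
  "var_bound (Mem i j) = Suc (max i j)"
| "var_bound (Eq i j) = Suc (max i j)"
| "var_bound (Neg p) = var_bound p"
| "var_bound (Conj p q) = max (var_bound p) (var_bound q)"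
| "var_bound (Ex i p) = max (Suc i) (var_bound p)"

lemma sat_agree: "(\<And>n. n < var_bound p \<Longrightarrow> s n = t n) \<Longrightarrow> sat E p s \<longleftrightarrow> sat E p t"
proof (induction p arbitrary: s t)
  case (Ex i p)
  have "sat E p (s(i := a)) \<longleftrightarrow> sat E p (t(i := a))" for a
    by (rule Ex.IH) (use Ex.prems in auto)
  then show ?case by simp
next
  case (Conj p q)
  have "sat E p s \<longleftrightarrow> sat E p t" by (rule Conj.IH(1)) (use Conj.prems in auto)
  moreover have "sat E q s \<longleftrightarrow> sat E q t" by (rule Conj.IH(2)) (use Conj.prems in auto)
  ultimately show ?case by simp
next
  case (Neg p)
  have "sat E p s \<longleftrightarrow> sat E p t" by (rule Neg.IH) (use Neg.prems in auto)
  then show ?case by simp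
qed (simp_all (no_asm_simp))

text \<open>Renaming along an arbitrary, possibly non-injective \<open>f\<close>. The new bound
  variable \<open>N\<close> exceeds \<open>f n\<close> for every variable \<open>n\<close> of
  \<open>p\<close>, so nothing is captured; the sum is just a convenient upper bound.\<close>

primrec subst_vars :: "fm \<Rightarrow> (nat \<Rightarrow> nat) \<Rightarrow> fm" where
  "subst_vars (Mem i j) f = Mem (f i) (f j)"
| "subst_vars (Eq i j) f = Eq (f i) (f j)"
| "subst_vars (Neg p) f = Neg (subst_vars p f)"
| "subst_vars (Conj p q) f = Conj (subst_vars p f) (subst_vars q f)"
| "subst_vars (Ex i p) f =
     (let N = Suc (\<Sum>n<var_bound p. f n) in Ex N (subst_vars p (f(i := N))))"

lemma sat_subst_vars: "sat E (subst_vars p f) s \<longleftrightarrow> sat E p (\<lambda>n. s (f n))"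
proof (induction p arbitrary: f s)
  case (Ex i p)
  define N where "N = Suc (\<Sum>n<var_bound p. f n)"
  have "f n < N" if "n < var_bound p" for n
    unfolding N_def using that member_le_sum[of n "{..<var_bound p}" f] by (simp add: less_Suc_eq_le)
  then have N: "f n \<noteq> N" if "n < var_bound p" for n
    using that by (metis less_irrefl)
  have "sat E (subst_vars p (f(i := N))) (s(N := a)) \<longleftrightarrow> sat E p ((\<lambda>n. s (f n))(i := a))" for a
    unfolding Ex.IH by (rule sat_agree) (simp add: N)
  then show ?case by (simp only: subst_vars.simps Let_def N_def[symmetric] sat.simps)
qed simp_all

text \<open>A quantifier in the style of de Bruijn: variable 0 of \<open>p\<close> is bound and
  variable \<open>Suc k\<close> becomes \<open>k\<close>. The name \<open>var_bound p\<close> is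
  fresh because the shifted variables stay below it.\<close>

definition ex_shift :: "fm \<Rightarrow> fm" where
  "ex_shift p = (let N = var_bound p in Ex N (subst_vars p (case_nat N (\<lambda>k. k))))"

lemma sat_ex_shift: "sat E (ex_shift p) s \<longleftrightarrow> (\<exists>a. sat E p (case_nat a s))"
proof -
  have "sat E (subst_vars p (case_nat (var_bound p) (\<lambda>k. k))) (s(var_bound p := a)) \<longleftrightarrow> sat E p (case_nat a s)" for a
    unfolding sat_subst_vars by (rule sat_agree) (auto split: nat.split)
  then show ?thesis by (simp only: ex_shift_def Let_def sat.simps)
qed

text \<open>Parameters \<open>r\<close> sit at the even indices and the environment \<open>s\<close>
  at the odd ones, so that both supplies are infinite while one formula refers to finitely many of
  each.\<close>

definition join :: "(nat \<Rightarrow> 'a) \<Rightarrow> (nat \<Rightarrow> 'a) \<Rightarrow> nat \<Rightarrow> 'a" where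
  "join r s n = (if even n then r (n div 2) else s (n div 2))"

lemma join_even [simp]: "join r s (2 * n) = r n" and join_odd [simp]: "join r s (Suc (2 * n)) = s n"
  by (auto simp: join_def)

lemma nat_parity_cases:
  fixes n :: nat
  obtains k where "n = 2 * k" | "n = 1" | k where "n = Suc (2 * Suc k)"
proof (cases "even n")
  case True
  then show ?thesis using that(1) by (elim evenE)
next
  case False
  then obtain m where m: "n = 2 * m + 1" by (elim oddE)
  show ?thesis using that(2,3) m by (cases m) simp_all
qed

named_theorems defi

context zfc
begin

lemma ex_empty: "\<exists>x. is_empty x"
  using infinity by blast

lemma empty_unique: "is_empty x \<Longrightarrow> is_empty y \<Longrightarrow> x = y"
  using extensionality unfolding is_empty_def by blast

definition emp :: 'a where "emp = (THE x. is_empty x)"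

lemma is_empty_emp: "is_empty emp"
  unfolding emp_def by (rule theI') (use ex_empty empty_unique in blast)

lemma is_empty_iff [simp]: "is_empty x \<longleftrightarrow> x = emp"
  using is_empty_emp empty_unique by blast

lemma not_mem_emp [simp]: "\<not> x \<^bold>\<in> emp"
  using is_empty_emp unfolding is_empty_def by blast

lemma is_ordinal_emp [simp]: "is_ordinal emp"
  by (simp add: is_ordinal_def)

text \<open>
  \<open>Df b P\<close>: the predicate \<open>P\<close> on environments is first-order with parameters, which are
  arbitrary if \<open>b\<close> and ordinals otherwise; \<open>Tf b t\<close>: the graph of \<open>t\<close> is such a predicate.
  Under a binder, index 0 is the bound variable.
\<close>

definition Df :: "bool \<Rightarrow> ((nat \<Rightarrow> 'a) \<Rightarrow> bool) \<Rightarrow> bool" where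
  "Df b P \<longleftrightarrow> (\<exists>p r. (\<forall>n. b \<or> is_ordinal (r n)) \<and> (\<forall>s. P s \<longleftrightarrow> sat mem p (join r s)))"

definition Tf :: "bool \<Rightarrow> ((nat \<Rightarrow> 'a) \<Rightarrow> 'a) \<Rightarrow> bool" where
  "Tf b t \<longleftrightarrow> Df b (\<lambda>s. s 0 = t (\<lambda>i. s (Suc i)))"

text \<open>The reindexing \<open>f\<close> is absorbed into the formula by
  \<open>subst_vars\<close>; each closure rule thus only has to say where its variables are to be
  found.\<close>

lemma DfI:
  assumes "\<And>n. b \<or> is_ordinal (r n)" and "\<And>s. P s \<longleftrightarrow> sat mem p (\<lambda>n. join r s (f n))"
  shows "Df b P"
  unfolding Df_def using assms by (intro exI[of _ "subst_vars p f"] exI[of _ r]) (simp add: sat_subst_vars)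

lemma DfE:
  assumes "Df b P"
  obtains p r where "\<And>n. b \<or> is_ordinal (r n)" "\<And>s. P s \<longleftrightarrow> sat mem p (join r s)"
  using assms unfolding Df_def by blast

lemma Df_subst: "Df b P \<Longrightarrow> Df b (\<lambda>s. P (\<lambda>i. s (h i)))"
proof (erule DfE)
  fix p r assume r: "\<And>n. b \<or> is_ordinal (r n)" and P: "\<And>s. P s \<longleftrightarrow> sat mem p (join r s)"
  have "join r (\<lambda>i. s (h i)) = (\<lambda>n. join r s (if even n then n else Suc (2 * h (n div 2))))" for s
    by (rule ext) (simp add: join_def)
  then show "Df b (\<lambda>s. P (\<lambda>i. s (h i)))"
    by (intro DfI[where f = "\<lambda>n. if even n then n else Suc (2 * h (n div 2))" and r = r and p = p]) (simp_all add: r P)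
qed

lemma Df_mem_var: "Df b (\<lambda>s. s i \<^bold>\<in> s j)"
  by (rule DfI[where r = "\<lambda>_. emp" and p = "Mem 0 1" and f = "\<lambda>n. Suc (2 * (if n = 0 then i else j))"]) auto

lemma Df_eq_var: "Df b (\<lambda>s. s i = s j)"
  by (rule DfI[where r = "\<lambda>_. emp" and p = "Eq 0 1" and f = "\<lambda>n. Suc (2 * (if n = 0 then i else j))"]) auto

lemma Df_not [defi]: "Df b P \<Longrightarrow> Df b (\<lambda>s. \<not> P s)"
proof (erule DfE)
  fix p r assume "\<And>n. b \<or> is_ordinal (r n)" "\<And>s. P s \<longleftrightarrow> sat mem p (join r s)"
  then show ?thesis by (intro DfI[where r = r and p = "Neg p" and f = id]) auto
qed

lemma Df_conj [defi]: "Df b P \<Longrightarrow> Df b Q \<Longrightarrow> Df b (\<lambda>s. P s \<and> Q s)"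
proof (elim DfE)
  fix p r q r' assume r: "\<And>n. b \<or> is_ordinal (r n)" and P: "\<And>s. P s \<longleftrightarrow> sat mem p (join r s)"
    and r': "\<And>n. b \<or> is_ordinal (r' n)" and Q: "\<And>s. Q s \<longleftrightarrow> sat mem q (join r' s)"
  \<comment> \<open>The two parameter lists are interleaved: the parameter at an even index
    \<open>n\<close> moves to \<open>2 * n\<close> for \<open>p\<close> and to
    \<open>2 * n + 2\<close> for \<open>q\<close>, while the odd indices, the environment, stay in
    place.\<close>
  have e: "(\<lambda>n. join (join r r') s (if even n then 2 * n else n)) = join r s"
    "(\<lambda>n. join (join r r') s (if even n then 2 * n + 2 else n)) = join r' s" for s
    by (auto simp: join_def fun_eq_iff)
  define p' where "p' = subst_vars p (\<lambda>n. if even n then 2 * n else n)"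
  have p': "sat mem p' s \<longleftrightarrow> sat mem p (\<lambda>n. s (if even n then 2 * n else n))" for s
    unfolding p'_def sat_subst_vars ..
  define q' where "q' = subst_vars q (\<lambda>n. if even n then 2 * n + 2 else n)"
  have q': "sat mem q' s \<longleftrightarrow> sat mem q (\<lambda>n. s (if even n then 2 * n + 2 else n))" for s
    unfolding q'_def sat_subst_vars ..
  have "b \<or> is_ordinal (join r r' n)" for n using r r' by (simp add: join_def)
  then show ?thesis
    by (rule DfI[where r = "join r r'" and p = "Conj p' q'" and f = id]) (simp add: P Q p' q' e)
qed

text \<open>In the premise the bound variable has become index 0 and the old environment is shifted.
  Higher-order unification reads \<open>P\<close> off a goal, so that \<open>intro defi\<close> can
  work through nested binders.\<close>

lemma Df_ex [defi]: "Df b (\<lambda>s. P (\<lambda>i. s (Suc i)) (s 0)) \<Longrightarrow> Df b (\<lambda>s. \<exists>a. P s a)"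
proof (erule DfE)
  fix p r assume r: "\<And>n. b \<or> is_ordinal (r n)"
    and P: "\<And>s. P (\<lambda>i. s (Suc i)) (s 0) \<longleftrightarrow> sat mem p (join r s)"
  have P': "P s a \<longleftrightarrow> sat mem p (join r (case_nat a s))" for s a
    using P[of "case_nat a s"] by simp
  \<comment> \<open>Prefixing the bound value to \<open>join r s\<close> shifts every index by one,
    whereas it should be variable 0 of the environment, that is index 1 of the join. The reindexing
    reconciles the two.\<close>
  define p' where "p' = subst_vars p (\<lambda>n. if even n then Suc n else if n = 1 then 0 else n - 1)"
  have p': "sat mem p' s \<longleftrightarrow> sat mem p (\<lambda>n. s (if even n then Suc n else if n = 1 then 0 else n - 1))" for s
    unfolding p'_def sat_subst_vars ..
  define q where "q = ex_shift p'"
  have q: "sat mem q s \<longleftrightarrow> (\<exists>a. sat mem p' (case_nat a s))" for s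
    unfolding q_def sat_ex_shift ..
  have e: "join r (case_nat a s) = (\<lambda>n. case_nat a (join r s) (if even n then Suc n else if n = 1 then 0 else n - 1))" for a s
  proof
    fix n
    consider k where "n = 2 * k" | "n = 1" | k where "n = Suc (2 * Suc k)"
      by (rule nat_parity_cases)
    then show "join r (case_nat a s) n = case_nat a (join r s) (if even n then Suc n else if n = 1 then 0 else n - 1)"
      by cases (auto simp: join_def)
  qed
  show ?thesis
    by (rule DfI[where r = r and p = q and f = id]) (auto simp: r P' q p' e)
qed

lemma Df_cong: "Df b P \<Longrightarrow> (\<And>s. Q s \<longleftrightarrow> P s) \<Longrightarrow> Df b Q"
  by presburger

lemma Df_disj [defi]: "Df b P \<Longrightarrow> Df b Q \<Longrightarrow> Df b (\<lambda>s. P s \<or> Q s)"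
  by (rule Df_cong[of b "\<lambda>s. \<not> (\<not> P s \<and> \<not> Q s)"]) (intro defi, auto)

lemma Df_imp [defi]: "Df b P \<Longrightarrow> Df b Q \<Longrightarrow> Df b (\<lambda>s. P s \<longrightarrow> Q s)"
  by (rule Df_cong[of b "\<lambda>s. \<not> P s \<or> Q s"]) (intro defi, auto)

lemma Df_iff [defi]: "Df b P \<Longrightarrow> Df b Q \<Longrightarrow> Df b (\<lambda>s. P s \<longleftrightarrow> Q s)"
  by (rule Df_cong[of b "\<lambda>s. (P s \<longrightarrow> Q s) \<and> (Q s \<longrightarrow> P s)"]) (intro defi, auto)

lemma Df_if [defi]: "Df b P \<Longrightarrow> Df b Q \<Longrightarrow> Df b R \<Longrightarrow> Df b (\<lambda>s. if P s then Q s else R s)"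
  by (rule Df_cong[of b "\<lambda>s. (P s \<longrightarrow> Q s) \<and> (\<not> P s \<longrightarrow> R s)"]) (intro defi, auto)

lemma Df_all [defi]: "Df b (\<lambda>s. P (\<lambda>i. s (Suc i)) (s 0)) \<Longrightarrow> Df b (\<lambda>s. \<forall>a. P s a)"
  by (rule Df_cong[of b "\<lambda>s. \<not> (\<exists>a. \<not> P s a)"]) (intro defi, auto)

lemma Tf_var [defi]: "Tf b (\<lambda>s. s i)"
  unfolding Tf_def by (rule Df_eq_var)

lemma Tf_param: "b \<or> is_ordinal c \<Longrightarrow> Tf b (\<lambda>s. c)"
  unfolding Tf_def by (rule DfI[where r = "\<lambda>_. c" and p = "Eq 0 1" and f = "\<lambda>n. if n = 0 then 1 else 0"]) (auto simp: join_def)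

lemma Tf_const: "Tf True (\<lambda>s. c)"
  by (rule Tf_param) simp

lemma Df_let: "Df b (\<lambda>s. P (\<lambda>i. s (Suc i)) (s 0)) \<Longrightarrow> Tf b t \<Longrightarrow> Df b (\<lambda>s. P s (t s))"
  unfolding Tf_def
  by (rule Df_cong[of b "\<lambda>s. \<exists>a. a = t s \<and> P s a"]) (intro defi, auto)

lemma Tf_subst: "Tf b t \<Longrightarrow> Tf b (\<lambda>s. t (\<lambda>i. s (h i)))"
  unfolding Tf_def
  using Df_subst[of b "\<lambda>s. s 0 = t (\<lambda>i. s (Suc i))" "case_nat 0 (\<lambda>i. Suc (h i))"] by simp

lemma Df_shift: "Df b P \<Longrightarrow> Df b (\<lambda>s. P (\<lambda>i. s (Suc i)))"
  by (rule Df_subst)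

lemma Tf_shift: "Tf b t \<Longrightarrow> Tf b (\<lambda>s. t (\<lambda>i. s (Suc i)))"
  by (rule Tf_subst)

lemma Df_let2:
  assumes "Df b (\<lambda>s. P (s 1) (s 0))" "Tf b t" "Tf b u" shows "Df b (\<lambda>s. P (t s) (u s))"
proof (rule Df_let[OF _ assms(2)])
  show "Df b (\<lambda>s. P (s 0) (u (\<lambda>i. s (Suc i))))"
    by (rule Df_let[OF _ Tf_shift[OF assms(3)]]) (use assms(1) in simp)
qed

lemma Df_mem [defi]: "Tf b t \<Longrightarrow> Tf b u \<Longrightarrow> Df b (\<lambda>s. t s \<^bold>\<in> u s)"
  by (rule Df_let2[where P = mem, OF Df_mem_var])

lemma Df_eq [defi]: "Tf b t \<Longrightarrow> Tf b u \<Longrightarrow> Df b (\<lambda>s. t s = u s)"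
  by (rule Df_let2[where P = "(=)", OF Df_eq_var])

text \<open>Simultaneous substitution of definable terms for all variables of a formula. Induction
  on the formula replaces an infinite substitution by finitely many steps.\<close>

lemma Df_sat: "(\<And>n. Tf b (f n)) \<Longrightarrow> Df b (\<lambda>s. sat mem p (\<lambda>n. f n s))"
proof (induction p arbitrary: f)
  case (Ex i p)
  have "Tf b (if n = i then (\<lambda>s. s 0) else (\<lambda>s. f n (\<lambda>i. s (Suc i))))" for n
    using Tf_var Tf_shift[OF Ex.prems] by simp
  from Ex.IH[of "\<lambda>n. if n = i then (\<lambda>s. s 0) else (\<lambda>s. f n (\<lambda>i. s (Suc i)))", OF this]
  have "Df b (\<lambda>s. sat mem p ((\<lambda>n. f n (\<lambda>i. s (Suc i)))(i := s 0)))"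
    by (rule Df_cong) (simp add: fun_upd_def if_distrib[of "\<lambda>g. g _"] cong: if_cong)
  then show ?case unfolding sat.simps by (rule Df_ex)
next
  case (Neg p)
  show ?case unfolding sat.simps by (intro defi Neg.IH Neg.prems)
next
  case (Conj p q)
  show ?case unfolding sat.simps by (intro defi Conj.IH Conj.prems)
qed (simp_all, (intro defi; assumption)+)

text \<open>The parameters of \<open>P\<close> are turned into constant terms, after which the claim
  is an instance of \<open>Df_sat\<close>.\<close>

lemma Df_comp:
  assumes "Df b P" and t: "\<And>i. Tf b (t i)" shows "Df b (\<lambda>s. P (\<lambda>i. t i s))"
proof -
  obtain p r where r: "\<And>n. b \<or> is_ordinal (r n)" and P: "\<And>s. P s \<longleftrightarrow> sat mem p (join r s)"
    using assms(1) by (erule_tac DfE) blast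
  have "Tf b (if even n then (\<lambda>s. r (n div 2)) else t (n div 2))" for n
    using t Tf_param[OF r] by simp
  from Df_sat[of b "\<lambda>n. if even n then (\<lambda>s. r (n div 2)) else t (n div 2)", OF this, of p]
  moreover have "join r (\<lambda>i. t i s) = (\<lambda>n. (if even n then (\<lambda>s. r (n div 2)) else t (n div 2)) s)" for s
    by (simp add: fun_eq_iff join_def)
  ultimately show ?thesis by (simp add: P)
qed

lemma Tf_comp:
  assumes "Tf b F" and t: "\<And>i. Tf b (t i)" shows "Tf b (\<lambda>s. F (\<lambda>i. t i s))"
proof -
  have "Tf b (case i of 0 \<Rightarrow> (\<lambda>s. s 0) | Suc j \<Rightarrow> (\<lambda>s. t j (\<lambda>i. s (Suc i))))" for i
    using Tf_var Tf_shift[OF t] by (cases i) simp_all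
  from Df_comp[OF assms(1)[unfolded Tf_def],
      where t = "case_nat (\<lambda>s. s 0) (\<lambda>j s. t j (\<lambda>i. s (Suc i)))", OF this]
  show ?thesis unfolding Tf_def by simp
qed

lemma Df_comp1: "Df b (\<lambda>s. P (s 0)) \<Longrightarrow> Tf b t \<Longrightarrow> Df b (\<lambda>s. P (t s))"
  by (rule Df_comp[where t = "\<lambda>_. t"])

lemma Df_comp2: "Df b (\<lambda>s. P (s 0) (s 1)) \<Longrightarrow> Tf b t \<Longrightarrow> Tf b u \<Longrightarrow> Df b (\<lambda>s. P (t s) (u s))"
  using Df_comp[of b "\<lambda>s. P (s 0) (s 1)" "\<lambda>i. if i = 0 then t else u"] by simp

lemma Df_comp3: "Df b (\<lambda>s. P (s 0) (s 1) (s 2)) \<Longrightarrow> Tf b t \<Longrightarrow> Tf b u \<Longrightarrow> Tf b v \<Longrightarrow>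
    Df b (\<lambda>s. P (t s) (u s) (v s))"
  using Df_comp[of b "\<lambda>s. P (s 0) (s 1) (s 2)" "\<lambda>i. if i = 0 then t else if i = 1 then u else v"] by simp

lemma Df_comp4: "Df b (\<lambda>s. P (s 0) (s 1) (s 2) (s 3)) \<Longrightarrow> Tf b t \<Longrightarrow> Tf b u \<Longrightarrow> Tf b v \<Longrightarrow> Tf b w \<Longrightarrow>
    Df b (\<lambda>s. P (t s) (u s) (v s) (w s))"
  using Df_comp[of b "\<lambda>s. P (s 0) (s 1) (s 2) (s 3)"
    "\<lambda>i. if i = 0 then t else if i = 1 then u else if i = 2 then v else w"] by simp

lemma Df_comp5: "Df b (\<lambda>s. P (s 0) (s 1) (s 2) (s 3) (s 4)) \<Longrightarrow> Tf b t \<Longrightarrow> Tf b u \<Longrightarrow> Tf b v \<Longrightarrow> Tf b w \<Longrightarrow>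
    Tf b x \<Longrightarrow> Df b (\<lambda>s. P (t s) (u s) (v s) (w s) (x s))"
  using Df_comp[of b "\<lambda>s. P (s 0) (s 1) (s 2) (s 3) (s 4)"
    "\<lambda>i. if i = 0 then t else if i = 1 then u else if i = 2 then v else if i = 3 then w else x"] by simp

lemma Tf_comp1: "Tf b (\<lambda>s. F (s 0)) \<Longrightarrow> Tf b t \<Longrightarrow> Tf b (\<lambda>s. F (t s))"
  by (rule Tf_comp[where t = "\<lambda>_. t"])

lemma Tf_comp2: "Tf b (\<lambda>s. F (s 0) (s 1)) \<Longrightarrow> Tf b t \<Longrightarrow> Tf b u \<Longrightarrow> Tf b (\<lambda>s. F (t s) (u s))"
  using Tf_comp[of b "\<lambda>s. F (s 0) (s 1)" "\<lambda>i. if i = 0 then t else u"] by simp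

lemma Tf_comp3: "Tf b (\<lambda>s. F (s 0) (s 1) (s 2)) \<Longrightarrow> Tf b t \<Longrightarrow> Tf b u \<Longrightarrow> Tf b v \<Longrightarrow>
    Tf b (\<lambda>s. F (t s) (u s) (v s))"
  using Tf_comp[of b "\<lambda>s. F (s 0) (s 1) (s 2)" "\<lambda>i. if i = 0 then t else if i = 1 then u else v"] by simp

lemma Tf_let: "Tf b (\<lambda>s. F (\<lambda>i. s (Suc i)) (s 0)) \<Longrightarrow> Tf b t \<Longrightarrow> Tf b (\<lambda>s. F s (t s))"
proof -
  assume F: "Tf b (\<lambda>s. F (\<lambda>i. s (Suc i)) (s 0))" and t: "Tf b t"
  have "Tf b (case i of 0 \<Rightarrow> t | Suc j \<Rightarrow> (\<lambda>s. s j))" for i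
    using t Tf_var by (cases i) simp_all
  from Tf_comp[OF F, where t = "case_nat t (\<lambda>j s. s j)", OF this] show ?thesis by simp
qed

lemma Df_ex1 [defi]: "Df b (\<lambda>s. P (\<lambda>i. s (Suc i)) (s 0)) \<Longrightarrow> Df b (\<lambda>s. \<exists>!a. P s a)"
proof -
  assume *: "Df b (\<lambda>s. P (\<lambda>i. s (Suc i)) (s 0))"
  have "Df b (\<lambda>s. P (\<lambda>i. s (Suc (Suc i))) (s 0))"
    using Df_subst[OF *, of "case_nat 0 (\<lambda>i. Suc (Suc i))"] by simp
  then have "Df b (\<lambda>s. \<exists>x. P s x \<and> (\<forall>y. P s y \<longrightarrow> y = x))"
    by (intro defi *)
  then show ?thesis unfolding Ex1_def .
qed

text \<open>
  All set-theoretic operations are introduced by \<open>the1\<close>, which has the value \<open>emp\<close> where the description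
  is not unique, so that the rules for \<open>Tf\<close> need no side conditions.
\<close>

definition the1 :: "('a \<Rightarrow> bool) \<Rightarrow> 'a" where
  "the1 P = (if \<exists>!x. P x then THE x. P x else emp)"

lemma the1_eq: "P x \<Longrightarrow> (\<And>y. P y \<Longrightarrow> y = x) \<Longrightarrow> the1 P = x"
  unfolding the1_def by (metis the_equality)

lemma the1_iff: "y = the1 P \<longleftrightarrow> (\<exists>!x. P x) \<and> P y \<or> \<not> (\<exists>!x. P x) \<and> y = emp"
proof (cases "\<exists>!x. P x")
  case True
  then show ?thesis using theI'[of P] the1_equality[of P y] by (auto simp only: the1_def if_True simp_thms)
qed (simp add: the1_def)

lemma Df_is_empty0: "Df b (\<lambda>s. is_empty (s 0))"
  unfolding is_empty_def by (intro defi)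

lemma Tf_emp [defi]: "Tf b (\<lambda>s. emp)"
  using Df_is_empty0 unfolding Tf_def by simp

lemma Tf_the1 [defi]: "Df b (\<lambda>s. P (\<lambda>i. s (Suc i)) (s 0)) \<Longrightarrow> Tf b (\<lambda>s. the1 (P s))"
proof -
  assume *: "Df b (\<lambda>s. P (\<lambda>i. s (Suc i)) (s 0))"
  have 1: "Df b (\<lambda>s. P (\<lambda>i. s (Suc (Suc i))) (s 0))"
    using Df_subst[OF *, of "case_nat 0 (\<lambda>i. Suc (Suc i))"] by simp
  have 2: "Df b (\<lambda>s. \<exists>!x. P (\<lambda>i. s (Suc i)) x)" using Df_shift[OF Df_ex1[OF *]] .
  have "Df b (\<lambda>s. (\<exists>!x. P (\<lambda>i. s (Suc i)) x) \<and> P (\<lambda>i. s (Suc i)) (s 0) \<or> \<not> (\<exists>!x. P (\<lambda>i. s (Suc i)) x) \<and> s 0 = emp)"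
    by (intro defi * 2)
  then show ?thesis unfolding Tf_def
    by (rule Df_cong) (rule the1_iff)
qed

lemma Tf_if [defi]: "Df b P \<Longrightarrow> Tf b t \<Longrightarrow> Tf b u \<Longrightarrow> Tf b (\<lambda>s. if P s then t s else u s)"
  unfolding Tf_def[of b "\<lambda>s. if P s then t s else u s"]
  by (rule Df_cong[of b "\<lambda>s. (P (\<lambda>i. s (Suc i)) \<longrightarrow> s 0 = t (\<lambda>i. s (Suc i))) \<and> (\<not> P (\<lambda>i. s (Suc i)) \<longrightarrow> s 0 = u (\<lambda>i. s (Suc i)))"])
    (intro defi Df_shift Tf_shift, auto)

section \<open>Separation and replacement for certified predicates and terms\<close>

lemma separate:
  assumes "Df b (\<lambda>s. P (s 0))"
  shows "\<exists>y. \<forall>z. z \<^bold>\<in> y \<longleftrightarrow> z \<^bold>\<in> x \<and> P z"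
proof -
  obtain p r where P: "\<And>s. P (s 0) \<longleftrightarrow> sat mem p (join r s)" using assms by (erule_tac DfE) blast
  \<comment> \<open>The scheme keeps the candidate at variable 0, so the parameters move to the
    positive indices and all environment variables are identified with 0.\<close>
  define q where "q = subst_vars p (\<lambda>n. if even n then Suc (n div 2) else 0)"
  have q: "sat mem q s \<longleftrightarrow> sat mem p (\<lambda>n. s (if even n then Suc (n div 2) else 0))" for s
    unfolding q_def sat_subst_vars ..
  define s0 where "s0 = case_nat emp r"
  have "sat mem q (s0(0 := z)) \<longleftrightarrow> P z" for z
  proof -
    have "(\<lambda>n. (s0(0 := z)) (if even n then Suc (n div 2) else 0)) = join r (\<lambda>_. z)"
      by (auto simp: join_def s0_def)
    then show ?thesis using q[of "s0(0 := z)"] P[of "\<lambda>_. z"] by simp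
  qed
  then show ?thesis using separation[of x q s0] by auto
qed

lemma replace:
  assumes "Tf b (\<lambda>s. F (s 0))"
  shows "\<exists>y. \<forall>z. z \<^bold>\<in> y \<longleftrightarrow> (\<exists>a. a \<^bold>\<in> x \<and> z = F a)"
proof -
  obtain p r where P: "\<And>s. s 0 = F (s 1) \<longleftrightarrow> sat mem p (join r s)"
    using assms unfolding Tf_def by (erule_tac DfE) auto
  define q where "q = subst_vars p (\<lambda>n. if even n then n div 2 + 2 else if n = 1 then 1 else 0)"
  have q: "sat mem q s \<longleftrightarrow> sat mem p (\<lambda>n. s (if even n then n div 2 + 2 else if n = 1 then 1 else 0))" for s
    unfolding q_def sat_subst_vars ..
  define s0 where "s0 n = r (n - 2)" for n
  have *: "sat mem q (s0(0 := a, 1 := z)) \<longleftrightarrow> z = F a" for z a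
  proof -
    have "(\<lambda>n. (s0(0 := a, 1 := z)) (if even n then n div 2 + 2 else if n = 1 then 1 else 0)) = join r (\<lambda>n. if n = 0 then z else a)"
    proof
      fix n show "(s0(0 := a, 1 := z)) (if even n then n div 2 + 2 else if n = 1 then 1 else 0) = join r (\<lambda>n. if n = 0 then z else a) n"
        by (cases "n = 1") (auto simp: join_def s0_def elim!: oddE)
    qed
    then show ?thesis using q[of "s0(0 := a, 1 := z)"] P[of "\<lambda>n. if n = 0 then z else a"] by simp
  qed
  show ?thesis using replacement[of x q s0] unfolding * by auto
qed

declare Tf_const [defi]

text \<open>A closed statement has a fixed truth value and is thus equivalent to a trivial formula
  without parameters, even if it mentions arbitrary sets.\<close>

lemma Df_const [defi]: "Df b (\<lambda>s. c)"
  by (cases c) (rule Df_cong[of b "\<lambda>s. s 0 = s 0"], intro defi, simp,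
    rule Df_cong[of b "\<lambda>s. \<not> s 0 = s 0"], intro defi, simp)

lemma Tf_bind: "Tf b (\<lambda>s. F (\<lambda>i. s (Suc i)) (s 0)) \<Longrightarrow> Tf b (\<lambda>s. F (\<lambda>i. s (h i)) (s j))"
  by (drule Tf_subst[where h = "case_nat j h"]) simp

lemma Df_bind: "Df b (\<lambda>s. F (\<lambda>i. s (Suc i)) (s 0)) \<Longrightarrow> Df b (\<lambda>s. F (\<lambda>i. s (h i)) (s j))"
  by (drule Df_subst[where h = "case_nat j h"]) simp

section \<open>First-order form of the notions in the statement\<close>

lemmas Df_is_empty [defi] = Df_comp1[where P = is_empty, OF Df_is_empty0]

text \<open>Each notion gets two rules: the one for variables follows by unfolding, and composition
  extends it to arbitrary terms as arguments.\<close>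

lemma Df_sub0: "Df b (\<lambda>s. sub (s 0) (s 1))"
  unfolding sub_def by (intro defi)
lemmas Df_sub [defi] = Df_comp2[where P = sub, OF Df_sub0]

lemma Df_is_upair0: "Df b (\<lambda>s. is_upair (s 0) (s 1) (s 2))"
  unfolding is_upair_def by (intro defi)
lemmas Df_is_upair [defi] = Df_comp3[where P = is_upair, OF Df_is_upair0]

lemma Df_is_pair0: "Df b (\<lambda>s. is_pair (s 0) (s 1) (s 2))"
  unfolding is_pair_def by (intro defi)
lemmas Df_is_pair [defi] = Df_comp3[where P = is_pair, OF Df_is_pair0]

lemma Df_is_union0: "Df b (\<lambda>s. is_union (s 0) (s 1))"
  unfolding is_union_def by (intro defi)
lemmas Df_is_union [defi] = Df_comp2[where P = is_union, OF Df_is_union0]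

lemma Df_is_power0: "Df b (\<lambda>s. is_power (s 0) (s 1))"
  unfolding is_power_def by (intro defi)
lemmas Df_is_power [defi] = Df_comp2[where P = is_power, OF Df_is_power0]

lemma Df_is_succ0: "Df b (\<lambda>s. is_succ (s 0) (s 1))"
  unfolding is_succ_def by (intro defi)
lemmas Df_is_succ [defi] = Df_comp2[where P = is_succ, OF Df_is_succ0]

lemma Df_is_ordinal0: "Df b (\<lambda>s. is_ordinal (s 0))"
  unfolding is_ordinal_def by (intro defi)
lemmas Df_is_ordinal [defi] = Df_comp1[where P = is_ordinal, OF Df_is_ordinal0]

lemma Df_is_limit0: "Df b (\<lambda>s. is_limit (s 0))"
  unfolding is_limit_def by (intro defi)
lemmas Df_is_limit [defi] = Df_comp1[where P = is_limit, OF Df_is_limit0]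

lemma Df_is_omega0: "Df b (\<lambda>s. is_omega (s 0))"
  unfolding is_omega_def by (intro defi)
lemmas Df_is_omega [defi] = Df_comp1[where P = is_omega, OF Df_is_omega0]

lemma Df_is_nat0: "Df b (\<lambda>s. is_nat (s 0))"
  unfolding is_nat_def by (intro defi)
lemmas Df_is_nat [defi] = Df_comp1[where P = is_nat, OF Df_is_nat0]

lemma Df_pair_in0: "Df b (\<lambda>s. pair_in (s 0) (s 1) (s 2))"
  unfolding pair_in_def by (intro defi)
lemmas Df_pair_in [defi] = Df_comp3[where P = pair_in, OF Df_pair_in0]

lemma Df_is_fun_on0: "Df b (\<lambda>s. is_fun_on (s 0) (s 1))"
  unfolding is_fun_on_def by (intro defi)
lemmas Df_is_fun_on [defi] = Df_comp2[where P = is_fun_on, OF Df_is_fun_on0]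

lemma Df_is_function0: "Df b (\<lambda>s. is_function (s 0) (s 1) (s 2))"
  unfolding is_function_def by (intro defi)
lemmas Df_is_function [defi] = Df_comp3[where P = is_function, OF Df_is_function0]

lemma Df_is_restriction0: "Df b (\<lambda>s. is_restriction (s 0) (s 1) (s 2))"
  unfolding is_restriction_def by (intro defi)
lemmas Df_is_restriction [defi] = Df_comp3[where P = is_restriction, OF Df_is_restriction0]

lemma Df_is_injection0: "Df b (\<lambda>s. is_injection (s 0) (s 1) (s 2))"
  unfolding is_injection_def by (intro defi)
lemmas Df_is_injection [defi] = Df_comp3[where P = is_injection, OF Df_is_injection0]

lemma Df_is_bijection0: "Df b (\<lambda>s. is_bijection (s 0) (s 1) (s 2))"
  unfolding is_bijection_def by (intro defi)
lemmas Df_is_bijection [defi] = Df_comp3[where P = is_bijection, OF Df_is_bijection0]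

lemma Df_is_countable0: "Df b (\<lambda>s. is_countable (s 0))"
  unfolding is_countable_def by (intro defi)
lemmas Df_is_countable [defi] = Df_comp1[where P = is_countable, OF Df_is_countable0]

lemma Df_is_numeral: "Tf b t \<Longrightarrow> Df b (\<lambda>s. is_numeral k (t s))"
proof (induction k arbitrary: t)
  case 0
  then show ?case unfolding is_numeral.simps by (intro defi)
next
  case (Suc k)
  show ?case unfolding is_numeral.simps by (intro defi Suc.IH Tf_shift[OF Suc.prems])
qed

declare Df_is_numeral [defi]

lemma Df_is_binary_seq0: "Df b (\<lambda>s. is_binary_seq (s 0) (s 1))"
  unfolding is_binary_seq_def by (intro defi)
lemmas Df_is_binary_seq [defi] = Df_comp2[where P = is_binary_seq, OF Df_is_binary_seq0]

lemma Df_card_at_most_continuum0: "Df b (\<lambda>s. card_at_most_continuum (s 0))"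
  unfolding card_at_most_continuum_def by (intro defi)
lemmas Df_card_at_most_continuum [defi] = Df_comp1[where P = card_at_most_continuum, OF Df_card_at_most_continuum0]

lemma Df_is_tagged0: "Df b (\<lambda>s. is_tagged k (s 0) (s 1))"
  unfolding is_tagged_def by (intro defi)
lemmas Df_is_tagged [defi] = Df_comp2[where P = "is_tagged k", OF Df_is_tagged0] for k

lemma Df_is_tagged20: "Df b (\<lambda>s. is_tagged2 k (s 0) (s 1) (s 2))"
  unfolding is_tagged2_def by (intro defi)
lemmas Df_is_tagged2 [defi] = Df_comp3[where P = "is_tagged2 k", OF Df_is_tagged20] for k

lemma Df_code_Mem0: "Df b (\<lambda>s. code_Mem (s 0) (s 1) (s 2))"
  unfolding code_Mem_def by (intro defi)
lemmas Df_code_Mem [defi] = Df_comp3[where P = code_Mem, OF Df_code_Mem0]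

lemma Df_code_Eq0: "Df b (\<lambda>s. code_Eq (s 0) (s 1) (s 2))"
  unfolding code_Eq_def by (intro defi)
lemmas Df_code_Eq [defi] = Df_comp3[where P = code_Eq, OF Df_code_Eq0]

lemma Df_code_Neg0: "Df b (\<lambda>s. code_Neg (s 0) (s 1))"
  unfolding code_Neg_def by (intro defi)
lemmas Df_code_Neg [defi] = Df_comp2[where P = code_Neg, OF Df_code_Neg0]

lemma Df_code_Conj0: "Df b (\<lambda>s. code_Conj (s 0) (s 1) (s 2))"
  unfolding code_Conj_def by (intro defi)
lemmas Df_code_Conj [defi] = Df_comp3[where P = code_Conj, OF Df_code_Conj0]

lemma Df_code_Ex0: "Df b (\<lambda>s. code_Ex (s 0) (s 1) (s 2))"
  unfolding code_Ex_def by (intro defi)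
lemmas Df_code_Ex [defi] = Df_comp3[where P = code_Ex, OF Df_code_Ex0]

lemma Df_formula_closed0: "Df b (\<lambda>s. formula_closed (s 0))"
  unfolding formula_closed_def by (intro defi)
lemmas Df_formula_closed [defi] = Df_comp1[where P = formula_closed, OF Df_formula_closed0]

lemma Df_is_formula0: "Df b (\<lambda>s. is_formula (s 0))"
  unfolding is_formula_def by (intro defi)
lemmas Df_is_formula [defi] = Df_comp1[where P = is_formula, OF Df_is_formula0]

lemma Df_is_assignment0: "Df b (\<lambda>s. is_assignment (s 0) (s 1))"
  unfolding is_assignment_def by (intro defi)
lemmas Df_is_assignment [defi] = Df_comp2[where P = is_assignment, OF Df_is_assignment0]

lemma Df_is_update0: "Df b (\<lambda>s. is_update (s 0) (s 1) (s 2) (s 3) (s 4))"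
  unfolding is_update_def by (intro defi)
lemmas Df_is_update [defi] = Df_comp5[where P = is_update, OF Df_is_update0]

lemma Df_is_satisfaction0: "Df b (\<lambda>s. is_satisfaction (s 0) (s 1))"
  unfolding is_satisfaction_def by (intro defi)
lemmas Df_is_satisfaction [defi] = Df_comp2[where P = is_satisfaction, OF Df_is_satisfaction0]

lemma Df_satisfies0: "Df b (\<lambda>s. satisfies (s 0) (s 1) (s 2))"
  unfolding satisfies_def by (intro defi)
lemmas Df_satisfies [defi] = Df_comp3[where P = satisfies, OF Df_satisfies0]

lemma Df_is_plus_twice0: "Df b (\<lambda>s. is_plus_twice (s 0) (s 1) (s 2))"
  unfolding is_plus_twice_def by (intro defi)
lemmas Df_is_plus_twice [defi] = Df_comp3[where P = is_plus_twice, OF Df_is_plus_twice0]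

lemma Df_first_turn0: "Df b (\<lambda>s. first_turn (s 0))"
  unfolding first_turn_def by (intro defi)
lemmas Df_first_turn [defi] = Df_comp1[where P = first_turn, OF Df_first_turn0]

lemma Df_second_turn0: "Df b (\<lambda>s. second_turn (s 0))"
  unfolding second_turn_def by (intro defi)
lemmas Df_second_turn [defi] = Df_comp1[where P = second_turn, OF Df_second_turn0]

lemma Df_closed_under_initial_segments0: "Df b (\<lambda>s. closed_under_initial_segments (s 0))"
  unfolding closed_under_initial_segments_def by (intro defi)
lemmas Df_closed_under_initial_segments [defi] = Df_comp1[where P = closed_under_initial_segments, OF Df_closed_under_initial_segments0]

lemma Df_is_chain0: "Df b (\<lambda>s. is_chain (s 0))"
  unfolding is_chain_def by (intro defi)
lemmas Df_is_chain [defi] = Df_comp1[where P = is_chain, OF Df_is_chain0]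

lemma Df_is_binary_tree0: "Df b (\<lambda>s. is_binary_tree (s 0) (s 1))"
  unfolding is_binary_tree_def by (intro defi)
lemmas Df_is_binary_tree [defi] = Df_comp2[where P = is_binary_tree, OF Df_is_binary_tree0]

lemma Df_is_path0: "Df b (\<lambda>s. is_path (s 0) (s 1) (s 2))"
  unfolding is_path_def by (intro defi)
lemmas Df_is_path [defi] = Df_comp3[where P = is_path, OF Df_is_path0]

lemma Df_branches_at0: "Df b (\<lambda>s. branches_at (s 0) (s 1))"
  unfolding branches_at_def by (intro defi)
lemmas Df_branches_at [defi] = Df_comp2[where P = branches_at, OF Df_branches_at0]

lemma Df_is_perfect_tree0: "Df b (\<lambda>s. is_perfect_tree (s 0) (s 1))"
  unfolding is_perfect_tree_def by (intro defi)
lemmas Df_is_perfect_tree [defi] = Df_comp2[where P = is_perfect_tree, OF Df_is_perfect_tree0]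

lemma Df_is_perfect_set0: "Df b (\<lambda>s. is_perfect_set (s 0) (s 1))"
  unfolding is_perfect_set_def by (intro defi)
lemmas Df_is_perfect_set [defi] = Df_comp2[where P = is_perfect_set, OF Df_is_perfect_set0]

section \<open>Elementary set theory\<close>

lemma set_ext: "(\<And>z. z \<^bold>\<in> x \<longleftrightarrow> z \<^bold>\<in> y) \<Longrightarrow> x = y"
  by (rule extensionality)

lemma subD: "x \<^bold>\<subseteq> y \<Longrightarrow> z \<^bold>\<in> x \<Longrightarrow> z \<^bold>\<in> y" and subI: "(\<And>z. z \<^bold>\<in> x \<Longrightarrow> z \<^bold>\<in> y) \<Longrightarrow> x \<^bold>\<subseteq> y"
  by (auto simp: sub_def)

lemma sub_refl [simp]: "x \<^bold>\<subseteq> x"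
  by (simp add: sub_def)

lemma sub_antisym: "x \<^bold>\<subseteq> y \<Longrightarrow> y \<^bold>\<subseteq> x \<Longrightarrow> x = y"
  by (rule set_ext) (auto simp: sub_def)

lemma sub_trans: "x \<^bold>\<subseteq> y \<Longrightarrow> y \<^bold>\<subseteq> z \<Longrightarrow> x \<^bold>\<subseteq> z"
  by (auto simp: sub_def)

lemma emp_sub [simp]: "emp \<^bold>\<subseteq> x"
  by (simp add: sub_def)

lemma eq_empI: "(\<And>z. \<not> z \<^bold>\<in> x) \<Longrightarrow> x = emp"
  by (rule set_ext) simp

section \<open>Set operations as terms\<close>

definition upair where "upair a b = the1 (\<lambda>p. is_upair p a b)"
definition pr where "pr a b = the1 (\<lambda>p. is_pair p a b)"
definition uni where "uni x = the1 (\<lambda>u. is_union u x)"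
definition pow where "pow x = the1 (\<lambda>p. is_power p x)"
definition suc where "suc x = the1 (\<lambda>s. is_succ s x)"
text \<open>\<open>sep\<close> and \<open>img\<close> accept arbitrary HOL arguments. That the
  described set exists is guaranteed for first-order ones, whence the premises of
  \<open>mem_sep\<close> and \<open>mem_img\<close>.\<close>

definition sep where "sep x P = the1 (\<lambda>y. \<forall>z. z \<^bold>\<in> y \<longleftrightarrow> z \<^bold>\<in> x \<and> P z)"
definition img where "img d F = the1 (\<lambda>y. \<forall>z. z \<^bold>\<in> y \<longleftrightarrow> (\<exists>a. a \<^bold>\<in> d \<and> z = F a))"

lemma Tf_upair [defi]: "Tf b t \<Longrightarrow> Tf b u \<Longrightarrow> Tf b (\<lambda>s. upair (t s) (u s))"
  by (rule Tf_comp2[where F = upair]; (assumption | (unfold upair_def, intro defi)))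
lemma Tf_pr [defi]: "Tf b t \<Longrightarrow> Tf b u \<Longrightarrow> Tf b (\<lambda>s. pr (t s) (u s))"
  by (rule Tf_comp2[where F = pr]; (assumption | (unfold pr_def, intro defi)))
lemma Tf_uni [defi]: "Tf b t \<Longrightarrow> Tf b (\<lambda>s. uni (t s))"
  by (rule Tf_comp1[where F = uni]; (assumption | (unfold uni_def, intro defi)))
lemma Tf_pow [defi]: "Tf b t \<Longrightarrow> Tf b (\<lambda>s. pow (t s))"
  by (rule Tf_comp1[where F = pow]; (assumption | (unfold pow_def, intro defi)))
lemma Tf_suc [defi]: "Tf b t \<Longrightarrow> Tf b (\<lambda>s. suc (t s))"
  by (rule Tf_comp1[where F = suc]; (assumption | (unfold suc_def, intro defi)))
lemma Tf_sep [defi]: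
  assumes "Tf b t" "Df b (\<lambda>s. P (\<lambda>i. s (Suc i)) (s 0))" shows "Tf b (\<lambda>s. sep (t s) (P s))"
  unfolding sep_def by (intro defi Tf_subst[OF assms(1)] Df_bind[where F = P, OF assms(2)])
lemma Tf_img [defi]:
  assumes "Tf b t" "Tf b (\<lambda>s. F (\<lambda>i. s (Suc i)) (s 0))" shows "Tf b (\<lambda>s. img (t s) (F s))"
  unfolding img_def by (intro defi Tf_subst[OF assms(1)] Tf_bind[where F = F, OF assms(2)])

lemma is_upair_iff [simp]: "is_upair p a b \<longleftrightarrow> p = upair a b"
proof -
  obtain q where q: "is_upair q a b" using pairing by blast
  have u: "p = q" if "is_upair p a b" for p
    using that q unfolding is_upair_def by (intro set_ext) simp
  have "upair a b = q" unfolding upair_def by (rule the1_eq) (rule q, erule u)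
  then show ?thesis using u q by blast
qed

lemma mem_upair [simp]: "z \<^bold>\<in> upair a b \<longleftrightarrow> z = a \<or> z = b"
  using is_upair_iff[of "upair a b" a b] unfolding is_upair_def by simp

lemma pr_eq: "is_pair p a b \<longleftrightarrow> p = upair (upair a a) (upair a b)"
  by (simp add: is_pair_def)

lemma is_pair_iff [simp]: "is_pair p a b \<longleftrightarrow> p = pr a b"
  unfolding pr_def pr_eq by (simp add: the1_eq)

lemma pr_upair: "pr a b = upair (upair a a) (upair a b)"
  using is_pair_iff pr_eq by blast

lemma upair_inject: "upair a b = upair c d \<longleftrightarrow> a = c \<and> b = d \<or> a = d \<and> b = c"
proof
  assume "upair a b = upair c d"
  then have "z = a \<or> z = b \<longleftrightarrow> z = c \<or> z = d" for z using mem_upair[of z a b] by simp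
  then show "a = c \<and> b = d \<or> a = d \<and> b = c" by metis
next
  assume "a = c \<and> b = d \<or> a = d \<and> b = c"
  then show "upair a b = upair c d" by (auto intro: set_ext)
qed

lemma pr_inject [simp]: "pr a b = pr c d \<longleftrightarrow> a = c \<and> b = d"
  unfolding pr_upair by (auto simp: upair_inject)

lemma is_union_iff [simp]: "is_union u x \<longleftrightarrow> u = uni x"
proof -
  obtain q where q: "is_union q x" using union by blast
  have u: "p = q" if "is_union p x" for p
    using that q unfolding is_union_def by (intro set_ext) simp
  have "uni x = q" unfolding uni_def by (rule the1_eq) (rule q, erule u)
  then show ?thesis using u q by blast
qed

lemma mem_uni [simp]: "z \<^bold>\<in> uni x \<longleftrightarrow> (\<exists>y. y \<^bold>\<in> x \<and> z \<^bold>\<in> y)"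
  using is_union_iff[of "uni x" x] unfolding is_union_def by simp

lemma mem_uni_upair: "z \<^bold>\<in> uni (upair a b) \<longleftrightarrow> z \<^bold>\<in> a \<or> z \<^bold>\<in> b"
  unfolding mem_uni mem_upair by blast

lemma is_power_iff [simp]: "is_power u x \<longleftrightarrow> u = pow x"
proof -
  obtain q where q: "is_power q x" using power_set by blast
  have u: "p = q" if "is_power p x" for p
    using that q unfolding is_power_def by (intro set_ext) simp
  have "pow x = q" unfolding pow_def by (rule the1_eq) (rule q, erule u)
  then show ?thesis using u q by blast
qed

lemma mem_pow [simp]: "z \<^bold>\<in> pow x \<longleftrightarrow> z \<^bold>\<subseteq> x"
  using is_power_iff[of "pow x" x] unfolding is_power_def by simp

lemma is_succ_iff [simp]: "is_succ u x \<longleftrightarrow> u = suc x"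
proof -
  have "is_succ (uni (upair x (upair x x))) x" by (simp add: is_succ_def mem_uni_upair del: mem_uni)
  then obtain q where q: "is_succ q x" ..
  have u: "p = q" if "is_succ p x" for p
    using that q unfolding is_succ_def by (intro set_ext) simp
  have "suc x = q" unfolding suc_def by (rule the1_eq) (rule q, erule u)
  then show ?thesis using u q by blast
qed

lemma mem_suc [simp]: "z \<^bold>\<in> suc x \<longleftrightarrow> z \<^bold>\<in> x \<or> z = x"
  using is_succ_iff[of "suc x" x] unfolding is_succ_def by simp

lemma mem_sep [simp]:
  assumes "Df True (\<lambda>s. P (s 0))" shows "z \<^bold>\<in> sep x P \<longleftrightarrow> z \<^bold>\<in> x \<and> P z"
proof -
  obtain y where y: "\<forall>z. z \<^bold>\<in> y \<longleftrightarrow> z \<^bold>\<in> x \<and> P z" using separate[OF assms] by blast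
  have "sep x P = y" unfolding sep_def by (rule the1_eq) (simp add: y, rule set_ext, simp add: y)
  then show ?thesis using y by simp
qed

lemma mem_img [simp]:
  assumes "Tf True (\<lambda>s. F (s 0))" shows "z \<^bold>\<in> img x F \<longleftrightarrow> (\<exists>a. a \<^bold>\<in> x \<and> z = F a)"
proof -
  obtain y where y: "\<forall>z. z \<^bold>\<in> y \<longleftrightarrow> (\<exists>a. a \<^bold>\<in> x \<and> z = F a)" using replace[OF assms] by blast
  have "img x F = y" unfolding img_def by (rule the1_eq) (simp add: y, rule set_ext, simp add: y)
  then show ?thesis using y by simp
qed

lemma mem_irrefl [simp]: "\<not> x \<^bold>\<in> x"
proof
  assume "x \<^bold>\<in> x"
  moreover obtain y where "y \<^bold>\<in> upair x x" "\<forall>z. z \<^bold>\<in> y \<longrightarrow> \<not> z \<^bold>\<in> upair x x"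
    using foundation[of "upair x x"] is_empty_iff mem_upair not_mem_emp by metis
  ultimately show False by auto
qed

lemma mem_asym: "x \<^bold>\<in> y \<Longrightarrow> \<not> y \<^bold>\<in> x"
proof
  assume "x \<^bold>\<in> y" "y \<^bold>\<in> x"
  moreover obtain z where "z \<^bold>\<in> upair x y" "\<forall>w. w \<^bold>\<in> z \<longrightarrow> \<not> w \<^bold>\<in> upair x y"
    using foundation[of "upair x y"] is_empty_iff mem_upair not_mem_emp by metis
  ultimately show False by auto
qed

lemma suc_inject [simp]: "suc x = suc y \<longleftrightarrow> x = y"
  using mem_suc mem_asym by metis

lemma suc_neq_emp [simp]: "suc x \<noteq> emp" "emp \<noteq> suc x"
  by (metis mem_suc not_mem_emp)+

text \<open>Foundation applied to the subset cut out by \<open>P\<close>. The ordinal inductions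
  rest on it, which is why they demand a certificate for \<open>P\<close>.\<close>

lemma mem_minimal:
  assumes "a \<^bold>\<in> x" "P a" "Df True (\<lambda>s. P (s 0))"
  obtains m where "m \<^bold>\<in> x" "P m" "\<And>z. z \<^bold>\<in> m \<Longrightarrow> z \<^bold>\<in> x \<Longrightarrow> \<not> P z"
proof -
  have "\<not> is_empty (sep x P)" using assms by (metis is_empty_iff mem_sep not_mem_emp)
  then show ?thesis using foundation[of "sep x P"] that assms(3) by (metis mem_sep)
qed

subsection \<open>Functions\<close>

definition app where "app f a = the1 (\<lambda>y. pr a y \<^bold>\<in> f)"
definition Lam where "Lam d F = img d (\<lambda>a. pr a (F a))"
definition restr where "restr f d = sep f (\<lambda>p. \<exists>a y. a \<^bold>\<in> d \<and> p = pr a y)"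

lemma Tf_app [defi]: "Tf b t \<Longrightarrow> Tf b u \<Longrightarrow> Tf b (\<lambda>s. app (t s) (u s))"
  by (rule Tf_comp2[where F = app]; (assumption | (unfold app_def, intro defi)))
lemma Tf_restr [defi]: "Tf b t \<Longrightarrow> Tf b u \<Longrightarrow> Tf b (\<lambda>s. restr (t s) (u s))"
  by (rule Tf_comp2[where F = restr]; (assumption | (unfold restr_def, intro defi)))
lemma Tf_Lam [defi]: "Tf b t \<Longrightarrow> Tf b (\<lambda>s. F (\<lambda>i. s (Suc i)) (s 0)) \<Longrightarrow> Tf b (\<lambda>s. Lam (t s) (F s))"
  unfolding Lam_def by (intro defi; assumption)

lemma pair_in_iff [simp]: "pair_in f a b \<longleftrightarrow> pr a b \<^bold>\<in> f"
  by (simp add: pair_in_def)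

lemma mem_Lam:
  assumes "Tf True (\<lambda>s. F (s 0))" shows "p \<^bold>\<in> Lam d F \<longleftrightarrow> (\<exists>a. a \<^bold>\<in> d \<and> p = pr a (F a))"
  unfolding Lam_def by (rule mem_img) (intro defi assms)

lemma mem_restr [simp]: "p \<^bold>\<in> restr f d \<longleftrightarrow> p \<^bold>\<in> f \<and> (\<exists>a b. a \<^bold>\<in> d \<and> p = pr a b)"
  unfolding restr_def by (rule mem_sep) (intro defi)

lemma is_restriction_iff [simp]: "is_restriction g f d \<longleftrightarrow> g = restr f d"
  unfolding is_restriction_def by (auto intro: set_ext)

lemma is_fun_on_iff: "is_fun_on f d \<longleftrightarrow>
    (\<forall>p. p \<^bold>\<in> f \<longrightarrow> (\<exists>a b. a \<^bold>\<in> d \<and> p = pr a b)) \<and> (\<forall>a. a \<^bold>\<in> d \<longrightarrow> (\<exists>!b. pr a b \<^bold>\<in> f))"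
proof -
  have "pair_in f = (\<lambda>a b. pr a b \<^bold>\<in> f)" by (simp add: fun_eq_iff)
  then show ?thesis unfolding is_fun_on_def is_pair_iff by presburger
qed

lemma app_eqI:
  assumes f: "is_fun_on f d" and y: "pr a y \<^bold>\<in> f" shows "app f a = y"
  unfolding app_def
proof (rule the1_eq)
  have "a \<^bold>\<in> d" using f y unfolding is_fun_on_iff by fastforce
  then have "\<exists>!y. pr a y \<^bold>\<in> f" using f unfolding is_fun_on_iff by blast
  then show "z = y" if "pr a z \<^bold>\<in> f" for z using that y by blast
qed (rule y)

lemma app_mem:
  assumes f: "is_fun_on f d" and "a \<^bold>\<in> d" shows "pr a (app f a) \<^bold>\<in> f"
proof -
  obtain y where "pr a y \<^bold>\<in> f" using assms unfolding is_fun_on_iff by blast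
  then show ?thesis using app_eqI[OF f] by simp
qed

lemma fun_mem_iff:
  assumes f: "is_fun_on f d" shows "p \<^bold>\<in> f \<longleftrightarrow> (\<exists>a. a \<^bold>\<in> d \<and> p = pr a (app f a))"
proof
  assume p: "p \<^bold>\<in> f"
  then obtain a y where a: "a \<^bold>\<in> d" "p = pr a y" using f unfolding is_fun_on_iff by blast
  then have "app f a = y" using app_eqI[OF f] p by simp
  then show "\<exists>a. a \<^bold>\<in> d \<and> p = pr a (app f a)" using a by auto
qed (auto intro: app_mem[OF f])

lemma fun_pr_iff: "is_fun_on f d \<Longrightarrow> pr a y \<^bold>\<in> f \<longleftrightarrow> a \<^bold>\<in> d \<and> y = app f a"
  by (auto simp: fun_mem_iff)

lemma fun_ext: "is_fun_on f d \<Longrightarrow> is_fun_on g d \<Longrightarrow> (\<And>a. a \<^bold>\<in> d \<Longrightarrow> app f a = app g a) \<Longrightarrow> f = g"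
  by (rule set_ext) (auto simp: fun_mem_iff)

lemma fun_dom_unique: "is_fun_on f d \<Longrightarrow> is_fun_on f d' \<Longrightarrow> d = d'"
proof (rule set_ext)
  fix z assume f: "is_fun_on f d" "is_fun_on f d'"
  show "z \<^bold>\<in> d \<longleftrightarrow> z \<^bold>\<in> d'" using fun_pr_iff[OF f(1), of z "app f z"] fun_pr_iff[OF f(2), of z "app f z"] by simp
qed

lemma is_fun_on_Lam: "Tf True (\<lambda>s. F (s 0)) \<Longrightarrow> is_fun_on (Lam d F) d"
  by (auto simp: is_fun_on_def mem_Lam)

lemma app_Lam: "Tf True (\<lambda>s. F (s 0)) \<Longrightarrow> a \<^bold>\<in> d \<Longrightarrow> app (Lam d F) a = F a"
  by (rule app_eqI[OF is_fun_on_Lam]) (auto simp: mem_Lam)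

lemma is_fun_on_restr: "is_fun_on f d \<Longrightarrow> c \<^bold>\<subseteq> d \<Longrightarrow> is_fun_on (restr f c) c"
proof -
  assume f: "is_fun_on f d" and c: "c \<^bold>\<subseteq> d"
  have 1: "\<exists>!y. pr a y \<^bold>\<in> restr f c" if "a \<^bold>\<in> c" for a
  proof -
    have "\<exists>!y. pr a y \<^bold>\<in> f" using f subD[OF c that] unfolding is_fun_on_iff by blast
    then show ?thesis using that by simp
  qed
  show ?thesis unfolding is_fun_on_iff
  proof (intro conjI allI impI 1)
    fix p assume "p \<^bold>\<in> restr f c" then show "\<exists>a b. a \<^bold>\<in> c \<and> p = pr a b" by simp
  qed
qed

lemma app_restr: "is_fun_on f d \<Longrightarrow> c \<^bold>\<subseteq> d \<Longrightarrow> a \<^bold>\<in> c \<Longrightarrow> app (restr f c) a = app f a"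
  by (rule app_eqI[OF is_fun_on_restr]) (auto simp: fun_pr_iff sub_def)

lemma restr_eq_iff:
  assumes f: "is_fun_on f d" "c \<^bold>\<subseteq> d" and g: "is_fun_on g d'" "c \<^bold>\<subseteq> d'"
  shows "restr f c = restr g c \<longleftrightarrow> (\<forall>a. a \<^bold>\<in> c \<longrightarrow> app f a = app g a)"
proof
  assume "restr f c = restr g c"
  then show "\<forall>a. a \<^bold>\<in> c \<longrightarrow> app f a = app g a" using app_restr[OF f] app_restr[OF g] by simp
next
  assume "\<forall>a. a \<^bold>\<in> c \<longrightarrow> app f a = app g a"
  then show "restr f c = restr g c"
    by (intro fun_ext[OF is_fun_on_restr[OF f] is_fun_on_restr[OF g]]) (simp add: app_restr[OF f] app_restr[OF g])
qed

lemma restr_restr: "c \<^bold>\<subseteq> d \<Longrightarrow> restr (restr f d) c = restr f c"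
  by (rule set_ext) (auto simp: sub_def)

lemma is_function_iff: "is_function f d c \<longleftrightarrow> is_fun_on f d \<and> (\<forall>a. a \<^bold>\<in> d \<longrightarrow> app f a \<^bold>\<in> c)"
  unfolding is_function_def using fun_pr_iff by auto

lemma is_injection_iff: "is_injection f d c \<longleftrightarrow> is_fun_on f d \<and> (\<forall>a. a \<^bold>\<in> d \<longrightarrow> app f a \<^bold>\<in> c) \<and>
    (\<forall>a a'. a \<^bold>\<in> d \<and> a' \<^bold>\<in> d \<and> app f a = app f a' \<longrightarrow> a = a')"
  unfolding is_injection_def is_function_iff using fun_pr_iff by fastforce

lemma is_bijection_iff: "is_bijection f d c \<longleftrightarrow> is_injection f d c \<and> (\<forall>y. y \<^bold>\<in> c \<longrightarrow> (\<exists>a. a \<^bold>\<in> d \<and> y = app f a))"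
  unfolding is_bijection_def is_injection_iff using fun_pr_iff by fastforce

definition Prod where "Prod a b = uni (img a (\<lambda>x. img b (\<lambda>y. pr x y)))"

lemma Tf_Prod [defi]: "Tf b t \<Longrightarrow> Tf b u \<Longrightarrow> Tf b (\<lambda>s. Prod (t s) (u s))"
  by (rule Tf_comp2[where F = Prod]; (assumption | (unfold Prod_def, intro defi)))

lemma mem_Prod [simp]: "p \<^bold>\<in> Prod a b \<longleftrightarrow> (\<exists>x y. x \<^bold>\<in> a \<and> y \<^bold>\<in> b \<and> p = pr x y)"
proof -
  have 1: "z \<^bold>\<in> img b (\<lambda>y. pr x y) \<longleftrightarrow> (\<exists>y. y \<^bold>\<in> b \<and> z = pr x y)" for z x
    by (rule mem_img) (intro defi)
  have "z \<^bold>\<in> img a (\<lambda>x. img b (\<lambda>y. pr x y)) \<longleftrightarrow> (\<exists>x. x \<^bold>\<in> a \<and> z = img b (\<lambda>y. pr x y))" for z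
    by (rule mem_img) (intro defi)
  then show ?thesis unfolding Prod_def using 1 by auto
qed

definition Funs where "Funs d c = sep (pow (Prod d c)) (\<lambda>f. is_function f d c)"

lemma mem_Funs [simp]: "f \<^bold>\<in> Funs d c \<longleftrightarrow> is_function f d c"
proof -
  have "f \<^bold>\<in> Funs d c \<longleftrightarrow> f \<^bold>\<in> pow (Prod d c) \<and> is_function f d c"
    unfolding Funs_def by (rule mem_sep) (intro defi)
  then show ?thesis by (auto simp: sub_def is_function_iff fun_mem_iff)
qed

lemma Tf_Funs [defi]: "Tf b t \<Longrightarrow> Tf b u \<Longrightarrow> Tf b (\<lambda>s. Funs (t s) (u s))"
  by (rule Tf_comp2[where F = Funs]; (assumption | (unfold Funs_def, intro defi)))

subsection \<open>Ordinals\<close>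

text \<open>Excludes a case that arises when the transitivity of an element of an ordinal is derived
  from comparability.\<close>

lemma mem_cycle3: "a \<^bold>\<in> b \<Longrightarrow> b \<^bold>\<in> c \<Longrightarrow> \<not> c \<^bold>\<in> a"
proof
  let ?x = "uni (upair (upair a b) (upair c c))"
  assume *: "a \<^bold>\<in> b" "b \<^bold>\<in> c" "c \<^bold>\<in> a"
  have m: "z \<^bold>\<in> ?x \<longleftrightarrow> z = a \<or> z = b \<or> z = c" for z
    unfolding mem_uni_upair mem_upair by blast
  have "?x \<noteq> emp" using m by (metis not_mem_emp)
  then obtain z where "z \<^bold>\<in> ?x" "\<forall>w. w \<^bold>\<in> z \<longrightarrow> \<not> w \<^bold>\<in> ?x"
    using foundation[of ?x] is_empty_iff by metis
  then show False using * unfolding m by blast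
qed

lemma ord_mem:
  assumes x: "is_ordinal x" and y: "y \<^bold>\<in> x" shows "is_ordinal y"
proof -
  have t: "w \<^bold>\<in> x" if "w \<^bold>\<in> v" "v \<^bold>\<in> x" for v w using x that unfolding is_ordinal_def sub_def by blast
  have l: "v \<^bold>\<in> w \<or> v = w \<or> w \<^bold>\<in> v" if "v \<^bold>\<in> x" "w \<^bold>\<in> x" for v w using x that unfolding is_ordinal_def by blast
  have "z \<^bold>\<in> y" if "w \<^bold>\<in> y" "z \<^bold>\<in> w" for z w
    using l[of z y] that y t mem_asym[of z w] mem_cycle3[of y z w] by blast
  then show ?thesis using l t y unfolding is_ordinal_def sub_def by blast
qed

lemma ord_trans: "is_ordinal z \<Longrightarrow> x \<^bold>\<in> y \<Longrightarrow> y \<^bold>\<in> z \<Longrightarrow> x \<^bold>\<in> z"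
  unfolding is_ordinal_def sub_def by blast

lemma ord_mem_sub: "is_ordinal z \<Longrightarrow> y \<^bold>\<in> z \<Longrightarrow> y \<^bold>\<subseteq> z"
  unfolding is_ordinal_def by blast

text \<open>A minimal element of \<open>y\<close> outside \<open>x\<close> has exactly the elements
  of \<open>x\<close>, hence is \<open>x\<close> itself.\<close>

lemma ord_psub_mem:
  assumes x: "is_ordinal x" and y: "is_ordinal y" and s: "x \<^bold>\<subseteq> y" "x \<noteq> y"
  shows "x \<^bold>\<in> y"
proof -
  obtain a where a: "a \<^bold>\<in> y" "\<not> a \<^bold>\<in> x" using s by (metis set_ext subD)
  obtain m where m: "m \<^bold>\<in> y" "\<not> m \<^bold>\<in> x" "\<And>z. z \<^bold>\<in> m \<Longrightarrow> z \<^bold>\<in> y \<Longrightarrow> \<not> \<not> z \<^bold>\<in> x"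
    by (rule mem_minimal[OF a(1), of "\<lambda>z. \<not> z \<^bold>\<in> x"]) (use a in \<open>auto intro!: defi\<close>)
  have "m = x"
  proof (rule set_ext)
    fix z show "z \<^bold>\<in> m \<longleftrightarrow> z \<^bold>\<in> x"
    proof
      assume "z \<^bold>\<in> m" then show "z \<^bold>\<in> x" using m ord_trans[OF y] by blast
    next
      assume z: "z \<^bold>\<in> x"
      then have "z \<^bold>\<in> y" using s subD by blast
      then have "z \<^bold>\<in> m \<or> z = m \<or> m \<^bold>\<in> z" using y m(1) unfolding is_ordinal_def by blast
      then show "z \<^bold>\<in> m" using z m(2) ord_trans[OF x] by blast
    qed
  qed
  then show ?thesis using m by simp
qed

text \<open>The intersection \<open>i\<close> is an ordinal. If it differed from both, it would be
  an element of both, hence of itself.\<close>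

lemma ord_linear:
  assumes x: "is_ordinal x" and y: "is_ordinal y" shows "x \<^bold>\<in> y \<or> x = y \<or> y \<^bold>\<in> x"
proof -
  define i where "i = sep x (\<lambda>z. z \<^bold>\<in> y)"
  have i: "z \<^bold>\<in> i \<longleftrightarrow> z \<^bold>\<in> x \<and> z \<^bold>\<in> y" for z unfolding i_def by (rule mem_sep) (intro defi)
  have o: "is_ordinal i" using x y unfolding is_ordinal_def sub_def i by blast
  have "i = x \<or> i \<^bold>\<in> x" "i = y \<or> i \<^bold>\<in> y" using ord_psub_mem[OF o x] ord_psub_mem[OF o y] i by (auto simp: sub_def)
  then show ?thesis using i mem_irrefl by blast
qed

lemma ord_sub_iff: "is_ordinal x \<Longrightarrow> is_ordinal y \<Longrightarrow> x \<^bold>\<subseteq> y \<longleftrightarrow> x \<^bold>\<in> y \<or> x = y"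
  using ord_psub_mem ord_mem_sub by auto

lemma ord_not_mem: "is_ordinal x \<Longrightarrow> is_ordinal y \<Longrightarrow> \<not> x \<^bold>\<in> y \<longleftrightarrow> y \<^bold>\<subseteq> x"
  using ord_linear ord_sub_iff mem_asym mem_irrefl by blast

lemma ord_suc [simp]: "is_ordinal (suc x) \<longleftrightarrow> is_ordinal x"
proof
  assume "is_ordinal (suc x)" then show "is_ordinal x" using ord_mem[of "suc x" x] by simp
next
  assume "is_ordinal x" then show "is_ordinal (suc x)" unfolding is_ordinal_def sub_def by auto
qed

lemma ord_setI: "(\<And>y. y \<^bold>\<in> x \<Longrightarrow> is_ordinal y) \<Longrightarrow> (\<And>y z. y \<^bold>\<in> x \<Longrightarrow> z \<^bold>\<in> y \<Longrightarrow> z \<^bold>\<in> x) \<Longrightarrow> is_ordinal x"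
  unfolding is_ordinal_def[of x] sub_def using ord_linear by blast

lemma ord_uni:
  assumes "\<And>y. y \<^bold>\<in> x \<Longrightarrow> is_ordinal y" shows "is_ordinal (uni x)"
proof (rule ord_setI)
  show "is_ordinal z" if "z \<^bold>\<in> uni x" for z using that assms ord_mem by auto
  show "w \<^bold>\<in> uni x" if z: "z \<^bold>\<in> uni x" "w \<^bold>\<in> z" for z w
  proof -
    obtain y where y: "y \<^bold>\<in> x" "z \<^bold>\<in> y" using z by auto
    then have "w \<^bold>\<in> y" using ord_trans[OF assms[OF y(1)] z(2)] by blast
    then show ?thesis using y by auto
  qed
qed

lemma ord_suc_mem: "is_ordinal x \<Longrightarrow> y \<^bold>\<in> x \<Longrightarrow> suc y \<^bold>\<in> x \<or> suc y = x"
  using ord_linear[of "suc y" x] ord_mem[of x y] by (auto dest: mem_asym)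

lemma ord_emp_mem: "is_ordinal x \<Longrightarrow> x \<noteq> emp \<Longrightarrow> emp \<^bold>\<in> x"
  using ord_linear[of emp x] by auto

lemma ord_uni_suc: "is_ordinal x \<Longrightarrow> uni (suc x) = x"
  by (rule set_ext) (auto intro: ord_trans)

lemma is_limit_iff: "is_limit x \<longleftrightarrow> is_ordinal x \<and> x \<noteq> emp \<and> (\<forall>y. y \<^bold>\<in> x \<longrightarrow> suc y \<^bold>\<in> x)"
  unfolding is_limit_def by auto

lemma ord_cases:
  assumes "is_ordinal x"
  obtains "x = emp" | y where "is_ordinal y" "x = suc y" | "is_limit x"
  using assms that ord_suc_mem ord_mem unfolding is_limit_iff by metis

lemma limit_not_suc: "is_limit x \<Longrightarrow> x \<noteq> suc y"
  unfolding is_limit_iff by (metis mem_irrefl mem_suc)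

lemma ord_induct:
  assumes "is_ordinal a" and P: "Df True (\<lambda>s. P (s 0))"
    and step: "\<And>x. is_ordinal x \<Longrightarrow> (\<And>y. y \<^bold>\<in> x \<Longrightarrow> P y) \<Longrightarrow> P x"
  shows "P a"
proof (rule ccontr)
  assume n: "\<not> P a"
  obtain m where m: "m \<^bold>\<in> suc a" "\<not> P m" "\<And>z. z \<^bold>\<in> m \<Longrightarrow> z \<^bold>\<in> suc a \<Longrightarrow> \<not> \<not> P z"
    by (rule mem_minimal[of a "suc a" "\<lambda>z. \<not> P z"]) (use n in \<open>auto intro!: defi P\<close>)
  have o: "is_ordinal (suc a)" using assms(1) by simp
  have "P m" by (rule step) (use m o ord_mem ord_trans[OF o] in blast)+
  then show False using m by blast
qed

lemma ord_least:
  assumes "is_ordinal a" "P a" "Df True (\<lambda>s. P (s 0))"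
  obtains m where "is_ordinal m" "P m" "\<And>z. z \<^bold>\<in> m \<Longrightarrow> \<not> P z" "m \<^bold>\<subseteq> a"
proof -
  obtain m where m: "m \<^bold>\<in> suc a" "P m" "\<And>z. z \<^bold>\<in> m \<Longrightarrow> z \<^bold>\<in> suc a \<Longrightarrow> \<not> P z"
    by (rule mem_minimal[of a "suc a" P]) (use assms in auto)
  have o: "is_ordinal (suc a)" using assms(1) by simp
  show ?thesis
    by (rule that[of m]) (use m o ord_mem ord_trans[OF o] ord_sub_iff[of m a] in auto)
qed

lemma ord_bound: "\<exists>y. is_ordinal y \<and> (\<forall>a. a \<^bold>\<in> x \<and> is_ordinal a \<longrightarrow> a \<^bold>\<in> y)"
proof -
  define o' where "o' = sep x is_ordinal"
  have o': "z \<^bold>\<in> o' \<longleftrightarrow> z \<^bold>\<in> x \<and> is_ordinal z" for z unfolding o'_def by (rule mem_sep) (intro defi)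
  have 1: "is_ordinal (uni o')" by (rule ord_uni) (simp add: o')
  have "a \<^bold>\<in> suc (uni o')" if "a \<^bold>\<in> x" "is_ordinal a" for a
  proof -
    have "a \<^bold>\<subseteq> uni o'" using that o' by (auto simp: sub_def)
    then show ?thesis using ord_sub_iff[OF that(2) 1] by simp
  qed
  then show ?thesis using 1 by (intro exI[of _ "suc (uni o')"]) simp
qed

subsection \<open>The natural numbers\<close>

definition om where "om = the1 is_omega"

lemma Tf_om [defi]: "Tf b (\<lambda>s. om)"
  unfolding om_def by (intro defi)

lemma ex_limit: "\<exists>x. is_limit x"
proof -
  obtain w where w: "emp \<^bold>\<in> w" "\<And>y. y \<^bold>\<in> w \<Longrightarrow> suc y \<^bold>\<in> w" using infinity by auto
  \<comment> \<open>The axiom may provide a set with unwanted elements. Keeping the ordinals all of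
    whose elements are again in \<open>w\<close> leaves a transitive set of ordinals.\<close>
  define l where "l = sep w (\<lambda>z. is_ordinal z \<and> z \<^bold>\<subseteq> w)"
  have l: "z \<^bold>\<in> l \<longleftrightarrow> z \<^bold>\<in> w \<and> is_ordinal z \<and> z \<^bold>\<subseteq> w" for z
    unfolding l_def by (rule mem_sep) (intro defi)
  have "is_ordinal l" by (rule ord_setI) (auto simp: l sub_def intro: ord_mem ord_trans)
  moreover have "emp \<^bold>\<in> l" using w by (simp add: l)
  moreover have "suc y \<^bold>\<in> l" if "y \<^bold>\<in> l" for y using that w by (auto simp: l sub_def)
  ultimately show ?thesis unfolding is_limit_iff by (metis not_mem_emp)
qed

lemma is_omega_unique: "is_omega x \<Longrightarrow> is_omega y \<Longrightarrow> x = y"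
  unfolding is_omega_def is_limit_iff by (metis ord_linear)

lemma is_omega_iff [simp]: "is_omega w \<longleftrightarrow> w = om"
proof -
  obtain l where l: "is_limit l" using ex_limit by blast
  obtain m where "is_limit m" "\<And>z. z \<^bold>\<in> m \<Longrightarrow> \<not> is_limit z"
    by (rule ord_least[of l is_limit]) (use l in \<open>auto intro!: defi simp: is_limit_iff\<close>)
  then have m: "is_omega m" unfolding is_omega_def by blast
  then have "om = m" unfolding om_def by (rule the1_eq) (use is_omega_unique m in blast)
  then show ?thesis using m is_omega_unique by blast
qed

lemma om_limit: "is_limit om"
  using is_omega_iff[of om] unfolding is_omega_def by blast

lemma om_ord [simp]: "is_ordinal om"
  using om_limit unfolding is_limit_iff by blast

lemma emp_om [simp]: "emp \<^bold>\<in> om" and suc_om [intro]: "n \<^bold>\<in> om \<Longrightarrow> suc n \<^bold>\<in> om"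
  using om_limit ord_emp_mem unfolding is_limit_iff by auto

lemma suc_om_iff [simp]: "suc n \<^bold>\<in> om \<longleftrightarrow> n \<^bold>\<in> om"
  using suc_om ord_trans[of om n "suc n"] by auto

lemma om_no_limit: "n \<^bold>\<in> om \<Longrightarrow> \<not> is_limit n"
  using is_omega_iff[of om] unfolding is_omega_def by blast

lemma is_nat_iff [simp]: "is_nat n \<longleftrightarrow> n \<^bold>\<in> om"
  by (simp add: is_nat_def)

lemma om_ordD: "n \<^bold>\<in> om \<Longrightarrow> is_ordinal n"
  using ord_mem om_ord by blast

lemma om_cases:
  assumes "n \<^bold>\<in> om" obtains "n = emp" | m where "m \<^bold>\<in> om" "n = suc m"
  using ord_cases[OF om_ordD[OF assms]] om_no_limit[OF assms] assms by (metis suc_om_iff)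

lemma om_induct:
  assumes "n \<^bold>\<in> om" and P: "Df True (\<lambda>s. P (s 0))" and "P emp" and "\<And>n. n \<^bold>\<in> om \<Longrightarrow> P n \<Longrightarrow> P (suc n)"
  shows "P n"
proof -
  have "n \<^bold>\<in> om \<longrightarrow> P n"
  proof (rule ord_induct[where P = "\<lambda>n. n \<^bold>\<in> om \<longrightarrow> P n"])
    fix x assume IH: "\<And>y. y \<^bold>\<in> x \<Longrightarrow> y \<^bold>\<in> om \<longrightarrow> P y"
    show "x \<^bold>\<in> om \<longrightarrow> P x"
    proof
      assume "x \<^bold>\<in> om" then show "P x" by (cases rule: om_cases) (use IH assms in auto)
    qed
  qed (use om_ordD assms(1) in \<open>auto intro!: defi P\<close>)
  then show ?thesis using assms(1) by blast
qed

primrec num :: "nat \<Rightarrow> 'a" where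
  "num 0 = emp"
| "num (Suc k) = suc (num k)"

lemma is_numeral_iff [simp]: "is_numeral k x \<longleftrightarrow> x = num k"
  by (induction k arbitrary: x) auto

lemma num_om [simp]: "num k \<^bold>\<in> om"
  by (induction k) auto

lemma num_inject [simp]: "num k = num l \<longleftrightarrow> k = l"
proof (induction k arbitrary: l)
  case 0 then show ?case by (cases l) auto
next
  case (Suc k) then show ?case by (cases l) auto
qed

subsection \<open>Transfinite recursion\<close>

definition recfun :: "('a \<Rightarrow> 'a) \<Rightarrow> 'a \<Rightarrow> 'a \<Rightarrow> bool" where
  "recfun G f a \<longleftrightarrow> is_fun_on f a \<and> (\<forall>c. c \<^bold>\<in> a \<longrightarrow> app f c = G (restr f c))"

definition rec :: "('a \<Rightarrow> 'a) \<Rightarrow> 'a \<Rightarrow> 'a" where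
  "rec G a = the1 (\<lambda>y. \<exists>f. recfun G f a \<and> y = G f)"

lemma Tf_rec [defi]:
  assumes "Tf b t" "Tf b (\<lambda>s. G (\<lambda>i. s (Suc i)) (s 0))" shows "Tf b (\<lambda>s. rec (G s) (t s))"
proof -
  have 1: "Tf b (\<lambda>s. G (\<lambda>i. s (h i)) (u s))" if "Tf b u" for h u
    by (rule Tf_let[where F = "\<lambda>s. G (\<lambda>i. s (h i))"]) (use Tf_bind[where F = G, OF assms(2)] that in auto)
  show ?thesis unfolding rec_def recfun_def
    by (intro defi Tf_subst[OF assms(1)] 1)
qed

lemma recfun_unique:
  assumes a: "is_ordinal a" and G: "Tf True (\<lambda>s. G (s 0))" and f: "recfun G f a" "recfun G g a"
  shows "f = g"
proof -
  have fg: "is_fun_on f a" "is_fun_on g a" using f unfolding recfun_def by auto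
  have "c \<^bold>\<in> a \<longrightarrow> app f c = app g c" if "is_ordinal c" for c
  proof (rule ord_induct[OF that, where P = "\<lambda>c. c \<^bold>\<in> a \<longrightarrow> app f c = app g c"])
    fix x assume IH: "\<And>y. y \<^bold>\<in> x \<Longrightarrow> y \<^bold>\<in> a \<longrightarrow> app f y = app g y"
    show "x \<^bold>\<in> a \<longrightarrow> app f x = app g x"
    proof
      assume x: "x \<^bold>\<in> a"
      have "restr f x = restr g x"
        by (subst restr_eq_iff[OF fg(1) ord_mem_sub[OF a x] fg(2) ord_mem_sub[OF a x]]) (use IH ord_trans[OF a _ x] in blast)
      then show "app f x = app g x" using f x unfolding recfun_def by simp
    qed
  qed (intro defi)
  then show ?thesis using fun_ext[OF fg] ord_mem[OF a] by blast
qed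

text \<open>\<open>rec G\<close> is already a total term, so no approximations have to be glued
  together: by induction on \<open>a\<close>, its own graph on \<open>a\<close> is the
  approximation, and \<open>recfun_unique\<close> identifies it with any other.\<close>

lemma rec_aux:
  assumes a: "is_ordinal a" and G: "Tf True (\<lambda>s. G (s 0))"
  shows "recfun G (Lam a (rec G)) a"
proof -
  have T: "Tf True (\<lambda>s. rec G (s 0))" by (intro defi Tf_comp1[where F = G, OF G])
  have fn: "is_fun_on (Lam a (rec G)) a" for a by (rule is_fun_on_Lam[OF T])
  have ap: "c \<^bold>\<in> a \<Longrightarrow> app (Lam a (rec G)) c = rec G c" for a c by (rule app_Lam[OF T])
  show ?thesis
  proof (rule ord_induct[OF a, where P = "\<lambda>a. recfun G (Lam a (rec G)) a"])
    show "Df True (\<lambda>s. recfun G (Lam (s 0) (rec G)) (s 0))"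
      unfolding recfun_def by (intro defi Tf_comp1[where F = G, OF G])
    fix x assume x: "is_ordinal x" and IH: "\<And>y. y \<^bold>\<in> x \<Longrightarrow> recfun G (Lam y (rec G)) y"
    have "rec G c = G (restr (Lam x (rec G)) c)" if c: "c \<^bold>\<in> x" for c
    proof -
      have e: "restr (Lam x (rec G)) c = Lam c (rec G)"
      proof (rule fun_ext[OF is_fun_on_restr[OF fn ord_mem_sub[OF x c]] fn])
        fix y assume y: "y \<^bold>\<in> c"
        show "app (restr (Lam x (rec G)) c) y = app (Lam c (rec G)) y"
          using app_restr[OF fn ord_mem_sub[OF x c] y] ap[OF y] ap[OF ord_trans[OF x y c]] by simp
      qed
      show ?thesis unfolding e rec_def[of G c]
        by (rule the1_eq) (use IH[OF c] recfun_unique[OF ord_mem[OF x c] G] in blast)+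
    qed
    then show "recfun G (Lam x (rec G)) x" unfolding recfun_def by (simp add: fn ap)
  qed
qed

lemma rec_eq:
  assumes a: "is_ordinal a" and G: "Tf True (\<lambda>s. G (s 0))"
  shows "rec G a = G (Lam a (rec G))"
  unfolding rec_def[of G a]
  by (rule the1_eq) (use rec_aux[OF a G] recfun_unique[OF a G] in blast)+

definition dom where "dom f = sep (uni (uni f)) (\<lambda>a. \<exists>y. pr a y \<^bold>\<in> f)"

lemma Tf_dom [defi]: "Tf b t \<Longrightarrow> Tf b (\<lambda>s. dom (t s))"
  by (rule Tf_comp1[where F = dom]; (assumption | (unfold dom_def, intro defi)))

lemma mem_dom: "a \<^bold>\<in> dom f \<longleftrightarrow> (\<exists>y. pr a y \<^bold>\<in> f)"
proof -
  have "a \<^bold>\<in> dom f \<longleftrightarrow> a \<^bold>\<in> uni (uni f) \<and> (\<exists>y. pr a y \<^bold>\<in> f)"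
    unfolding dom_def by (rule mem_sep) (intro defi)
  moreover have "a \<^bold>\<in> uni (uni f)" if "pr a y \<^bold>\<in> f" for y
  proof -
    have "a \<^bold>\<in> upair a a" "upair a a \<^bold>\<in> pr a y" by (simp_all add: pr_upair)
    then show ?thesis using that unfolding mem_uni by blast
  qed
  ultimately show ?thesis by blast
qed

lemma dom_fun: "is_fun_on f d \<Longrightarrow> dom f = d"
  by (rule set_ext) (simp add: mem_dom fun_pr_iff)

text \<open>If \<open>f\<close> has domain \<open>suc n\<close>, then \<open>uni (dom f)\<close> is
  \<open>n\<close>, so the last value is available without a predecessor function.\<close>

definition nrec :: "'a \<Rightarrow> ('a \<Rightarrow> 'a) \<Rightarrow> 'a \<Rightarrow> 'a" where
  "nrec a F n = rec (\<lambda>f. if dom f = emp then a else F (app f (uni (dom f)))) n"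

lemma Tf_nrec [defi]:
  assumes "Tf b t" "Tf b u" "Tf b (\<lambda>s. F (\<lambda>i. s (Suc i)) (s 0))"
  shows "Tf b (\<lambda>s. nrec (t s) (F s) (u s))"
proof -
  have 1: "Tf b (\<lambda>s. F (\<lambda>i. s (h i)) (v s))" if "Tf b v" for h v
    by (rule Tf_let[where F = "\<lambda>s. F (\<lambda>i. s (h i))"]) (use Tf_bind[where F = F, OF assms(3)] that in auto)
  show ?thesis unfolding nrec_def
    by (intro defi Tf_subst[OF assms(1)] assms(2) 1)
qed

lemma
  assumes F: "Tf True (\<lambda>s. F (s 0))"
  shows nrec_emp [simp]: "nrec a F emp = a"
    and nrec_suc: "is_ordinal n \<Longrightarrow> nrec a F (suc n) = F (nrec a F n)"
proof -
  let ?G = "\<lambda>f. if dom f = emp then a else F (app f (uni (dom f)))"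
  have G: "Tf True (\<lambda>s. ?G (s 0))" by (intro defi Tf_comp1[where F = F, OF F])
  have R: "Tf True (\<lambda>s. rec ?G (s 0))" by (intro defi Tf_comp1[where F = F, OF F])
  have d: "dom (Lam k (rec ?G)) = k" for k by (rule dom_fun[OF is_fun_on_Lam[OF R]])
  have eq: "nrec a F k = ?G (Lam k (rec ?G))" if "is_ordinal k" for k
    unfolding nrec_def by (rule rec_eq[OF that G])
  show "nrec a F emp = a" using eq[of emp] d[of emp] by simp
  assume n: "is_ordinal n"
  have "app (Lam (suc n) (rec ?G)) n = rec ?G n" by (rule app_Lam[OF R]) simp
  then show "nrec a F (suc n) = F (nrec a F n)" using eq[of "suc n"] n by (simp add: d ord_uni_suc nrec_def)
qed

section \<open>Least witnesses and collection\<close>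

definition leastord :: "('a \<Rightarrow> bool) \<Rightarrow> 'a" where
  "leastord P = the1 (\<lambda>a. is_ordinal a \<and> P a \<and> (\<forall>z. z \<^bold>\<in> a \<longrightarrow> \<not> P z))"

lemma Tf_leastord [defi]:
  assumes "Df b (\<lambda>s. P (\<lambda>i. s (Suc i)) (s 0))" shows "Tf b (\<lambda>s. leastord (P s))"
  unfolding leastord_def by (intro defi Df_bind[where F = P, OF assms] assms)

lemma leastord:
  assumes a: "is_ordinal a" "P a" and P: "Df True (\<lambda>s. P (s 0))"
  shows "is_ordinal (leastord P)" "P (leastord P)" "leastord P \<^bold>\<subseteq> a" "z \<^bold>\<in> leastord P \<Longrightarrow> \<not> P z"
proof -
  obtain m where m: "is_ordinal m" "P m" "\<And>z. z \<^bold>\<in> m \<Longrightarrow> \<not> P z" "m \<^bold>\<subseteq> a"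
    by (rule ord_least[OF a P]) blast
  have "leastord P = m" unfolding leastord_def
  proof (rule the1_eq)
    fix y assume "is_ordinal y \<and> P y \<and> (\<forall>z. z \<^bold>\<in> y \<longrightarrow> \<not> P z)"
    then show "y = m" using m ord_linear[of y m] by blast
  qed (use m in blast)
  then show "is_ordinal (leastord P)" "P (leastord P)" "leastord P \<^bold>\<subseteq> a" "z \<^bold>\<in> leastord P \<Longrightarrow> \<not> P z"
    using m by auto
qed

text \<open>Collection from replacement: the least witness is a definable function of
  \<open>y\<close>, and the set of its values has an ordinal bound.\<close>

lemma collect_ord:
  assumes ex: "\<And>y. y \<^bold>\<in> x \<Longrightarrow> \<exists>a. is_ordinal a \<and> P y a" and P: "Df True (\<lambda>s. P (s 0) (s 1))"
  shows "\<exists>c. is_ordinal c \<and> (\<forall>y. y \<^bold>\<in> x \<longrightarrow> (\<exists>a. a \<^bold>\<in> c \<and> P y a))"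
proof -
  have P2: "Df True (\<lambda>s. P (t s) (u s))" if "Tf True t" "Tf True u" for t u
    by (rule Df_comp2[where P = P, OF P that])
  have T: "Tf True (\<lambda>s. leastord (P (s 0)))" by (intro defi P2)
  obtain c where c: "is_ordinal c" "\<forall>a. a \<^bold>\<in> img x (\<lambda>y. leastord (P y)) \<and> is_ordinal a \<longrightarrow> a \<^bold>\<in> c"
    using ord_bound by blast
  have "\<exists>a. a \<^bold>\<in> c \<and> P y a" if y: "y \<^bold>\<in> x" for y
  proof -
    obtain a where a: "is_ordinal a" "P y a" using ex[OF y] by blast
    have D: "Df True (\<lambda>s. P y (s 0))" by (intro P2 defi)
    have "leastord (P y) \<^bold>\<in> img x (\<lambda>y. leastord (P y))" unfolding mem_img[OF T] using y by blast
    then show ?thesis using c leastord[OF a D] by blast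
  qed
  then show ?thesis using c by blast
qed

definition un where "un a b = uni (upair a b)"

lemma Tf_un [defi]: "Tf b t \<Longrightarrow> Tf b u \<Longrightarrow> Tf b (\<lambda>s. un (t s) (u s))"
  by (rule Tf_comp2[where F = un]; (assumption | (unfold un_def, intro defi)))

lemma mem_un [simp]: "z \<^bold>\<in> un a b \<longleftrightarrow> z \<^bold>\<in> a \<or> z \<^bold>\<in> b"
  unfolding un_def by (rule mem_uni_upair)

lemma ord_un: "is_ordinal a \<Longrightarrow> is_ordinal b \<Longrightarrow> is_ordinal (un a b)"
  unfolding un_def by (rule ord_uni) auto

lemma un_left: "a \<^bold>\<subseteq> un a b" and un_right: "b \<^bold>\<subseteq> un a b"
  by (auto simp: sub_def)

lemma ord_sub_mem: "is_ordinal a \<Longrightarrow> is_ordinal c \<Longrightarrow> a \<^bold>\<subseteq> b \<Longrightarrow> b \<^bold>\<in> c \<Longrightarrow> a \<^bold>\<in> c"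
  using ord_sub_iff[of a b] ord_mem[of c b] ord_trans[of c a b] by blast

lemma un_cases: "is_ordinal a \<Longrightarrow> is_ordinal b \<Longrightarrow> un a b = a \<or> un a b = b"
proof -
  assume a: "is_ordinal a" "is_ordinal b"
  have "a \<^bold>\<subseteq> b \<or> b \<^bold>\<subseteq> a" using ord_linear[OF a] ord_sub_iff a by auto
  then show ?thesis by (auto simp: sub_def intro!: set_ext)
qed

section \<open>The cumulative hierarchy\<close>

text \<open>One clause covers zero, successors and limits; agreement with the usual three clauses is
  \<open>is_V_iff\<close>.\<close>

definition V where "V a = rec (\<lambda>f. uni (img (dom f) (\<lambda>c. pow (app f c)))) a"

lemma Tf_V [defi]: "Tf b t \<Longrightarrow> Tf b (\<lambda>s. V (t s))"
  by (rule Tf_comp1[where F = V]; (assumption | (unfold V_def, intro defi)))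

lemma mem_V: "is_ordinal a \<Longrightarrow> z \<^bold>\<in> V a \<longleftrightarrow> (\<exists>c. c \<^bold>\<in> a \<and> z \<^bold>\<subseteq> V c)"
proof -
  assume a: "is_ordinal a"
  let ?G = "\<lambda>f. uni (img (dom f) (\<lambda>c. pow (app f c)))"
  have G: "Tf True (\<lambda>s. ?G (s 0))" by (intro defi)
  have R: "Tf True (\<lambda>s. rec ?G (s 0))" by (intro defi)
  have e: "V a = ?G (Lam a (rec ?G))" unfolding V_def by (rule rec_eq[OF a G])
  have d: "dom (Lam a (rec ?G)) = a" by (rule dom_fun[OF is_fun_on_Lam[OF R]])
  have I: "Tf True (\<lambda>s. pow (app (Lam a (rec ?G)) (s 0)))" by (intro defi)
  have ap: "app (Lam a (rec ?G)) c = V c" if "c \<^bold>\<in> a" for c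
    unfolding V_def by (rule app_Lam[OF R that])
  have "z \<^bold>\<in> V a \<longleftrightarrow> (\<exists>y. (\<exists>c. c \<^bold>\<in> a \<and> y = pow (app (Lam a (rec ?G)) c)) \<and> z \<^bold>\<in> y)"
    unfolding e d mem_uni mem_img[OF I] ..
  also have "\<dots> \<longleftrightarrow> (\<exists>c. c \<^bold>\<in> a \<and> z \<^bold>\<subseteq> V c)" using ap by force
  finally show ?thesis .
qed

lemma V_mono: "is_ordinal a \<Longrightarrow> is_ordinal b \<Longrightarrow> a \<^bold>\<subseteq> b \<Longrightarrow> V a \<^bold>\<subseteq> V b"
  by (rule subI) (auto simp: mem_V dest: subD)

lemma V_mono_mem: "is_ordinal b \<Longrightarrow> a \<^bold>\<in> b \<Longrightarrow> V a \<^bold>\<subseteq> V b"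
  using V_mono ord_mem ord_mem_sub by blast

lemma V_trans: "is_ordinal a \<Longrightarrow> z \<^bold>\<in> V a \<Longrightarrow> w \<^bold>\<in> z \<Longrightarrow> w \<^bold>\<in> V a"
  unfolding mem_V using V_mono_mem mem_V subD by metis

lemma V_emp: "V emp = emp"
  by (rule eq_empI) (simp add: mem_V)

lemma V_suc: "is_ordinal a \<Longrightarrow> V (suc a) = pow (V a)"
proof (rule set_ext)
  fix z assume a: "is_ordinal a"
  then have "z \<^bold>\<in> V (suc a) \<longleftrightarrow> (\<exists>c. (c \<^bold>\<in> a \<or> c = a) \<and> z \<^bold>\<subseteq> V c)" by (simp add: mem_V)
  also have "\<dots> \<longleftrightarrow> z \<^bold>\<subseteq> V a" using V_mono_mem[OF a] sub_trans by blast
  finally show "z \<^bold>\<in> V (suc a) \<longleftrightarrow> z \<^bold>\<in> pow (V a)" by simp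
qed

lemma mem_V_limit: "is_limit l \<Longrightarrow> z \<^bold>\<in> V l \<longleftrightarrow> (\<exists>c. c \<^bold>\<in> l \<and> z \<^bold>\<in> V c)"
proof
  assume l: "is_limit l" and z: "z \<^bold>\<in> V l"
  then obtain c where "c \<^bold>\<in> l" "z \<^bold>\<subseteq> V c" using mem_V is_limit_iff by blast
  then show "\<exists>c. c \<^bold>\<in> l \<and> z \<^bold>\<in> V c" using l V_suc[of c] ord_mem[of l c] unfolding is_limit_iff by (intro exI[of _ "suc c"]) simp
next
  assume l: "is_limit l" and "\<exists>c. c \<^bold>\<in> l \<and> z \<^bold>\<in> V c"
  then show "z \<^bold>\<in> V l" using V_mono_mem[of l] subD unfolding is_limit_iff by blast
qed

lemma ord_sub_V: "is_ordinal a \<Longrightarrow> a \<^bold>\<subseteq> V a"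
proof (rule ord_induct[where P = "\<lambda>a. a \<^bold>\<subseteq> V a"])
  fix x assume x: "is_ordinal x" and IH: "\<And>y. y \<^bold>\<in> x \<Longrightarrow> y \<^bold>\<subseteq> V y"
  show "x \<^bold>\<subseteq> V x" by (rule subI) (use IH mem_V[OF x] in blast)
qed (auto intro!: defi)

lemma ord_mem_V_suc: "is_ordinal a \<Longrightarrow> a \<^bold>\<in> V (suc a)"
  using ord_sub_V by (simp add: V_suc)

lemma ex_V_of_elems:
  assumes "\<And>y. y \<^bold>\<in> x \<Longrightarrow> \<exists>a. is_ordinal a \<and> y \<^bold>\<in> V a"
  shows "\<exists>a. is_ordinal a \<and> x \<^bold>\<in> V a"
proof -
  have D: "Df True (\<lambda>s. is_ordinal (s 1) \<and> s 0 \<^bold>\<in> V (s 1))" by (intro defi)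
  obtain c where c: "is_ordinal c" "\<forall>y. y \<^bold>\<in> x \<longrightarrow> (\<exists>a. a \<^bold>\<in> c \<and> is_ordinal a \<and> y \<^bold>\<in> V a)"
    using collect_ord[of x "\<lambda>y a. is_ordinal a \<and> y \<^bold>\<in> V a", OF _ D] assms by blast
  have "x \<^bold>\<subseteq> V c" by (rule subI) (use c V_mono_mem subD in blast)
  then show ?thesis using c by (intro exI[of _ "suc c"]) (simp add: V_suc)
qed

text \<open>A set outside the hierarchy has an element outside it. A minimal such element of the
  transitive closure \<open>T\<close> of \<open>x\<close> contradicts
  \<open>ex_V_of_elems\<close>.\<close>

lemma ex_V: "\<exists>a. is_ordinal a \<and> x \<^bold>\<in> V a"
proof (rule ccontr)
  assume n: "\<not> ?thesis"
  let ?P = "\<lambda>y. \<exists>a. is_ordinal a \<and> y \<^bold>\<in> V a"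
  have U: "Tf True (\<lambda>s. uni (s 0))" by (intro defi)
  have N: "Tf True (\<lambda>s. nrec x uni (s 0))" by (intro defi)
  define T where "T = uni (img om (nrec x uni))"
  have T: "z \<^bold>\<in> T \<longleftrightarrow> (\<exists>n. n \<^bold>\<in> om \<and> z \<^bold>\<in> nrec x uni n)" for z
    unfolding T_def mem_uni mem_img[OF N] by blast
  have tr: "w \<^bold>\<in> T" if wz: "w \<^bold>\<in> z" "z \<^bold>\<in> T" for w z
  proof -
    obtain n where n: "n \<^bold>\<in> om" "z \<^bold>\<in> nrec x uni n" using wz T by blast
    then have "w \<^bold>\<in> nrec x uni (suc n)" using wz nrec_suc[OF U om_ordD[OF n(1)]] by auto
    then show ?thesis using n T by blast
  qed
  obtain y where y: "y \<^bold>\<in> x" "\<not> ?P y" using ex_V_of_elems n by blast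
  have "y \<^bold>\<in> T" unfolding T by (rule exI[of _ emp]) (simp add: U y)
  then obtain m where m: "m \<^bold>\<in> T" "\<not> ?P m" "\<And>z. z \<^bold>\<in> m \<Longrightarrow> z \<^bold>\<in> T \<Longrightarrow> \<not> \<not> ?P z"
    by (rule mem_minimal[of y T "\<lambda>z. \<not> ?P z"]) (use y in \<open>auto intro!: defi\<close>)
  then have "?P m" using ex_V_of_elems[of m] tr by blast
  then show False using m by blast
qed

lemma is_V_iff: "is_V v l \<longleftrightarrow> is_ordinal l \<and> v = V l"
proof
  assume v: "is_V v l"
  then have l: "is_ordinal l" unfolding is_V_def by blast
  then have sl: "is_ordinal (suc l)" by simp
  obtain f where f: "is_fun_on f (suc l)" "pr l v \<^bold>\<in> f" and c: "\<And>a u. pr a u \<^bold>\<in> f \<Longrightarrow>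
      (a = emp \<longrightarrow> u = emp) \<and> (\<forall>b w. a = suc b \<and> pr b w \<^bold>\<in> f \<longrightarrow> u = pow w) \<and>
      (is_limit a \<longrightarrow> (\<forall>z. z \<^bold>\<in> u \<longleftrightarrow> (\<exists>b w. b \<^bold>\<in> a \<and> pr b w \<^bold>\<in> f \<and> z \<^bold>\<in> w)))"
    using v unfolding is_V_def by auto
  have "a \<^bold>\<in> suc l \<longrightarrow> app f a = V a" if a: "is_ordinal a" for a
  proof (rule ord_induct[OF a, where P = "\<lambda>a. a \<^bold>\<in> suc l \<longrightarrow> app f a = V a"])
    fix x assume x: "is_ordinal x" and IH0: "\<And>y. y \<^bold>\<in> x \<Longrightarrow> y \<^bold>\<in> suc l \<longrightarrow> app f y = V y"
    show "x \<^bold>\<in> suc l \<longrightarrow> app f x = V x"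
    proof
      assume xl: "x \<^bold>\<in> suc l"
      have IH: "pr y u \<^bold>\<in> f \<longleftrightarrow> u = V y" if "y \<^bold>\<in> x" for y u
        using IH0[OF that] ord_trans[OF sl that xl] fun_pr_iff[OF f(1)] by auto
      note cx = c[OF app_mem[OF f(1) xl]]
      show "app f x = V x"
      proof (cases rule: ord_cases[OF x])
        case 1 then show ?thesis using cx V_emp by simp
      next
        case (2 y) then show ?thesis using cx IH[of y "V y"] V_suc by simp
      next
        case 3
        show ?thesis
        proof (rule set_ext)
          fix z
          have "z \<^bold>\<in> app f x \<longleftrightarrow> (\<exists>b w. b \<^bold>\<in> x \<and> pr b w \<^bold>\<in> f \<and> z \<^bold>\<in> w)" using cx 3 by blast
          also have "\<dots> \<longleftrightarrow> (\<exists>b. b \<^bold>\<in> x \<and> z \<^bold>\<in> V b)" by (simp add: IH cong: conj_cong)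
          finally show "z \<^bold>\<in> app f x \<longleftrightarrow> z \<^bold>\<in> V x" using mem_V_limit[OF 3] by blast
        qed
      qed
    qed
  qed (intro defi)
  then have "app f l = V l" using l by simp
  then show "is_ordinal l \<and> v = V l" using l app_eqI[OF f] by simp
next
  assume "is_ordinal l \<and> v = V l"
  then have l: "is_ordinal l" and v: "v = V l" by auto
  have T: "Tf True (\<lambda>s. V (s 0))" by (intro defi)
  define f where "f = Lam (suc l) V"
  have f: "is_fun_on f (suc l)" unfolding f_def by (rule is_fun_on_Lam[OF T])
  have pf: "pr a u \<^bold>\<in> f \<longleftrightarrow> a \<^bold>\<in> suc l \<and> u = V a" for a u
    unfolding f_def mem_Lam[OF T] by auto
  have o: "is_ordinal a" if "a \<^bold>\<in> suc l" for a using that l ord_mem by auto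
  have tr: "c \<^bold>\<in> suc l" if "c \<^bold>\<in> a" "a \<^bold>\<in> suc l" for c a using ord_trans[of "suc l"] that l by simp
  have "(a = emp \<longrightarrow> u = emp) \<and> (\<forall>b w. a = suc b \<and> pr b w \<^bold>\<in> f \<longrightarrow> u = pow w) \<and>
      (is_limit a \<longrightarrow> (\<forall>z. z \<^bold>\<in> u \<longleftrightarrow> (\<exists>b w. b \<^bold>\<in> a \<and> pr b w \<^bold>\<in> f \<and> z \<^bold>\<in> w)))" if "pr a u \<^bold>\<in> f" for a u
  proof -
    have a: "a \<^bold>\<in> suc l" "u = V a" using that pf by auto
    have 1: "\<forall>b w. a = suc b \<and> pr b w \<^bold>\<in> f \<longrightarrow> u = pow w"
      unfolding pf using a o V_suc by metis
    have 2: "z \<^bold>\<in> u \<longleftrightarrow> (\<exists>b w. b \<^bold>\<in> a \<and> pr b w \<^bold>\<in> f \<and> z \<^bold>\<in> w)" if "is_limit a" for z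
      unfolding pf a(2) mem_V_limit[OF that] using tr a by blast
    show ?thesis using 1 2 a V_emp by auto
  qed
  then show "is_V v l" unfolding is_V_def
    using l f pf v by (intro conjI exI[of _ f] exI[of _ "suc l"]) auto
qed

section \<open>The reflection principle\<close>

primrec satr :: "'a \<Rightarrow> fm \<Rightarrow> (nat \<Rightarrow> 'a) \<Rightarrow> bool" where
  "satr A (Mem i j) s \<longleftrightarrow> s i \<^bold>\<in> s j"
| "satr A (Eq i j) s \<longleftrightarrow> s i = s j"
| "satr A (Neg p) s \<longleftrightarrow> \<not> satr A p s"
| "satr A (Conj p q) s \<longleftrightarrow> satr A p s \<and> satr A q s"
| "satr A (Ex i p) s \<longleftrightarrow> (\<exists>a. a \<^bold>\<in> A \<and> satr A p (s(i := a)))"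

lemma Funs_update:
  assumes e: "e \<^bold>\<in> Funs om A" and a: "a \<^bold>\<in> A" and i: "i \<^bold>\<in> om"
  shows "\<exists>e'. e' \<^bold>\<in> Funs om A \<and> app e' i = a \<and> (\<forall>j. j \<^bold>\<in> om \<and> j \<noteq> i \<longrightarrow> app e' j = app e j)"
proof -
  have T: "Tf True (\<lambda>s. if s 0 = i then a else app e (s 0))" by (intro defi)
  show ?thesis
    by (rule exI[of _ "Lam om (\<lambda>j. if j = i then a else app e j)"])
      (use assms in \<open>auto simp: is_function_iff is_fun_on_Lam[OF T] app_Lam[OF T]\<close>)
qed

text \<open>An environment of the metatheory need not be an element of the model. Finitely many of
  its values can be copied into one, which suffices for a single formula.\<close>

lemma ex_assignment:
  assumes "x \<^bold>\<in> A" "\<And>n. n < N \<Longrightarrow> s n \<^bold>\<in> A"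
  shows "\<exists>e. e \<^bold>\<in> Funs om A \<and> (\<forall>n<N. app e (num n) = s n)"
  using assms(2)
proof (induction N)
  case 0
  have T: "Tf True (\<lambda>s. x)" by (intro defi)
  show ?case
    by (rule exI[of _ "Lam om (\<lambda>_. x)"]) (use assms(1) in \<open>auto simp: is_function_iff is_fun_on_Lam[OF T] app_Lam[OF T]\<close>)
next
  case (Suc N)
  then obtain e where e: "e \<^bold>\<in> Funs om A" "\<forall>n<N. app e (num n) = s n" by auto
  obtain e' where "e' \<^bold>\<in> Funs om A" "app e' (num N) = s N" "\<forall>j. j \<^bold>\<in> om \<and> j \<noteq> num N \<longrightarrow> app e' j = app e j"
    using Funs_update[OF e(1) Suc.prems[of N] num_om[of N]] by auto
  then show ?case using e(2) by (intro exI[of _ e']) (auto simp: less_Suc_eq)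
qed

text \<open>The limit \<open>l\<close> may have countable cofinality, so the values of an infinite
  environment need not all appear at one stage below \<open>l\<close>; finitely many do.\<close>

lemma finitely_many_in_V_limit:
  fixes s :: "nat \<Rightarrow> 'a"
  assumes l: "is_limit l" and s: "\<And>n. s n \<^bold>\<in> V l"
  shows "\<exists>a. a \<^bold>\<in> l \<and> emp \<^bold>\<in> V a \<and> (\<forall>n<N. s n \<^bold>\<in> V a)"
proof (induction N)
  case 0
  have "emp \<^bold>\<in> l" using l unfolding is_limit_iff by (intro ord_emp_mem) simp_all
  then have "suc emp \<^bold>\<in> l" using l unfolding is_limit_iff by simp
  then show ?case using ord_mem_V_suc[OF is_ordinal_emp] by (intro exI[of _ "suc emp"]) simp
next
  case (Suc N)
  then obtain a where a: "a \<^bold>\<in> l" "emp \<^bold>\<in> V a" "\<forall>n<N. s n \<^bold>\<in> V a" by blast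
  obtain c where c: "c \<^bold>\<in> l" "s N \<^bold>\<in> V c" using s[of N] mem_V_limit[OF l] by blast
  have o: "is_ordinal a" "is_ordinal c" using a c l ord_mem unfolding is_limit_iff by blast+
  have "un a c \<^bold>\<in> l" using un_cases[OF o] a c by auto
  moreover have "V a \<^bold>\<subseteq> V (un a c)" "V c \<^bold>\<subseteq> V (un a c)"
    using V_mono ord_un o un_left un_right by blast+
  ultimately show ?case using a c subD by (intro exI[of _ "un a c"]) (auto simp: less_Suc_eq)
qed

text \<open>Reflection is a scheme, so the induction is over external formulas. \<open>G a\<close>
  bounds the stages at which the quantifiers of \<open>p\<close> find witnesses for parameters in
  \<open>V a\<close>; monotonicity makes it easy to produce ordinals closed under
  \<open>G\<close>.\<close>

lemma reflection_bound:
  "\<exists>G. Tf True (\<lambda>s. G (s 0)) \<and> (\<forall>a. is_ordinal a \<longrightarrow> is_ordinal (G a)) \<and>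
     (\<forall>a c. is_ordinal a \<and> is_ordinal c \<and> a \<^bold>\<subseteq> c \<longrightarrow> G a \<^bold>\<subseteq> G c) \<and>
     (\<forall>l s. is_limit l \<and> (\<forall>a. a \<^bold>\<in> l \<longrightarrow> G a \<^bold>\<in> l) \<and> (\<forall>n. s n \<^bold>\<in> V l) \<longrightarrow> (satr (V l) p s \<longleftrightarrow> sat mem p s))"
proof (induction p)
  case (Mem i j)
  show ?case by (rule exI[of _ "\<lambda>a. a"]) (auto intro: Tf_var)
next
  case (Eq i j)
  show ?case by (rule exI[of _ "\<lambda>a. a"]) (auto intro: Tf_var)
next
  case (Neg p)
  then show ?case unfolding sat.simps satr.simps by presburger
next
  case (Conj p q)
  obtain G where G: "Tf True (\<lambda>s. G (s 0))" "\<forall>a. is_ordinal a \<longrightarrow> is_ordinal (G a)"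
     "\<forall>a c. is_ordinal a \<and> is_ordinal c \<and> a \<^bold>\<subseteq> c \<longrightarrow> G a \<^bold>\<subseteq> G c"
     "\<forall>l s. is_limit l \<and> (\<forall>a. a \<^bold>\<in> l \<longrightarrow> G a \<^bold>\<in> l) \<and> (\<forall>n. s n \<^bold>\<in> V l) \<longrightarrow> (satr (V l) p s \<longleftrightarrow> sat mem p s)"
    using Conj.IH(1) by blast
  obtain H where H: "Tf True (\<lambda>s. H (s 0))" "\<forall>a. is_ordinal a \<longrightarrow> is_ordinal (H a)"
     "\<forall>a c. is_ordinal a \<and> is_ordinal c \<and> a \<^bold>\<subseteq> c \<longrightarrow> H a \<^bold>\<subseteq> H c"
     "\<forall>l s. is_limit l \<and> (\<forall>a. a \<^bold>\<in> l \<longrightarrow> H a \<^bold>\<in> l) \<and> (\<forall>n. s n \<^bold>\<in> V l) \<longrightarrow> (satr (V l) q s \<longleftrightarrow> sat mem q s)"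
    using Conj.IH(2) by blast
  let ?K = "\<lambda>a. un (G a) (H a)"
  have 1: "Tf True (\<lambda>s. ?K (s 0))" by (intro defi G(1) H(1))
  have 2: "is_ordinal (?K a)" if "is_ordinal a" for a using that G(2) H(2) ord_un by blast
  have 3: "?K a \<^bold>\<subseteq> ?K c" if "is_ordinal a" "is_ordinal c" "a \<^bold>\<subseteq> c" for a c
  proof -
    have "G a \<^bold>\<subseteq> G c" "H a \<^bold>\<subseteq> H c" using that G(3) H(3) by blast+
    then show ?thesis by (auto simp: sub_def)
  qed
  have 4: "satr (V l) (Conj p q) s \<longleftrightarrow> sat mem (Conj p q) s"
    if l: "is_limit l" and cl: "\<forall>a. a \<^bold>\<in> l \<longrightarrow> ?K a \<^bold>\<in> l" and s: "\<forall>n. s n \<^bold>\<in> V l" for l s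
  proof -
    have ol: "is_ordinal l" using l unfolding is_limit_iff by blast
    have "G a \<^bold>\<in> l \<and> H a \<^bold>\<in> l" if a: "a \<^bold>\<in> l" for a
    proof -
      have "is_ordinal (G a)" "is_ordinal (H a)" using ord_mem[OF ol a] G(2) H(2) by blast+
      then show ?thesis using ord_sub_mem[OF _ ol un_left] ord_sub_mem[OF _ ol un_right] cl a by blast
    qed
    then show ?thesis using G(4) H(4) l s by simp
  qed
  show ?case using 1 2 3 4 by (intro exI[of _ ?K]) blast
next
  case (Ex i p)
  obtain G where G: "Tf True (\<lambda>s. G (s 0))" "\<forall>a. is_ordinal a \<longrightarrow> is_ordinal (G a)"
     "\<forall>a c. is_ordinal a \<and> is_ordinal c \<and> a \<^bold>\<subseteq> c \<longrightarrow> G a \<^bold>\<subseteq> G c"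
     "\<forall>l s. is_limit l \<and> (\<forall>a. a \<^bold>\<in> l \<longrightarrow> G a \<^bold>\<in> l) \<and> (\<forall>n. s n \<^bold>\<in> V l) \<longrightarrow> (satr (V l) p s \<longleftrightarrow> sat mem p s)"
    using Ex.IH by blast
  \<comment> \<open>Variable \<open>i\<close> is set to \<open>x\<close> and the others are read off
    an internal assignment, which turns quantification over environments into quantification over a
    set.\<close>
  define R where "R e x = sat mem p (\<lambda>n. if n = i then x else app e (num n))" for e x
  have DR: "Df True (\<lambda>s. R (t s) (u s))" if "Tf True t" "Tf True u" for t u
  proof -
    define g :: "nat \<Rightarrow> (nat \<Rightarrow> 'a) \<Rightarrow> 'a" where "g n = (if n = i then (\<lambda>s. s 1) else (\<lambda>s. app (s 0) (num n)))" for n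
    have T: "Tf True (g n)" for n unfolding g_def by (cases "n = i") (simp_all, (intro defi)+)
    have "R (s 0) (s 1) \<longleftrightarrow> sat mem p (\<lambda>n. g n s)" for s
      unfolding R_def g_def if_distribR ..
    then have "Df True (\<lambda>s. R (s 0) (s 1))"
      by (rule Df_cong[OF Df_sat[of True g p, OF T]])
    then show ?thesis using that by (rule Df_comp2[where P = R])
  qed
  define Q where "Q a c \<longleftrightarrow> (\<forall>e. e \<^bold>\<in> Funs om (V a) \<longrightarrow> (\<exists>x. R e x) \<longrightarrow> (\<exists>x. x \<^bold>\<in> V c \<and> R e x))" for a c
  have DQ: "Df True (\<lambda>s. Q (t s) (u s))" if "Tf True t" "Tf True u" for t u
  proof -
    have "Df True (\<lambda>s. Q (s 0) (s 1))" unfolding Q_def by (intro defi DR)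
    then show ?thesis using that by (rule Df_comp2[where P = Q])
  qed
  have exQ: "\<exists>c. is_ordinal c \<and> Q a c" for a
  proof -
    have D: "Df True (\<lambda>s. (\<exists>x. R (s 0) x) \<longrightarrow> (\<exists>x. x \<^bold>\<in> V (s 1) \<and> R (s 0) x))" by (intro defi DR)
    have "\<exists>c. is_ordinal c \<and> ((\<exists>x. R e x) \<longrightarrow> (\<exists>x. x \<^bold>\<in> V c \<and> R e x))" for e
      using ex_V is_ordinal_emp by blast
    then obtain d where d: "is_ordinal d"
      "\<forall>e. e \<^bold>\<in> Funs om (V a) \<longrightarrow> (\<exists>c. c \<^bold>\<in> d \<and> ((\<exists>x. R e x) \<longrightarrow> (\<exists>x. x \<^bold>\<in> V c \<and> R e x)))"
      using collect_ord[of "Funs om (V a)" "\<lambda>e c. (\<exists>x. R e x) \<longrightarrow> (\<exists>x. x \<^bold>\<in> V c \<and> R e x)", OF _ D] by blast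
    have "Q a d" unfolding Q_def
    proof (intro allI impI)
      fix e assume e: "e \<^bold>\<in> Funs om (V a)" "\<exists>x. R e x"
      then obtain c x where "c \<^bold>\<in> d" "x \<^bold>\<in> V c" "R e x" using d(2) by blast
      then show "\<exists>x. x \<^bold>\<in> V d \<and> R e x" using V_mono_mem[OF d(1)] subD by blast
    qed
    then show ?thesis using d by blast
  qed
  \<comment> \<open>The least stage with witnesses for all assignments into \<open>V a\<close>.
    Leastness gives monotonicity, as a stage good for a larger level is good for a smaller
    one.\<close>
  define H where "H a = leastord (Q a)" for a
  have TH: "Tf True (\<lambda>s. H (s 0))" unfolding H_def by (intro defi DQ)
  have DQ1: "Df True (\<lambda>s. Q a (s 0))" for a by (intro defi DQ)
  have H: "is_ordinal (H a)" "Q a (H a)" "is_ordinal c \<Longrightarrow> Q a c \<Longrightarrow> H a \<^bold>\<subseteq> c" for a c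
  proof -
    obtain d where "is_ordinal d" "Q a d" using exQ by blast
    then show "is_ordinal (H a)" "Q a (H a)" unfolding H_def using leastord(1,2)[OF _ _ DQ1] by blast+
    show "is_ordinal c \<Longrightarrow> Q a c \<Longrightarrow> H a \<^bold>\<subseteq> c" unfolding H_def using leastord(3)[OF _ _ DQ1] by blast
  qed
  have Hmono: "H a \<^bold>\<subseteq> H c" if "is_ordinal a" "is_ordinal c" "a \<^bold>\<subseteq> c" for a c
  proof (rule H(3)[OF H(1)])
    have "V a \<^bold>\<subseteq> V c" by (rule V_mono[OF that])
    then have "e \<^bold>\<in> Funs om (V c)" if "e \<^bold>\<in> Funs om (V a)" for e
      using that by (auto simp: is_function_iff sub_def)
    then show "Q a (H c)" using H(2)[of c] unfolding Q_def by blast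
  qed
  let ?K = "\<lambda>a. un (G a) (H a)"
  have 1: "Tf True (\<lambda>s. ?K (s 0))" by (intro defi G(1) TH)
  have 2: "is_ordinal (?K a)" if "is_ordinal a" for a using that G(2) H(1) ord_un by blast
  have 3: "?K a \<^bold>\<subseteq> ?K c" if "is_ordinal a" "is_ordinal c" "a \<^bold>\<subseteq> c" for a c
  proof -
    have "G a \<^bold>\<subseteq> G c" "H a \<^bold>\<subseteq> H c" using that G(3) Hmono by blast+
    then show ?thesis by (auto simp: sub_def)
  qed
  have 4: "satr (V l) (Ex i p) s \<longleftrightarrow> sat mem (Ex i p) s"
    if l: "is_limit l" and cl: "\<forall>a. a \<^bold>\<in> l \<longrightarrow> ?K a \<^bold>\<in> l" and s: "\<forall>n. s n \<^bold>\<in> V l" for l s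
  proof -
    have ol: "is_ordinal l" using l unfolding is_limit_iff by blast
    have K: "G a \<^bold>\<in> l \<and> H a \<^bold>\<in> l" if a: "a \<^bold>\<in> l" for a
    proof -
      have "is_ordinal (G a)" "is_ordinal (H a)" using ord_mem[OF ol a] G(2) H(1) by blast+
      then show ?thesis using ord_sub_mem[OF _ ol un_left] ord_sub_mem[OF _ ol un_right] cl a by blast
    qed
    have eq: "satr (V l) p (s(i := x)) \<longleftrightarrow> sat mem p (s(i := x))" if "x \<^bold>\<in> V l" for x
    proof -
      have "\<forall>n. (s(i := x)) n \<^bold>\<in> V l" using s that by simp
      then show ?thesis using G(4) l K by blast
    qed
    have "\<exists>x. x \<^bold>\<in> V l \<and> sat mem p (s(i := x))" if x: "sat mem p (s(i := x))" for x
    proof -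
      obtain a where a: "a \<^bold>\<in> l" "emp \<^bold>\<in> V a" "\<forall>n<var_bound p. s n \<^bold>\<in> V a"
        using finitely_many_in_V_limit[OF l, of s] s by blast
      obtain e where e: "e \<^bold>\<in> Funs om (V a)" "\<forall>n<var_bound p. app e (num n) = s n"
        using ex_assignment[OF a(2), of "var_bound p" s] a(3) by blast
      have Re: "R e y \<longleftrightarrow> sat mem p (s(i := y))" for y
        unfolding R_def by (rule sat_agree) (use e in simp)
      then obtain y where "y \<^bold>\<in> V (H a)" "R e y" using H(2)[of a] e(1) x unfolding Q_def by blast
      then show ?thesis using Re K[OF a(1)] V_mono_mem[OF ol] subD by blast
    qed
    then show ?thesis unfolding sat.simps satr.simps using eq by blast
  qed
  show ?case using 1 2 3 4 by (intro exI[of _ ?K]) blast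
qed

lemma ex_closed_limit:
  assumes TG: "Tf True (\<lambda>s. G (s 0))" and oG: "\<And>a. is_ordinal a \<Longrightarrow> is_ordinal (G a)"
    and mG: "\<And>a c. is_ordinal a \<Longrightarrow> is_ordinal c \<Longrightarrow> a \<^bold>\<subseteq> c \<Longrightarrow> G a \<^bold>\<subseteq> G c" and a0: "is_ordinal a0"
  shows "\<exists>l. is_limit l \<and> a0 \<^bold>\<in> l \<and> (\<forall>a. a \<^bold>\<in> l \<longrightarrow> G a \<^bold>\<in> l)"
proof -
  \<comment> \<open>The union with \<open>c\<close> makes the sequence increase even where
    \<open>G c\<close> lies below \<open>c\<close>, and the successor makes the supremum a
    limit.\<close>
  let ?F = "\<lambda>c. suc (un (G c) c)"
  have F: "Tf True (\<lambda>s. ?F (s 0))" by (intro defi TG)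
  define c where "c n = nrec (suc a0) ?F n" for n
  have Tc: "Tf True (\<lambda>s. c (s 0))" unfolding c_def by (intro defi Tf_comp1[where F = G, OF TG])
  have c0: "c emp = suc a0" unfolding c_def by (rule nrec_emp[OF F])
  have cs: "c (suc n) = suc (un (G (c n)) (c n))" if "n \<^bold>\<in> om" for n
    unfolding c_def by (rule nrec_suc[OF F om_ordD[OF that]])
  have co: "is_ordinal (c n)" if "n \<^bold>\<in> om" for n
    by (rule om_induct[OF that, where P = "\<lambda>n. is_ordinal (c n)"])
      (use a0 in \<open>auto intro!: defi Tc simp: c0 cs oG ord_un\<close>)
  define l where "l = uni (img om c)"
  have l: "z \<^bold>\<in> l \<longleftrightarrow> (\<exists>n. n \<^bold>\<in> om \<and> z \<^bold>\<in> c n)" for z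
    unfolding l_def mem_uni mem_img[OF Tc] by blast
  have ol: "is_ordinal l" unfolding l_def by (rule ord_uni) (use co in \<open>auto simp: mem_img[OF Tc]\<close>)
  have step: "z \<^bold>\<in> l" if "is_ordinal z" "n \<^bold>\<in> om" "z \<^bold>\<subseteq> un (G (c n)) (c n)" for z n
  proof -
    have "is_ordinal (un (G (c n)) (c n))" using co[OF that(2)] oG ord_un by blast
    then have "z \<^bold>\<in> c (suc n)" using cs[OF that(2)] that ord_sub_iff by simp
    then show ?thesis using l that(2) by blast
  qed
  have a0l: "a0 \<^bold>\<in> l" unfolding l using c0 by (intro exI[of _ emp]) simp
  have sucl: "suc z \<^bold>\<in> l" if z: "z \<^bold>\<in> l" for z
  proof -
    obtain n where n: "n \<^bold>\<in> om" "z \<^bold>\<in> c n" using z l by blast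
    have "suc z \<^bold>\<subseteq> c n" using n ord_mem_sub[OF co[OF n(1)] n(2)] by (auto simp: sub_def)
    then have "suc z \<^bold>\<subseteq> un (G (c n)) (c n)" by (rule sub_trans[OF _ un_right])
    then show ?thesis by (intro step[OF _ n(1)]) (simp_all add: ord_mem[OF ol z])
  qed
  have Gl: "G z \<^bold>\<in> l" if z: "z \<^bold>\<in> l" for z
  proof -
    obtain n where n: "n \<^bold>\<in> om" "z \<^bold>\<in> c n" using z l by blast
    have oz: "is_ordinal z" by (rule ord_mem[OF ol z])
    have "G z \<^bold>\<subseteq> G (c n)" by (rule mG[OF oz co[OF n(1)] ord_mem_sub[OF co[OF n(1)] n(2)]])
    then show ?thesis using step[OF oG[OF oz] n(1)] un_left sub_trans by blast
  qed
  have "l \<noteq> emp" using a0l by auto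
  then show ?thesis using a0l sucl Gl ol unfolding is_limit_iff by blast
qed

theorem reflection:
  assumes "is_ordinal a0"
  shows "\<exists>l. is_limit l \<and> a0 \<^bold>\<in> l \<and> (\<forall>s. (\<forall>n. s n \<^bold>\<in> V l) \<longrightarrow> (satr (V l) p s \<longleftrightarrow> sat mem p s))"
proof -
  obtain G where G: "Tf True (\<lambda>s. G (s 0))" "\<forall>a. is_ordinal a \<longrightarrow> is_ordinal (G a)"
     "\<forall>a c. is_ordinal a \<and> is_ordinal c \<and> a \<^bold>\<subseteq> c \<longrightarrow> G a \<^bold>\<subseteq> G c"
     "\<forall>l s. is_limit l \<and> (\<forall>a. a \<^bold>\<in> l \<longrightarrow> G a \<^bold>\<in> l) \<and> (\<forall>n. s n \<^bold>\<in> V l) \<longrightarrow> (satr (V l) p s \<longleftrightarrow> sat mem p s)"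
    using reflection_bound[of p] by blast
  obtain l where "is_limit l" "a0 \<^bold>\<in> l" "\<forall>a. a \<^bold>\<in> l \<longrightarrow> G a \<^bold>\<in> l"
    using ex_closed_limit[OF G(1) _ _ assms] G(2,3) by blast
  then show ?thesis using G(4) by blast
qed

section \<open>Coded formulas and ordinal definability\<close>

lemma code_simps:
  "is_tagged k c a \<longleftrightarrow> c = pr (num k) a"
  "is_tagged2 k c a d \<longleftrightarrow> c = pr (num k) (pr a d)"
  by (simp_all add: is_tagged_def is_tagged2_def)

lemma code_iffs [simp]:
  "code_Mem c i j \<longleftrightarrow> i \<^bold>\<in> om \<and> j \<^bold>\<in> om \<and> c = pr (num 0) (pr i j)"
  "code_Eq c i j \<longleftrightarrow> i \<^bold>\<in> om \<and> j \<^bold>\<in> om \<and> c = pr (num 1) (pr i j)"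
  "code_Neg c p \<longleftrightarrow> c = pr (num 2) p"
  "code_Conj c p q \<longleftrightarrow> c = pr (num 3) (pr p q)"
  "code_Ex c i p \<longleftrightarrow> i \<^bold>\<in> om \<and> c = pr (num 4) (pr i p)"
  unfolding code_Mem_def code_Eq_def code_Neg_def code_Conj_def code_Ex_def code_simps is_nat_iff by (rule refl)+

lemma formula_closed_iff: "formula_closed F \<longleftrightarrow>
    (\<forall>i j. i \<^bold>\<in> om \<longrightarrow> j \<^bold>\<in> om \<longrightarrow> pr (num 0) (pr i j) \<^bold>\<in> F \<and> pr (num 1) (pr i j) \<^bold>\<in> F) \<and>
    (\<forall>p. p \<^bold>\<in> F \<longrightarrow> pr (num 2) p \<^bold>\<in> F \<and> (\<forall>q. q \<^bold>\<in> F \<longrightarrow> pr (num 3) (pr p q) \<^bold>\<in> F) \<and>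
      (\<forall>i. i \<^bold>\<in> om \<longrightarrow> pr (num 4) (pr i p) \<^bold>\<in> F))"
proof
  assume F: "formula_closed F"
  note F' = F[unfolded formula_closed_def]
  have m: "code_Mem c i j \<Longrightarrow> c \<^bold>\<in> F" for c i j
    by (rule F'[THEN conjunct1, rule_format])
  have e: "code_Eq c i j \<Longrightarrow> c \<^bold>\<in> F" for c i j
    by (rule F'[THEN conjunct2, THEN conjunct1, rule_format])
  have n: "p \<^bold>\<in> F \<Longrightarrow> code_Neg c p \<Longrightarrow> c \<^bold>\<in> F" for c p
    by (rule F'[THEN conjunct2, THEN conjunct2, THEN conjunct1, rule_format]) (rule conjI)
  have c: "p \<^bold>\<in> F \<Longrightarrow> q \<^bold>\<in> F \<Longrightarrow> code_Conj c p q \<Longrightarrow> c \<^bold>\<in> F" for c p q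
    by (rule F'[THEN conjunct2, THEN conjunct2, THEN conjunct2, THEN conjunct1, rule_format]) (intro conjI)
  have x: "p \<^bold>\<in> F \<Longrightarrow> code_Ex c i p \<Longrightarrow> c \<^bold>\<in> F" for c i p
    by (rule F'[THEN conjunct2, THEN conjunct2, THEN conjunct2, THEN conjunct2, rule_format]) (rule conjI)
  show "(\<forall>i j. i \<^bold>\<in> om \<longrightarrow> j \<^bold>\<in> om \<longrightarrow> pr (num 0) (pr i j) \<^bold>\<in> F \<and> pr (num 1) (pr i j) \<^bold>\<in> F) \<and>
    (\<forall>p. p \<^bold>\<in> F \<longrightarrow> pr (num 2) p \<^bold>\<in> F \<and> (\<forall>q. q \<^bold>\<in> F \<longrightarrow> pr (num 3) (pr p q) \<^bold>\<in> F) \<and>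
      (\<forall>i. i \<^bold>\<in> om \<longrightarrow> pr (num 4) (pr i p) \<^bold>\<in> F))"
    apply (intro conjI allI impI)
    subgoal for i j by (rule m[of _ i j]) (simp del: num.simps One_nat_def)
    subgoal for i j by (rule e[of _ i j]) (simp del: num.simps One_nat_def)
    subgoal for p by (rule n[of p]) simp_all
    subgoal for p q by (rule c[of p q]) simp_all
    subgoal for p i by (rule x[of p _ i]) simp_all
    done
next
  assume "(\<forall>i j. i \<^bold>\<in> om \<longrightarrow> j \<^bold>\<in> om \<longrightarrow> pr (num 0) (pr i j) \<^bold>\<in> F \<and> pr (num 1) (pr i j) \<^bold>\<in> F) \<and>
    (\<forall>p. p \<^bold>\<in> F \<longrightarrow> pr (num 2) p \<^bold>\<in> F \<and> (\<forall>q. q \<^bold>\<in> F \<longrightarrow> pr (num 3) (pr p q) \<^bold>\<in> F) \<and>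
      (\<forall>i. i \<^bold>\<in> om \<longrightarrow> pr (num 4) (pr i p) \<^bold>\<in> F))"
  then show "formula_closed F" unfolding formula_closed_def by (simp del: num.simps One_nat_def)
qed

lemma is_formula_intros:
  "i \<^bold>\<in> om \<Longrightarrow> j \<^bold>\<in> om \<Longrightarrow> is_formula (pr (num 0) (pr i j))"
  "i \<^bold>\<in> om \<Longrightarrow> j \<^bold>\<in> om \<Longrightarrow> is_formula (pr (num 1) (pr i j))"
  "is_formula p \<Longrightarrow> is_formula (pr (num 2) p)"
  "is_formula p \<Longrightarrow> is_formula q \<Longrightarrow> is_formula (pr (num 3) (pr p q))"
  "i \<^bold>\<in> om \<Longrightarrow> is_formula p \<Longrightarrow> is_formula (pr (num 4) (pr i p))"
  unfolding is_formula_def formula_closed_iff by blast+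

lemma V_limit_pr: "is_limit l \<Longrightarrow> x \<^bold>\<in> V l \<Longrightarrow> y \<^bold>\<in> V l \<Longrightarrow> pr x y \<^bold>\<in> V l"
proof -
  assume l: "is_limit l"
  have ol: "is_ordinal l" using l unfolding is_limit_iff by blast
  have 1: "upair x y \<^bold>\<in> V l" if xy: "x \<^bold>\<in> V l" "y \<^bold>\<in> V l" for x y
  proof -
    obtain a c where a: "a \<^bold>\<in> l" "x \<^bold>\<in> V a" "c \<^bold>\<in> l" "y \<^bold>\<in> V c" using xy mem_V_limit[OF l] by blast
    have o: "is_ordinal a" "is_ordinal c" using a ord_mem[OF ol] by blast+
    have u: "un a c \<^bold>\<in> l" using un_cases[OF o] a by auto
    have "V a \<^bold>\<subseteq> V (un a c)" "V c \<^bold>\<subseteq> V (un a c)"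
      using V_mono ord_un o un_left un_right by blast+
    then have "upair x y \<^bold>\<subseteq> V (un a c)" using a by (auto simp: sub_def)
    then show ?thesis using u mem_V[OF ol] by blast
  qed
  assume "x \<^bold>\<in> V l" "y \<^bold>\<in> V l"
  then show ?thesis unfolding pr_upair using 1 by blast
qed

lemma ex_formula_closed: "\<exists>F. formula_closed F"
proof -
  \<comment> \<open>Reflection is invoked here to obtain a limit ordinal above \<open>om\<close>; a
    level at a limit is closed under pairs.\<close>
  obtain l where l: "is_limit l" "om \<^bold>\<in> l" using reflection[OF om_ord] by blast
  have ol: "is_ordinal l" using l unfolding is_limit_iff by blast
  have n: "i \<^bold>\<in> V l" if "i \<^bold>\<in> om" for i
    using ord_sub_V[OF ol] subD ord_trans[OF ol that l(2)] by blast
  show ?thesis unfolding formula_closed_iff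
    using V_limit_pr[OF l(1)] n num_om by blast
qed

text \<open>The model may contain formulas that are not codes of elements of \<open>fm\<close>.
  Induction over them uses that a formula lies in every closed set, and closed sets are cut out by
  first-order \<open>P\<close>.\<close>

lemma formula_induct:
  assumes p: "is_formula p" and P: "Df True (\<lambda>s. P (s 0))"
    and "\<And>i j. i \<^bold>\<in> om \<Longrightarrow> j \<^bold>\<in> om \<Longrightarrow> P (pr (num 0) (pr i j))"
    and "\<And>i j. i \<^bold>\<in> om \<Longrightarrow> j \<^bold>\<in> om \<Longrightarrow> P (pr (num 1) (pr i j))"
    and "\<And>p. is_formula p \<Longrightarrow> P p \<Longrightarrow> P (pr (num 2) p)"
    and "\<And>p q. is_formula p \<Longrightarrow> is_formula q \<Longrightarrow> P p \<Longrightarrow> P q \<Longrightarrow> P (pr (num 3) (pr p q))"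
    and "\<And>i p. i \<^bold>\<in> om \<Longrightarrow> is_formula p \<Longrightarrow> P p \<Longrightarrow> P (pr (num 4) (pr i p))"
  shows "P p"
proof -
  obtain K where K: "formula_closed K" using ex_formula_closed by blast
  define F where "F = sep K (\<lambda>p. is_formula p \<and> P p)"
  have F: "z \<^bold>\<in> F \<longleftrightarrow> z \<^bold>\<in> K \<and> is_formula z \<and> P z" for z
    unfolding F_def by (rule mem_sep) (intro defi P)
  have "formula_closed F"
    using K unfolding formula_closed_iff F by (simp add: is_formula_intros assms(3-7) del: num.simps One_nat_def)
  then show ?thesis using p F unfolding is_formula_def by blast
qed

lemma is_assignment_iff [simp]: "is_assignment e A \<longleftrightarrow> e \<^bold>\<in> Funs om A"
  unfolding is_assignment_def by auto

lemma is_update_iff: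
  assumes e: "e \<^bold>\<in> Funs om A" and i: "i \<^bold>\<in> om"
  shows "is_update A e' e i a \<longleftrightarrow>
    e' \<^bold>\<in> Funs om A \<and> app e' i = a \<and> (\<forall>j. j \<^bold>\<in> om \<and> j \<noteq> i \<longrightarrow> app e' j = app e j)"
proof -
  have fe: "is_fun_on e om" using e by (simp add: is_function_iff)
  show ?thesis
  proof (cases "e' \<^bold>\<in> Funs om A")
    case True
    then have fe': "is_fun_on e' om" by (simp add: is_function_iff)
    have "(\<forall>j b. pair_in e' j b \<longleftrightarrow> (if j = i then b = a else pair_in e j b)) \<longleftrightarrow>
        app e' i = a \<and> (\<forall>j. j \<^bold>\<in> om \<and> j \<noteq> i \<longrightarrow> app e' j = app e j)"
      unfolding pair_in_iff fun_pr_iff[OF fe] fun_pr_iff[OF fe'] using i by metis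
    then show ?thesis unfolding is_update_def is_assignment_iff using True by blast
  qed (simp add: is_update_def)
qed

text \<open>The truth clause for \<open>c\<close> at \<open>e\<close>, with the truth values of the
  components taken from \<open>S\<close>. A fixed point on formulas is a satisfaction
  relation.\<close>

definition tarski :: "'a \<Rightarrow> 'a \<Rightarrow> 'a \<Rightarrow> 'a \<Rightarrow> bool" where
  "tarski A S c e \<longleftrightarrow>
    (\<exists>i j. c = pr (num 0) (pr i j) \<and> app e i \<^bold>\<in> app e j) \<or>
    (\<exists>i j. c = pr (num 1) (pr i j) \<and> app e i = app e j) \<or>
    (\<exists>p. c = pr (num 2) p \<and> \<not> pr p e \<^bold>\<in> S) \<or>
    (\<exists>p q. c = pr (num 3) (pr p q) \<and> pr p e \<^bold>\<in> S \<and> pr q e \<^bold>\<in> S) \<or>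
    (\<exists>i p. c = pr (num 4) (pr i p) \<and> (\<exists>a e'. a \<^bold>\<in> A \<and> is_update A e' e i a \<and> pr p e' \<^bold>\<in> S))"

lemma tarski_simps:
  "tarski A S (pr (num 0) (pr i j)) e \<longleftrightarrow> app e i \<^bold>\<in> app e j"
  "tarski A S (pr (num 1) (pr i j)) e \<longleftrightarrow> app e i = app e j"
  "tarski A S (pr (num 2) p) e \<longleftrightarrow> \<not> pr p e \<^bold>\<in> S"
  "tarski A S (pr (num 3) (pr p q)) e \<longleftrightarrow> pr p e \<^bold>\<in> S \<and> pr q e \<^bold>\<in> S"
  "tarski A S (pr (num 4) (pr i p)) e \<longleftrightarrow> (\<exists>a e'. a \<^bold>\<in> A \<and> is_update A e' e i a \<and> pr p e' \<^bold>\<in> S)"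
  unfolding tarski_def pr_inject num_inject by auto

lemma is_satisfactionI:
  assumes "\<And>c e. is_formula c \<Longrightarrow> e \<^bold>\<in> Funs om A \<Longrightarrow> pr c e \<^bold>\<in> S \<longleftrightarrow> tarski A S c e"
  shows "is_satisfaction A S"
  unfolding is_satisfaction_def is_assignment_iff code_iffs pair_in_iff
proof (intro allI impI conjI)
  fix e assume e: "e \<^bold>\<in> Funs om A"
  then have fe: "is_fun_on e om" by (simp add: is_function_iff)
  note S = assms[OF _ e]
  fix c i j
  show "pr c e \<^bold>\<in> S \<longleftrightarrow> (\<exists>x y. pr i x \<^bold>\<in> e \<and> pr j y \<^bold>\<in> e \<and> x \<^bold>\<in> y)"
    if "i \<^bold>\<in> om \<and> j \<^bold>\<in> om \<and> c = pr (num 0) (pr i j)"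
    using S[OF is_formula_intros(1)] that unfolding fun_pr_iff[OF fe] tarski_simps by blast
  show "pr c e \<^bold>\<in> S \<longleftrightarrow> (\<exists>x. pr i x \<^bold>\<in> e \<and> pr j x \<^bold>\<in> e)"
    if "i \<^bold>\<in> om \<and> j \<^bold>\<in> om \<and> c = pr (num 1) (pr i j)"
    using S[OF is_formula_intros(2)] that unfolding fun_pr_iff[OF fe] tarski_simps by metis
  fix p q
  show "pr c e \<^bold>\<in> S \<longleftrightarrow> \<not> pr p e \<^bold>\<in> S" if "is_formula p \<and> c = pr (num 2) p"
    using S[OF is_formula_intros(3)] that unfolding tarski_simps by blast
  show "pr c e \<^bold>\<in> S \<longleftrightarrow> pr p e \<^bold>\<in> S \<and> pr q e \<^bold>\<in> S"
    if "is_formula p \<and> is_formula q \<and> c = pr (num 3) (pr p q)"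
    using S[OF is_formula_intros(4)] that unfolding tarski_simps by blast
  show "pr c e \<^bold>\<in> S \<longleftrightarrow> (\<exists>a e'. a \<^bold>\<in> A \<and> is_update A e' e i a \<and> pr p e' \<^bold>\<in> S)"
    if "is_formula p \<and> i \<^bold>\<in> om \<and> c = pr (num 4) (pr i p)"
    using S[OF is_formula_intros(5)] that unfolding tarski_simps by blast
qed

text \<open>
  The satisfaction relation is the limit of the iterates of Tarski's clauses, started from the
  empty relation: the truth value of a formula is constant from the step given by its height on.
\<close>

lemma ex_satisfaction: "\<exists>S. is_satisfaction A S"
proof -
  obtain K where K: "formula_closed K" using ex_formula_closed by blast
  have K: "c \<^bold>\<in> K" if "is_formula c" for c using that K unfolding is_formula_def by blast
  have Dt: "Df True (\<lambda>s. tarski A (t s) (u s) (v s))" if "Tf True t" "Tf True u" "Tf True v" for t u v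
  proof -
    have "Df True (\<lambda>s. tarski A (s 0) (s 1) (s 2))" unfolding tarski_def by (intro defi)
    then show ?thesis using that by (rule Df_comp3[where P = "tarski A"])
  qed
  let ?T = "\<lambda>S. sep (Prod K (Funs om A)) (\<lambda>z. \<exists>c e. z = pr c e \<and> tarski A S c e)"
  have TT: "Tf True (\<lambda>s. ?T (s 0))" by (intro defi Dt)
  have memT: "pr c e \<^bold>\<in> ?T S \<longleftrightarrow> c \<^bold>\<in> K \<and> e \<^bold>\<in> Funs om A \<and> tarski A S c e" for c e S
  proof -
    have "pr c e \<^bold>\<in> ?T S \<longleftrightarrow> pr c e \<^bold>\<in> Prod K (Funs om A) \<and> (\<exists>c' e'. pr c e = pr c' e' \<and> tarski A S c' e')"
      by (rule mem_sep) (intro defi Dt)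
    then show ?thesis by (simp del: mem_Funs)
  qed
  define S where "S n = nrec emp ?T n" for n
  have TS: "Tf True (\<lambda>s. S (t s))" if "Tf True t" for t
    unfolding S_def by (intro defi Dt that)
  have Ssuc: "S (suc n) = ?T (S n)" if "n \<^bold>\<in> om" for n
    unfolding S_def by (rule nrec_suc[OF TT om_ordD[OF that]])
  \<comment> \<open>Negation makes the iterates non-monotone, so their limit is eventual membership
    rather than a union.\<close>
  define W where "W = sep (Prod K (Funs om A)) (\<lambda>z. \<exists>n. n \<^bold>\<in> om \<and> (\<forall>m. m \<^bold>\<in> om \<longrightarrow> n \<^bold>\<subseteq> m \<longrightarrow> z \<^bold>\<in> S m))"
  have W: "z \<^bold>\<in> W \<longleftrightarrow> z \<^bold>\<in> Prod K (Funs om A) \<and> (\<exists>n. n \<^bold>\<in> om \<and> (\<forall>m. m \<^bold>\<in> om \<longrightarrow> n \<^bold>\<subseteq> m \<longrightarrow> z \<^bold>\<in> S m))" for z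
    unfolding W_def by (rule mem_sep) (intro defi TS)
  define stab where "stab c n \<longleftrightarrow> n \<^bold>\<in> om \<and>
      (\<forall>m. m \<^bold>\<in> om \<longrightarrow> n \<^bold>\<subseteq> m \<longrightarrow> (\<forall>e. e \<^bold>\<in> Funs om A \<longrightarrow> (pr c e \<^bold>\<in> S m \<longleftrightarrow> pr c e \<^bold>\<in> W)))" for c n
  have mx: "\<exists>k. k \<^bold>\<in> om \<and> n \<^bold>\<subseteq> k \<and> m \<^bold>\<subseteq> k" if "n \<^bold>\<in> om" "m \<^bold>\<in> om" for n m
    using that un_cases[OF om_ordD om_ordD, OF that] un_left[of n m] un_right[of m n] by (intro exI[of _ "un n m"]) auto
  \<comment> \<open>If the clause for \<open>c\<close> evaluates alike in \<open>S m\<close> and in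
    \<open>W\<close> from \<open>k\<close> on, the truth values of \<open>c\<close> are settled one
    iteration later, from \<open>suc k\<close> on.\<close>
  have stabI: "\<exists>n. stab c n"
    if c: "is_formula c" and k: "k \<^bold>\<in> om"
      and *: "\<And>m e. m \<^bold>\<in> om \<Longrightarrow> k \<^bold>\<subseteq> m \<Longrightarrow> e \<^bold>\<in> Funs om A \<Longrightarrow> tarski A (S m) c e \<longleftrightarrow> tarski A W c e" for c k
  proof -
    have eq: "pr c e \<^bold>\<in> S m \<longleftrightarrow> tarski A W c e"
      if m: "m \<^bold>\<in> om" "suc k \<^bold>\<subseteq> m" and e: "e \<^bold>\<in> Funs om A" for m e
    proof -
      have km: "k \<^bold>\<in> m" using m(2) by (simp add: sub_def)
      then obtain m' where m': "m' \<^bold>\<in> om" "m = suc m'" using om_cases[OF m(1)] by (metis not_mem_emp)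
      have "k \<^bold>\<subseteq> m'" using km m' ord_mem_sub[OF om_ordD[OF m'(1)]] by auto
      then show ?thesis using m' Ssuc[OF m'(1)] memT K[OF c] e * by simp
    qed
    have "pr c e \<^bold>\<in> W \<longleftrightarrow> tarski A W c e" if e: "e \<^bold>\<in> Funs om A" for e
    proof
      assume "pr c e \<^bold>\<in> W"
      then obtain n where n: "n \<^bold>\<in> om" "\<forall>m. m \<^bold>\<in> om \<longrightarrow> n \<^bold>\<subseteq> m \<longrightarrow> pr c e \<^bold>\<in> S m" using W by blast
      obtain m where "m \<^bold>\<in> om" "n \<^bold>\<subseteq> m" "suc k \<^bold>\<subseteq> m" using mx[OF n(1) suc_om[OF k]] by blast
      then show "tarski A W c e" using n eq e by blast
    next
      assume t: "tarski A W c e"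
      have "pr c e \<^bold>\<in> Prod K (Funs om A)" using K[OF c] e unfolding mem_Prod by blast
      then show "pr c e \<^bold>\<in> W" unfolding W using eq e t suc_om[OF k] by blast
    qed
    then show ?thesis unfolding stab_def using eq suc_om[OF k] by (intro exI[of _ "suc k"]) blast
  qed
  have Dstab: "Df True (\<lambda>s. \<exists>n. stab (s 0) n)" unfolding stab_def by (intro defi TS)
  have step: "\<exists>k. k \<^bold>\<in> om \<and> (\<forall>m e. m \<^bold>\<in> om \<and> k \<^bold>\<subseteq> m \<and> e \<^bold>\<in> Funs om A \<longrightarrow> (tarski A (S m) c e \<longleftrightarrow> tarski A W c e))"
    if "is_formula c" for c
  proof -
    let ?Q = "\<lambda>c. \<exists>k. k \<^bold>\<in> om \<and> (\<forall>m e. m \<^bold>\<in> om \<and> k \<^bold>\<subseteq> m \<and> e \<^bold>\<in> Funs om A \<longrightarrow> (tarski A (S m) c e \<longleftrightarrow> tarski A W c e))"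
    have QI: "\<exists>n. stab c n" if "is_formula c" "?Q c" for c using stabI[OF that(1)] that(2) by blast
    show ?thesis
    proof (rule formula_induct[where P = ?Q, OF that])
      show "Df True (\<lambda>s. ?Q (s 0))" by (intro defi Dt TS)
    next
      fix p assume "is_formula p" "?Q p"
      then obtain n where n: "stab p n" using QI by blast
      then show "?Q (pr (num 2) p)" unfolding stab_def tarski_simps by blast
    next
      fix p q assume pq: "is_formula p" "is_formula q" "?Q p" "?Q q"
      obtain n where n: "stab p n" using QI[OF pq(1,3)] by (rule exE)
      obtain m where m: "stab q m" using QI[OF pq(2,4)] by (rule exE)
      have nm: "n \<^bold>\<in> om" "m \<^bold>\<in> om" using n m unfolding stab_def by blast+
      obtain k where k: "k \<^bold>\<in> om" "n \<^bold>\<subseteq> k" "m \<^bold>\<subseteq> k" using mx[OF nm] by blast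
      have "n \<^bold>\<subseteq> j \<and> m \<^bold>\<subseteq> j" if "k \<^bold>\<subseteq> j" for j using k that sub_trans by blast
      then show "?Q (pr (num 3) (pr p q))"
        using n m k(1) unfolding stab_def tarski_simps by (intro exI[of _ k]) blast
    next
      fix i p assume "is_formula p" "?Q p" "i \<^bold>\<in> om"
      then obtain n where n: "stab p n" using QI by blast
      have "e' \<^bold>\<in> Funs om A" if "is_update A e' e i a" for e' e a using that unfolding is_update_def by simp
      then show "?Q (pr (num 4) (pr i p))"
        using n unfolding stab_def tarski_simps by (intro exI[of _ n]) blast
    qed (unfold tarski_simps, (intro exI[of _ emp], simp)+)
  qed
  have "pr c e \<^bold>\<in> W \<longleftrightarrow> tarski A W c e" if c: "is_formula c" and e: "e \<^bold>\<in> Funs om A" for c e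
  proof -
    obtain k where k: "k \<^bold>\<in> om" "\<And>m e. m \<^bold>\<in> om \<Longrightarrow> k \<^bold>\<subseteq> m \<Longrightarrow> e \<^bold>\<in> Funs om A \<Longrightarrow> tarski A (S m) c e \<longleftrightarrow> tarski A W c e"
      using step[OF c] by blast
    obtain n where n: "stab c n" using stabI[OF c k] by blast
    obtain m where m: "m \<^bold>\<in> om" "n \<^bold>\<subseteq> m" "k \<^bold>\<subseteq> m" using mx n k(1) unfolding stab_def by blast
    have "suc m \<^bold>\<in> om" "n \<^bold>\<subseteq> suc m" using m by (auto simp: sub_def)
    then have "pr c e \<^bold>\<in> W \<longleftrightarrow> pr c e \<^bold>\<in> S (suc m)" using n e unfolding stab_def by blast
    also have "\<dots> \<longleftrightarrow> tarski A (S m) c e" using Ssuc[OF m(1)] memT K[OF c] e by simp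
    finally show ?thesis using k(2) m e by blast
  qed
  then show ?thesis using is_satisfactionI by blast
qed

section \<open>Codes of external formulas\<close>

primrec code :: "fm \<Rightarrow> 'a" where
  "code (Mem i j) = pr (num 0) (pr (num i) (num j))"
| "code (Eq i j) = pr (num 1) (pr (num i) (num j))"
| "code (Neg p) = pr (num 2) (code p)"
| "code (Conj p q) = pr (num 3) (pr (code p) (code q))"
| "code (Ex i p) = pr (num 4) (pr (num i) (code p))"

lemma is_formula_code: "is_formula (code p)"
  by (induction p) (simp_all only: code.simps is_formula_intros num_om)

lemma is_satisfactionD:
  assumes S: "is_satisfaction A S" and e: "e \<^bold>\<in> Funs om A"
  shows "i \<^bold>\<in> om \<Longrightarrow> j \<^bold>\<in> om \<Longrightarrow> pr (pr (num 0) (pr i j)) e \<^bold>\<in> S \<longleftrightarrow> app e i \<^bold>\<in> app e j"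
    and "i \<^bold>\<in> om \<Longrightarrow> j \<^bold>\<in> om \<Longrightarrow> pr (pr (num 1) (pr i j)) e \<^bold>\<in> S \<longleftrightarrow> app e i = app e j"
    and "is_formula p \<Longrightarrow> pr (pr (num 2) p) e \<^bold>\<in> S \<longleftrightarrow> \<not> pr p e \<^bold>\<in> S"
    and "is_formula p \<Longrightarrow> is_formula q \<Longrightarrow> pr (pr (num 3) (pr p q)) e \<^bold>\<in> S \<longleftrightarrow> pr p e \<^bold>\<in> S \<and> pr q e \<^bold>\<in> S"
    and "i \<^bold>\<in> om \<Longrightarrow> is_formula p \<Longrightarrow> pr (pr (num 4) (pr i p)) e \<^bold>\<in> S \<longleftrightarrow>
      (\<exists>a e'. a \<^bold>\<in> A \<and> is_update A e' e i a \<and> pr p e' \<^bold>\<in> S)"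
proof -
  have fe: "is_fun_on e om" using e by (simp add: is_function_iff)
  note C = S[unfolded is_satisfaction_def is_assignment_iff pair_in_iff fun_pr_iff[OF fe], THEN spec, THEN mp, OF e,
      unfolded pair_in_iff fun_pr_iff[OF fe]]
  note C1 = C[THEN conjunct1, rule_format]
  note C2 = C[THEN conjunct2, THEN conjunct1, rule_format]
  note C3 = C[THEN conjunct2, THEN conjunct2, THEN conjunct1, rule_format]
  note C4 = C[THEN conjunct2, THEN conjunct2, THEN conjunct2, THEN conjunct1, rule_format]
  note C5 = C[THEN conjunct2, THEN conjunct2, THEN conjunct2, THEN conjunct2, rule_format]
  show "i \<^bold>\<in> om \<Longrightarrow> j \<^bold>\<in> om \<Longrightarrow> pr (pr (num 0) (pr i j)) e \<^bold>\<in> S \<longleftrightarrow> app e i \<^bold>\<in> app e j"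
    using C1[of "pr (num 0) (pr i j)" i j] by simp
  show "i \<^bold>\<in> om \<Longrightarrow> j \<^bold>\<in> om \<Longrightarrow> pr (pr (num 1) (pr i j)) e \<^bold>\<in> S \<longleftrightarrow> app e i = app e j"
    using C2[of "pr (num 1) (pr i j)" i j] by auto
  show "is_formula p \<Longrightarrow> pr (pr (num 2) p) e \<^bold>\<in> S \<longleftrightarrow> \<not> pr p e \<^bold>\<in> S"
    using C3[of p "pr (num 2) p"] by simp
  show "is_formula p \<Longrightarrow> is_formula q \<Longrightarrow> pr (pr (num 3) (pr p q)) e \<^bold>\<in> S \<longleftrightarrow> pr p e \<^bold>\<in> S \<and> pr q e \<^bold>\<in> S"
    using C4[of p q "pr (num 3) (pr p q)"] by simp
  show "i \<^bold>\<in> om \<Longrightarrow> is_formula p \<Longrightarrow> pr (pr (num 4) (pr i p)) e \<^bold>\<in> S \<longleftrightarrow>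
      (\<exists>a e'. a \<^bold>\<in> A \<and> is_update A e' e i a \<and> pr p e' \<^bold>\<in> S)"
    using C5[of p "pr (num 4) (pr i p)" i] by simp
qed

text \<open>Since \<open>S\<close> is arbitrary, the existential in \<open>satisfies\<close> cannot
  depend on the relation chosen. In the quantifier step internal updates match external ones at all
  variables below the bound.\<close>

lemma satisfaction_code:
  assumes S: "is_satisfaction A S" and "e \<^bold>\<in> Funs om A" "\<And>n. n < var_bound p \<Longrightarrow> app e (num n) = s n"
  shows "pr (code p) e \<^bold>\<in> S \<longleftrightarrow> satr A p s"
  using assms(2,3)
proof (induction p arbitrary: e s)
  case (Mem i j)
  show ?case unfolding code.simps is_satisfactionD(1)[OF S Mem(1) num_om num_om]
    using Mem(2)[of i] Mem(2)[of j] by simp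
next
  case (Eq i j)
  show ?case unfolding code.simps is_satisfactionD(2)[OF S Eq(1) num_om num_om]
    using Eq(2)[of i] Eq(2)[of j] by simp
next
  case (Neg p)
  have "pr (code p) e \<^bold>\<in> S \<longleftrightarrow> satr A p s" by (rule Neg.IH[OF Neg.prems(1)]) (simp add: Neg.prems(2))
  then show ?case unfolding code.simps is_satisfactionD(3)[OF S Neg.prems(1) is_formula_code] by simp
next
  case (Conj p q)
  have "pr (code p) e \<^bold>\<in> S \<longleftrightarrow> satr A p s" by (rule Conj.IH(1)[OF Conj.prems(1)]) (simp add: Conj.prems(2))
  moreover have "pr (code q) e \<^bold>\<in> S \<longleftrightarrow> satr A q s" by (rule Conj.IH(2)[OF Conj.prems(1)]) (simp add: Conj.prems(2))
  ultimately show ?case unfolding code.simps is_satisfactionD(4)[OF S Conj.prems(1) is_formula_code is_formula_code] by simp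
next
  case (Ex i p)
  have 1: "pr (code p) e' \<^bold>\<in> S \<longleftrightarrow> satr A p (s(i := a))" if u: "is_update A e' e (num i) a" for e' a
  proof -
    have u: "e' \<^bold>\<in> Funs om A" "app e' (num i) = a" "\<forall>j. j \<^bold>\<in> om \<and> j \<noteq> num i \<longrightarrow> app e' j = app e j"
      using u unfolding is_update_iff[OF Ex.prems(1) num_om] by blast+
    show ?thesis
    proof (rule Ex.IH[OF u(1)])
      fix n assume "n < var_bound p"
      then show "app e' (num n) = (s(i := a)) n" using u(2,3) Ex.prems(2)[of n] by (cases "n = i") auto
    qed
  qed
  have 2: "\<exists>e'. is_update A e' e (num i) a" if "a \<^bold>\<in> A" for a
    unfolding is_update_iff[OF Ex.prems(1) num_om] by (rule Funs_update[OF Ex.prems(1) that num_om])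
  show ?case unfolding code.simps satr.simps is_satisfactionD(5)[OF S Ex.prems(1) num_om is_formula_code]
    using 1 2 by blast
qed

lemma satisfies_code:
  assumes "e \<^bold>\<in> Funs om A" "\<And>n. n < var_bound p \<Longrightarrow> app e (num n) = s n"
  shows "satisfies A (code p) e \<longleftrightarrow> satr A p s"
  unfolding satisfies_def pair_in_iff using satisfaction_code[OF _ assms] ex_satisfaction by blast

text \<open>Choose a level that reflects the formula and contains \<open>X\<close> and the ordinal
  parameters occurring in it; there the formula defines \<open>X\<close> from the same
  parameters.\<close>

theorem ordinal_definableI:
  assumes P: "Df False (\<lambda>s. P (s 0))" and X: "\<And>z. z \<^bold>\<in> X \<longleftrightarrow> P z"
  shows "ordinal_definable X"
proof -
  obtain p r where r: "\<And>n. is_ordinal (r n)" and p: "\<And>s. P (s 0) \<longleftrightarrow> sat mem p (join r s)"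
    using P by (erule_tac DfE) blast
  \<comment> \<open>As \<open>definable_in\<close> prescribes, the element is variable 0; parameter
    \<open>k\<close> becomes variable \<open>Suc k\<close>.\<close>
  define q where "q = subst_vars p (\<lambda>n. if even n then Suc (n div 2) else 0)"
  have q: "sat mem q (case_nat z r) \<longleftrightarrow> P z" for z
  proof -
    have "(\<lambda>n. case_nat z r (if even n then Suc (n div 2) else 0)) = join r (\<lambda>_. z)"
      by (auto simp: join_def)
    then show ?thesis unfolding q_def sat_subst_vars using p[of "\<lambda>_. z"] by simp
  qed
  define N where "N = var_bound q"
  obtain b where b: "is_ordinal b" "X \<^bold>\<in> V b" using ex_V by blast
  have "\<exists>a. is_ordinal a \<and> b \<^bold>\<subseteq> a \<and> (\<forall>n<M. r n \<^bold>\<in> a)" for M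
  proof (induction M)
    case (Suc M)
    then obtain a where a: "is_ordinal a" "b \<^bold>\<subseteq> a" "\<forall>n<M. r n \<^bold>\<in> a" by blast
    have o: "is_ordinal (un a (suc (r M)))" using a r ord_un by simp
    show ?case
      by (rule exI[of _ "un a (suc (r M))"]) (use a o sub_trans[OF a(2) un_left] in \<open>auto simp: less_Suc_eq\<close>)
  qed (use b in auto)
  then obtain a where a: "is_ordinal a" "b \<^bold>\<subseteq> a" "\<forall>n<N. r n \<^bold>\<in> a" by blast
  obtain l where l: "is_limit l" "a \<^bold>\<in> l" and refl: "\<And>s. (\<forall>n. s n \<^bold>\<in> V l) \<Longrightarrow> satr (V l) q s \<longleftrightarrow> sat mem q s"
    using reflection[OF a(1), of q] by blast
  have ol: "is_ordinal l" using l unfolding is_limit_iff by blast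
  have V: "V b \<^bold>\<subseteq> V l" using V_mono[OF b(1) a(1,2)] V_mono_mem[OF ol l(2)] sub_trans by blast
  have XV: "z \<^bold>\<in> V l" if "z \<^bold>\<in> X" for z using V_trans[OF b(1,2) that] V subD by blast
  have rV: "r n \<^bold>\<in> V l" if "n < N" for n
    using a(3) that ord_sub_V[OF ol] ord_trans[OF ol _ l(2)] subD by blast
  have eV: "emp \<^bold>\<in> V l" using ord_sub_V[OF ol] subD ord_emp_mem[OF ol] l(2) by fastforce
  \<comment> \<open>An assignment is total and all of its values have to be ordinals, so it is built
    inside the set of ordinals of \<open>V l\<close>.\<close>
  define O' where "O' = sep (V l) is_ordinal"
  have O': "z \<^bold>\<in> O' \<longleftrightarrow> z \<^bold>\<in> V l \<and> is_ordinal z" for z unfolding O'_def by (rule mem_sep) (intro defi)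
  \<comment> \<open>Past the variables of \<open>q\<close> the value is \<open>emp\<close>, since
    parameters that do not occur in \<open>q\<close> might lie outside \<open>V l\<close>.\<close>
  define s0 where "s0 z n = (if n < N then case_nat z r n else emp)" for z n
  have s0q: "sat mem q (s0 z) \<longleftrightarrow> P z" for z
    unfolding q[symmetric] by (rule sat_agree) (simp add: s0_def N_def)
  have s0V: "s0 z n \<^bold>\<in> V l" if "z \<^bold>\<in> V l" for z n
    using that rV eV by (auto simp: s0_def split: nat.split)
  obtain e where e: "e \<^bold>\<in> Funs om O'" "\<forall>n<N. app e (num n) = s0 emp n"
  proof -
    have "s0 emp n \<^bold>\<in> O'" if "n < N" for n
      using s0V[OF eV, of n] r by (auto simp: O' s0_def split: nat.split)
    then show ?thesis using ex_assignment[of emp O' N "s0 emp"] eV that by (auto simp: O' simp del: mem_Funs)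
  qed
  have eVl: "e \<^bold>\<in> Funs om (V l)" and fe: "is_fun_on e om"
    using e(1) unfolding mem_Funs is_function_iff O' by blast+
  have sat: "satisfies (V l) (code q) e' \<longleftrightarrow> P z" if z: "z \<^bold>\<in> V l" and u: "is_update (V l) e' e emp z" for z e'
  proof -
    have u: "e' \<^bold>\<in> Funs om (V l)" "app e' emp = z" "\<And>j. j \<^bold>\<in> om \<Longrightarrow> j \<noteq> emp \<Longrightarrow> app e' j = app e j"
      using u unfolding is_update_iff[OF eVl emp_om] by blast+
    have "app e' (num n) = s0 z n" if "n < var_bound q" for n
    proof (cases n)
      case (Suc k)
      then show ?thesis using u(3)[OF num_om, of n] e(2)[rule_format, of n] that by (simp add: s0_def N_def)
    qed (use u that in \<open>simp add: s0_def N_def\<close>)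
    then have "satisfies (V l) (code q) e' \<longleftrightarrow> satr (V l) q (s0 z)" by (rule satisfies_code[OF u(1)])
    also have "\<dots> \<longleftrightarrow> P z" unfolding s0q[symmetric] by (rule refl) (use s0V[OF z] in blast)
    finally show ?thesis .
  qed
  have exu: "\<exists>e'. is_update (V l) e' e emp z" if "z \<^bold>\<in> V l" for z
    unfolding is_update_iff[OF eVl emp_om] by (rule Funs_update[OF eVl that emp_om])
  have "z \<^bold>\<in> X \<longleftrightarrow> z \<^bold>\<in> V l \<and> (\<exists>o' e'. is_empty o' \<and> is_update (V l) e' e o' z \<and> satisfies (V l) (code q) e')" for z
  proof
    assume z: "z \<^bold>\<in> X"
    obtain e' where u: "is_update (V l) e' e emp z" using exu[OF XV[OF z]] by (rule exE)
    have "satisfies (V l) (code q) e'" using sat[OF XV[OF z] u] X z by simp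
    then show "z \<^bold>\<in> V l \<and> (\<exists>o' e'. is_empty o' \<and> is_update (V l) e' e o' z \<and> satisfies (V l) (code q) e')"
      using XV[OF z] u by (intro conjI exI[of _ emp] exI[of _ e']) simp_all
  next
    assume z: "z \<^bold>\<in> V l \<and> (\<exists>o' e'. is_empty o' \<and> is_update (V l) e' e o' z \<and> satisfies (V l) (code q) e')"
    then obtain o' e' where u: "z \<^bold>\<in> V l" "o' = emp" "is_update (V l) e' e o' z" "satisfies (V l) (code q) e'"
      unfolding is_empty_iff by (elim conjE exE)
    then have "P z" using sat[OF u(1), of e'] by simp
    then show "z \<^bold>\<in> X" by (simp add: X)
  qed
  moreover have "is_ordinal c" if "pair_in e i c" for i c
  proof -
    have "i \<^bold>\<in> om" "c = app e i" using that by (simp_all add: fun_pr_iff[OF fe])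
    then show ?thesis using e(1) O' by (simp add: is_function_iff)
  qed
  ultimately have "definable_in (V l) is_ordinal X"
    unfolding definable_in_def is_assignment_iff
    by (intro exI[of _ "code q"] exI[of _ e] conjI allI impI is_formula_code eVl)
  then show ?thesis unfolding ordinal_definable_def is_V_iff using ol by blast
qed

section \<open>Turns\<close>

lemma is_plus_twice_iff:
  assumes n: "n \<^bold>\<in> om"
  shows "is_plus_twice a l n \<longleftrightarrow> (\<exists>s. is_fun_on s (suc n) \<and> app s emp = l \<and>
    (\<forall>k. k \<^bold>\<in> n \<longrightarrow> app s (suc k) = suc (suc (app s k))) \<and> app s n = a)"
proof -
  have on: "is_ordinal n" "is_ordinal (suc n)" using om_ordD[OF n] by simp_all
  have 0: "emp \<^bold>\<in> suc n" using ord_emp_mem[OF on(2)] by simp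
  have s: "suc k \<^bold>\<in> suc n" if "k \<^bold>\<in> n" for k using ord_suc_mem[OF on(1) that] by simp
  show ?thesis
  proof
    assume "is_plus_twice a l n"
    then obtain d s where d: "is_succ d n" and fd: "is_fun_on s d" and z: "\<forall>z. is_empty z \<longrightarrow> pair_in s z l"
      and st: "\<forall>k k' \<beta> \<gamma> \<delta>. k \<^bold>\<in> n \<and> is_succ k' k \<and> pair_in s k \<beta> \<and> is_succ \<gamma> \<beta> \<and> is_succ \<delta> \<gamma> \<longrightarrow> pair_in s k' \<delta>"
      and a: "pair_in s n a" unfolding is_plus_twice_def by blast
    have fs: "is_fun_on s (suc n)" using d fd by simp
    have "app s (suc k) = suc (suc (app s k))" if "k \<^bold>\<in> n" for k
      using st[rule_format, of k "suc k" "app s k" "suc (app s k)" "suc (suc (app s k))"] that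
      by (simp add: fun_pr_iff[OF fs])
    then show "\<exists>s. is_fun_on s (suc n) \<and> app s emp = l \<and>
        (\<forall>k. k \<^bold>\<in> n \<longrightarrow> app s (suc k) = suc (suc (app s k))) \<and> app s n = a"
      using fs z a by (intro exI[of _ s]) (simp add: fun_pr_iff[OF fs])
  next
    assume "\<exists>s. is_fun_on s (suc n) \<and> app s emp = l \<and>
        (\<forall>k. k \<^bold>\<in> n \<longrightarrow> app s (suc k) = suc (suc (app s k))) \<and> app s n = a"
    then obtain f where f: "is_fun_on f (suc n)" "app f emp = l"
      "\<forall>k. k \<^bold>\<in> n \<longrightarrow> app f (suc k) = suc (suc (app f k))" "app f n = a" by blast
    show "is_plus_twice a l n" unfolding is_plus_twice_def
    proof (rule exI[of _ "suc n"], rule exI[of _ f], intro conjI allI impI)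
      fix k k' \<beta> \<gamma> \<delta> assume "k \<^bold>\<in> n \<and> is_succ k' k \<and> pair_in f k \<beta> \<and> is_succ \<gamma> \<beta> \<and> is_succ \<delta> \<gamma>"
      then show "pair_in f k' \<delta>" using f(3) s by (simp add: fun_pr_iff[OF f(1)])
    next
      show "pair_in f z l" if "is_empty z" for z using that 0 f(2) by (simp add: fun_pr_iff[OF f(1)])
    qed (use f in \<open>simp_all add: fun_pr_iff[OF f(1)]\<close>)
  qed
qed

lemma is_plus_twice_emp: "is_plus_twice a l emp \<longleftrightarrow> a = l"
proof -
  have T: "Tf True (\<lambda>s. l)" by (intro defi)
  have "is_fun_on (Lam (suc emp) (\<lambda>_. l)) (suc emp)" "app (Lam (suc emp) (\<lambda>_. l)) emp = l"
    using is_fun_on_Lam[OF T] app_Lam[OF T] by simp_all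
  then show ?thesis unfolding is_plus_twice_iff[OF emp_om] by auto
qed

lemma is_plus_twice_suc:
  assumes n: "n \<^bold>\<in> om"
  shows "is_plus_twice a l (suc n) \<longleftrightarrow> (\<exists>b. is_plus_twice b l n \<and> a = suc (suc b))"
proof
  have on: "is_ordinal n" using om_ordD[OF n] .
  assume "is_plus_twice a l (suc n)"
  then obtain s where s: "is_fun_on s (suc (suc n))" "app s emp = l"
    "\<And>k. k \<^bold>\<in> suc n \<Longrightarrow> app s (suc k) = suc (suc (app s k))" "app s (suc n) = a"
    unfolding is_plus_twice_iff[OF suc_om[OF n]] by blast
  have sub: "suc n \<^bold>\<subseteq> suc (suc n)" by (simp add: sub_def)
  have r: "app (restr s (suc n)) k = app s k" if "k \<^bold>\<in> suc n" for k by (rule app_restr[OF s(1) sub that])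
  have "emp \<^bold>\<in> suc n" using ord_emp_mem[of "suc n"] on by simp
  moreover have "suc k \<^bold>\<in> suc n" if "k \<^bold>\<in> n" for k using ord_suc_mem[OF on that] by simp
  ultimately have "is_plus_twice (app s n) l n"
    unfolding is_plus_twice_iff[OF n] using is_fun_on_restr[OF s(1) sub] s r
    by (intro exI[of _ "restr s (suc n)"]) simp
  then show "\<exists>b. is_plus_twice b l n \<and> a = suc (suc b)" using s(3)[of n] s(4) by auto
next
  have on: "is_ordinal n" using om_ordD[OF n] .
  assume "\<exists>b. is_plus_twice b l n \<and> a = suc (suc b)"
  then obtain b where b: "is_plus_twice b l n" "a = suc (suc b)" by blast
  obtain s where s: "is_fun_on s (suc n)" "app s emp = l"
    "\<And>k. k \<^bold>\<in> n \<Longrightarrow> app s (suc k) = suc (suc (app s k))" "app s n = b"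
    using b(1) unfolding is_plus_twice_iff[OF n] by blast
  let ?F = "\<lambda>k. if k = suc n then a else app s k"
  have T: "Tf True (\<lambda>s. ?F (s 0))" by (intro defi)
  have ap: "app (Lam (suc (suc n)) ?F) k = ?F k" if "k \<^bold>\<in> suc (suc n)" for k by (rule app_Lam[OF T that])
  have e: "emp \<^bold>\<in> suc (suc n)" using ord_emp_mem[of "suc (suc n)"] on by simp
  have st: "app (Lam (suc (suc n)) ?F) (suc k) = suc (suc (app (Lam (suc (suc n)) ?F) k))" if k: "k \<^bold>\<in> suc n" for k
  proof -
    have "suc k \<^bold>\<in> suc (suc n)" using ord_suc_mem[of "suc n" k] on k by simp
    moreover have "k \<noteq> suc n" using k mem_irrefl by metis
    moreover have "app s (suc k) = suc (suc (app s k))" if "k \<noteq> n" using that k s(3) by simp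
    ultimately show ?thesis using ap[of k] ap[of "suc k"] k s(4) b(2) by auto
  qed
  show "is_plus_twice a l (suc n)" unfolding is_plus_twice_iff[OF suc_om[OF n]]
    by (intro exI[of _ "Lam (suc (suc n)) ?F"]) (use is_fun_on_Lam[OF T] ap e st s(2) in simp)
qed

text \<open>Replaces the witnessing sequence of \<open>is_plus_twice\<close> by a recursion through
  two successors, which is the form used from here on.\<close>

lemma first_turn_unfold: "first_turn a \<longleftrightarrow> a = emp \<or> is_limit a \<or> (\<exists>b. first_turn b \<and> a = suc (suc b))"
proof
  assume "first_turn a"
  then obtain l n where l: "l = emp \<or> is_limit l" "n \<^bold>\<in> om" "is_plus_twice a l n"
    unfolding first_turn_def is_nat_iff is_empty_iff by blast
  from l(2) show "a = emp \<or> is_limit a \<or> (\<exists>b. first_turn b \<and> a = suc (suc b))"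
  proof (cases rule: om_cases)
    case 1
    then have "a = l" using l(3) is_plus_twice_emp by simp
    then show ?thesis using l(1) by blast
  next
    case (2 m)
    then obtain b where "is_plus_twice b l m" "a = suc (suc b)" using l(3) is_plus_twice_suc by blast
    then show ?thesis using 2 l(1) unfolding first_turn_def is_nat_iff is_empty_iff by blast
  qed
next
  assume "a = emp \<or> is_limit a \<or> (\<exists>b. first_turn b \<and> a = suc (suc b))"
  then consider "a = emp \<or> is_limit a" | b where "first_turn b" "a = suc (suc b)" by blast
  then show "first_turn a"
  proof cases
    case 1
    then show ?thesis unfolding first_turn_def is_nat_iff is_empty_iff using is_plus_twice_emp emp_om by blast
  next
    case (2 b)
    then obtain l n where l: "l = emp \<or> is_limit l" "n \<^bold>\<in> om" "is_plus_twice b l n"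
      unfolding first_turn_def is_nat_iff is_empty_iff by blast
    then have "is_plus_twice a l (suc n)" using is_plus_twice_suc 2 by blast
    then show ?thesis unfolding first_turn_def is_nat_iff is_empty_iff using l suc_om by blast
  qed
qed

lemma first_turn_emp: "first_turn emp" and first_turn_limit: "is_limit a \<Longrightarrow> first_turn a"
  using first_turn_unfold by blast+

lemma second_turn_iff: "second_turn a \<longleftrightarrow> (\<exists>b. first_turn b \<and> a = suc b)"
  unfolding second_turn_def by simp

lemma second_turn_suc [simp]: "second_turn (suc a) \<longleftrightarrow> first_turn a"
  unfolding second_turn_iff by simp

lemma first_turn_suc_suc [simp]: "first_turn (suc (suc a)) \<longleftrightarrow> first_turn a"
  using first_turn_unfold[of "suc (suc a)"] limit_not_suc by auto

text \<open>If \<open>x\<close> and its successor were both first turns, \<open>x\<close> would be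
  \<open>suc b\<close> for a first turn \<open>b\<close>, so the same would already happen at
  \<open>b\<close>.\<close>

lemma first_turn_not_suc: "is_ordinal a \<Longrightarrow> first_turn a \<longrightarrow> \<not> first_turn (suc a)"
proof (rule ord_induct[where P = "\<lambda>a. first_turn a \<longrightarrow> \<not> first_turn (suc a)"])
  fix x assume IH: "\<And>y. y \<^bold>\<in> x \<Longrightarrow> first_turn y \<longrightarrow> \<not> first_turn (suc y)"
  show "first_turn x \<longrightarrow> \<not> first_turn (suc x)"
  proof (intro impI notI)
    assume x: "first_turn x" "first_turn (suc x)"
    obtain b where "first_turn b" "x = suc b"
      using x(2) first_turn_unfold[of "suc x"] limit_not_suc by auto
    then show False using x(1) IH[of b] by simp
  qed
qed (assumption, intro defi)

lemma first_not_second: "is_ordinal a \<Longrightarrow> first_turn a \<Longrightarrow> \<not> second_turn a"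
  using first_turn_not_suc unfolding second_turn_iff by (metis ord_suc)

lemma first_or_second: "is_ordinal a \<Longrightarrow> first_turn a \<or> second_turn a"
proof (rule ord_induct[where P = "\<lambda>a. first_turn a \<or> second_turn a"])
  fix x assume x: "is_ordinal x" and IH: "\<And>y. y \<^bold>\<in> x \<Longrightarrow> first_turn y \<or> second_turn y"
  from x show "first_turn x \<or> second_turn x"
  proof (cases rule: ord_cases)
    case (2 y)
    then show ?thesis using IH[of y] second_turn_iff by auto
  qed (auto intro: first_turn_emp first_turn_limit)
qed (assumption, intro defi)

section \<open>Countability\<close>

text \<open>The covering function may take values outside \<open>x\<close>, so the empty set is no
  exception and coverings compose freely.\<close>

lemma countable_iff: "is_countable x \<longleftrightarrow> (\<exists>h. is_fun_on h om \<and> (\<forall>u. u \<^bold>\<in> x \<longrightarrow> (\<exists>n. n \<^bold>\<in> om \<and> app h n = u)))"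
proof
  assume "is_countable x"
  then obtain f where f: "is_injection f x om" unfolding is_countable_def by auto
  let ?F = "\<lambda>n. the1 (\<lambda>u. u \<^bold>\<in> x \<and> app f u = n)"
  have T: "Tf True (\<lambda>s. ?F (s 0))" by (intro defi)
  have 1: "?F (app f u) = u" if "u \<^bold>\<in> x" for u
    by (rule the1_eq) (use f that in \<open>auto simp: is_injection_iff\<close>)
  have 2: "app f u \<^bold>\<in> om" if "u \<^bold>\<in> x" for u
    using f that unfolding is_injection_iff by blast
  have 3: "app (Lam om ?F) (app f u) = u" if "u \<^bold>\<in> x" for u
    unfolding app_Lam[OF T 2[OF that]] by (rule 1[OF that])
  show "\<exists>h. is_fun_on h om \<and> (\<forall>u. u \<^bold>\<in> x \<longrightarrow> (\<exists>n. n \<^bold>\<in> om \<and> app h n = u))"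
  proof (rule exI[of _ "Lam om ?F"], intro conjI allI impI is_fun_on_Lam[OF T])
    fix u assume u: "u \<^bold>\<in> x"
    show "\<exists>n. n \<^bold>\<in> om \<and> app (Lam om ?F) n = u"
      by (rule exI[of _ "app f u"], intro conjI 2[OF u] 3[OF u])
  qed
next
  assume "\<exists>h. is_fun_on h om \<and> (\<forall>u. u \<^bold>\<in> x \<longrightarrow> (\<exists>n. n \<^bold>\<in> om \<and> app h n = u))"
  then obtain h where h: "\<And>u. u \<^bold>\<in> x \<Longrightarrow> \<exists>n. n \<^bold>\<in> om \<and> app h n = u" by blast
  let ?F = "\<lambda>u. leastord (\<lambda>n. n \<^bold>\<in> om \<and> app h n = u)"
  have T: "Tf True (\<lambda>s. ?F (s 0))" by (intro defi)
  have *: "?F u \<^bold>\<in> om \<and> app h (?F u) = u" if u: "u \<^bold>\<in> x" for u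
  proof -
    have D: "Df True (\<lambda>s. s 0 \<^bold>\<in> om \<and> app h (s 0) = u)" by (intro defi)
    obtain n where "n \<^bold>\<in> om" "app h n = u" using h[OF u] by blast
    then show ?thesis using leastord(2)[OF om_ordD, of n "\<lambda>n. n \<^bold>\<in> om \<and> app h n = u", OF _ _ D] by blast
  qed
  have "is_injection (Lam x ?F) x om" unfolding is_injection_iff
  proof (intro conjI allI impI is_fun_on_Lam[OF T])
    show "app (Lam x ?F) a \<^bold>\<in> om" if "a \<^bold>\<in> x" for a
      unfolding app_Lam[OF T that] by (rule conjunct1[OF *[OF that]])
    fix a b assume "a \<^bold>\<in> x \<and> b \<^bold>\<in> x \<and> app (Lam x ?F) a = app (Lam x ?F) b"
    then have a: "a \<^bold>\<in> x" and b: "b \<^bold>\<in> x" and e: "app (Lam x ?F) a = app (Lam x ?F) b" by blast+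
    have "?F a = ?F b" using e unfolding app_Lam[OF T a] app_Lam[OF T b] .
    then show "a = b" by (rule box_equals[OF arg_cong[of _ _ "app h"] conjunct2[OF *[OF a]] conjunct2[OF *[OF b]]])
  qed
  then show "is_countable x" unfolding is_countable_def by auto
qed

lemma countable_sub: "is_countable x \<Longrightarrow> y \<^bold>\<subseteq> x \<Longrightarrow> is_countable y"
  unfolding countable_iff sub_def by meson

lemma countable_cover:
  assumes T: "Tf True (\<lambda>s. F (s 0))" and "\<And>u. u \<^bold>\<in> x \<Longrightarrow> \<exists>n. n \<^bold>\<in> om \<and> F n = u"
  shows "is_countable x"
  unfolding countable_iff using is_fun_on_Lam[OF T, of om] app_Lam[OF T, of _ om] assms(2)
  by (intro exI[of _ "Lam om F"]) metis

lemma countable_image: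
  assumes x: "is_countable x" and T: "Tf True (\<lambda>s. F (s 0))" and y: "\<And>u. u \<^bold>\<in> y \<Longrightarrow> \<exists>a. a \<^bold>\<in> x \<and> u = F a"
  shows "is_countable y"
proof -
  obtain h where h: "\<forall>u. u \<^bold>\<in> x \<longrightarrow> (\<exists>n. n \<^bold>\<in> om \<and> app h n = u)" using x countable_iff by blast
  have "Tf True (\<lambda>s. F (app h (s 0)))" by (intro defi Tf_comp1[where F = F, OF T])
  then show ?thesis by (rule countable_cover[where F = "\<lambda>n. F (app h n)"]) (use h y in metis)
qed

lemma countable_om: "is_countable om"
  by (rule countable_cover[where F = "\<lambda>n. n"]) (auto intro: Tf_var)

lemma countable_upair: "is_countable (upair a b)"
proof (rule countable_cover[where F = "\<lambda>n. if n = emp then a else b"])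
  show "Tf True (\<lambda>s. if s 0 = emp then a else b)" by (intro defi)
  fix u assume "u \<^bold>\<in> upair a b"
  then show "\<exists>n. n \<^bold>\<in> om \<and> (if n = emp then a else b) = u"
    using emp_om suc_om[OF emp_om] suc_neq_emp mem_upair by metis
qed

text \<open>Collection confines witnesses to one level \<open>V c\<close>. The axiom wants a
  disjoint family, so each witness is tagged with its \<open>y\<close>.\<close>

lemma choice_function:
  assumes ex: "\<And>y. y \<^bold>\<in> x \<Longrightarrow> \<exists>z. R y z" and D: "Df True (\<lambda>s. R (s 0) (s 1))"
  shows "\<exists>h. is_fun_on h x \<and> (\<forall>y. y \<^bold>\<in> x \<longrightarrow> R y (app h y))"
proof -
  have DR: "Df True (\<lambda>s. R (t s) (u s))" if "Tf True t" "Tf True u" for t u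
    by (rule Df_comp2[where P = R, OF D that])
  have D1: "Df True (\<lambda>s. \<exists>z. z \<^bold>\<in> V (s 1) \<and> R (s 0) z)" by (intro defi DR)
  have "\<exists>a. is_ordinal a \<and> (\<exists>z. z \<^bold>\<in> V a \<and> R y z)" if "y \<^bold>\<in> x" for y
    using ex[OF that] ex_V by blast
  then obtain c where c: "is_ordinal c" "\<forall>y. y \<^bold>\<in> x \<longrightarrow> (\<exists>a. a \<^bold>\<in> c \<and> (\<exists>z. z \<^bold>\<in> V a \<and> R y z))"
    using collect_ord[of x "\<lambda>y a. \<exists>z. z \<^bold>\<in> V a \<and> R y z", OF _ D1] by blast
  have exc: "\<exists>z. z \<^bold>\<in> V c \<and> R y z" if "y \<^bold>\<in> x" for y
    using c that V_mono_mem[OF c(1)] subD by blast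
  define B where "B y = sep (Prod (upair y y) (V c)) (\<lambda>p. \<exists>z. p = pr y z \<and> R y z)" for y
  have TB: "Tf True (\<lambda>s. B (s 0))" unfolding B_def by (intro defi DR)
  have B: "p \<^bold>\<in> B y \<longleftrightarrow> (\<exists>z. p = pr y z \<and> z \<^bold>\<in> V c \<and> R y z)" for p y
  proof -
    have "p \<^bold>\<in> B y \<longleftrightarrow> p \<^bold>\<in> Prod (upair y y) (V c) \<and> (\<exists>z. p = pr y z \<and> R y z)"
      unfolding B_def by (rule mem_sep) (intro defi DR)
    then show ?thesis by auto
  qed
  have "\<exists>C. \<forall>b. b \<^bold>\<in> img x B \<longrightarrow> (\<exists>!z. z \<^bold>\<in> b \<and> z \<^bold>\<in> C)"
  proof (rule choice)
    fix b assume "b \<^bold>\<in> img x B"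
    then obtain y where y: "y \<^bold>\<in> x" "b = B y" using mem_img[OF TB] by blast
    then obtain z where "pr y z \<^bold>\<in> b" using exc B by blast
    then show "\<not> is_empty b" by auto
  next
    fix b b' p assume "b \<^bold>\<in> img x B" "b' \<^bold>\<in> img x B" "p \<^bold>\<in> b" "p \<^bold>\<in> b'"
    then show "b = b'" unfolding mem_img[OF TB] using B by (metis pr_inject)
  qed
  then obtain C where C0: "\<forall>b. b \<^bold>\<in> img x B \<longrightarrow> (\<exists>!z. z \<^bold>\<in> b \<and> z \<^bold>\<in> C)" by blast
  have C: "\<exists>!z. z \<^bold>\<in> B y \<and> z \<^bold>\<in> C" if "y \<^bold>\<in> x" for y
  proof -
    have "B y \<^bold>\<in> img x B" unfolding mem_img[OF TB] using that by blast
    then show ?thesis using C0 by blast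
  qed
  let ?F = "\<lambda>y. the1 (\<lambda>z. pr y z \<^bold>\<in> B y \<and> pr y z \<^bold>\<in> C)"
  have TF: "Tf True (\<lambda>s. ?F (s 0))"
    by (intro defi Tf_comp1[where F = B, OF TB])
  have "R y (?F y)" if y: "y \<^bold>\<in> x" for y
  proof -
    obtain p where p: "p \<^bold>\<in> B y" "p \<^bold>\<in> C" "\<And>q. q \<^bold>\<in> B y \<Longrightarrow> q \<^bold>\<in> C \<Longrightarrow> q = p" using C[OF y] by blast
    obtain z where z: "p = pr y z" "R y z" using p(1) unfolding B by blast
    have "?F y = z"
    proof (rule the1_eq)
      show "pr y z \<^bold>\<in> B y \<and> pr y z \<^bold>\<in> C" using p(1,2) z(1) by simp
      fix w assume "pr y w \<^bold>\<in> B y \<and> pr y w \<^bold>\<in> C"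
      then have "pr y w = p" using p(3)[of "pr y w"] by blast
      then show "w = z" using z(1) by simp
    qed
    then show ?thesis using z by simp
  qed
  then show ?thesis using is_fun_on_Lam[OF TF, of x] app_Lam[OF TF, of _ x] by (intro exI[of _ "Lam x ?F"]) simp
qed

section \<open>Projections and an enumeration of pairs of natural numbers\<close>

definition pfst where "pfst t = the1 (\<lambda>a. \<exists>b. t = pr a b)"
definition psnd where "psnd t = the1 (\<lambda>b. \<exists>a. t = pr a b)"

lemma Tf_pfst [defi]: "Tf b t \<Longrightarrow> Tf b (\<lambda>s. pfst (t s))"
  by (rule Tf_comp1[where F = pfst]; (assumption | (unfold pfst_def, intro defi)))
lemma Tf_psnd [defi]: "Tf b t \<Longrightarrow> Tf b (\<lambda>s. psnd (t s))"
  by (rule Tf_comp1[where F = psnd]; (assumption | (unfold psnd_def, intro defi)))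

lemma pfst_pr [simp]: "pfst (pr a b) = a" unfolding pfst_def by (rule the1_eq) auto
lemma psnd_pr [simp]: "psnd (pr a b) = b" unfolding psnd_def by (rule the1_eq) auto

text \<open>
  \<open>triple\<close> enumerates the triples \<open>(m, k, n)\<close> with \<open>m, k \<le> n\<close>, staying put at the first player's turns,
  so that each pair of natural numbers is named by some turn of the second player below \<open>\<omega>\<close>.
\<close>

definition next_triple where
  "next_triple t = (if pfst t \<^bold>\<in> psnd (psnd t) then pr (suc (pfst t)) (psnd t)
    else if pfst (psnd t) \<^bold>\<in> psnd (psnd t) then pr emp (pr (suc (pfst (psnd t))) (psnd (psnd t)))
    else pr emp (pr emp (suc (psnd (psnd t)))))"

text \<open>The state carries its own index, since a recursion by \<open>nrec\<close> sees the
  previous value only and has to know whose turn it was.\<close>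

definition triple_step where "triple_step t = pr (suc (pfst t)) (if first_turn (pfst t) then psnd t else next_triple (psnd t))"

definition triple where "triple n = psnd (nrec (pr emp (pr emp (pr emp emp))) triple_step n)"

lemma Tf_next_triple [defi]: "Tf b t \<Longrightarrow> Tf b (\<lambda>s. next_triple (t s))"
  by (rule Tf_comp1[where F = next_triple]; (assumption | (unfold next_triple_def, intro defi)))
lemma Tf_triple_step [defi]: "Tf b t \<Longrightarrow> Tf b (\<lambda>s. triple_step (t s))"
  by (rule Tf_comp1[where F = triple_step]; (assumption | (unfold triple_step_def, intro defi)))
lemma Tf_triple [defi]: "Tf b t \<Longrightarrow> Tf b (\<lambda>s. triple (t s))"
  by (rule Tf_comp1[where F = triple]; (assumption | (unfold triple_def, intro defi)))

lemma triple_emp: "triple emp = pr emp (pr emp emp)"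
  and triple_suc: "n \<^bold>\<in> om \<Longrightarrow> triple (suc n) = (if first_turn n then triple n else next_triple (triple n))"
proof -
  let ?c = "nrec (pr emp (pr emp (pr emp emp))) triple_step"
  have T: "Tf True (\<lambda>s. triple_step (s 0))" by (intro defi)
  have c: "?c (suc n) = triple_step (?c n)" if "n \<^bold>\<in> om" for n by (rule nrec_suc[OF T om_ordD[OF that]])
  have i: "pfst (?c n) = n" if "n \<^bold>\<in> om" for n
    by (rule om_induct[OF that, where P = "\<lambda>n. pfst (?c n) = n"])
      (intro defi, simp add: nrec_emp[OF T], simp add: c triple_step_def)
  show "triple emp = pr emp (pr emp emp)" unfolding triple_def nrec_emp[OF T] by simp
  show "n \<^bold>\<in> om \<Longrightarrow> triple (suc n) = (if first_turn n then triple n else next_triple (triple n))"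
    unfolding triple_def by (simp add: c i triple_step_def)
qed

definition visited where "visited t \<longleftrightarrow> (\<exists>b. b \<^bold>\<in> om \<and> second_turn b \<and> triple b = t)"

lemma Df_visited [defi]: "Tf b t \<Longrightarrow> Df b (\<lambda>s. visited (t s))"
  by (rule Df_comp1[where P = visited]; (assumption | (unfold visited_def, intro defi)))

lemma visited_start: "visited (pr emp (pr emp emp))"
  unfolding visited_def
  by (rule exI[of _ "suc emp"]) (simp add: triple_suc triple_emp first_turn_emp)

text \<open>Two steps lead from one turn of the second player to the next, and exactly one of them
  advances the triple.\<close>

lemma visited_next_triple: "visited t \<Longrightarrow> visited (next_triple t)"
proof -
  assume "visited t"
  then obtain c where c: "suc c \<^bold>\<in> om" "first_turn c" "triple (suc c) = t"
    unfolding visited_def second_turn_iff by blast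
  have "\<not> first_turn (suc c)" using first_not_second[of "suc c"] c om_ordD[OF c(1)] by auto
  then have "triple (suc (suc (suc c))) = next_triple t" using c triple_suc by simp
  then show ?thesis unfolding visited_def using c by (intro exI[of _ "suc (suc (suc c))"]) simp
qed

text \<open>The enumeration varies \<open>m\<close> fastest, then \<open>k\<close>, then
  \<open>n\<close>; \<open>row\<close> and \<open>column\<close> are the two inner inductions, and
  the last triple for \<open>n\<close> is followed by the first one for
  \<open>suc n\<close>.\<close>

lemma visited_all:
  assumes n: "n \<^bold>\<in> om" and m: "m \<^bold>\<in> suc n" and k: "k \<^bold>\<in> suc n"
  shows "visited (pr m (pr k n))"
proof -
  have row: "visited (pr m (pr k n))" if v: "visited (pr emp (pr k n))" and n: "n \<^bold>\<in> om" and m: "m \<^bold>\<in> suc n" for m k n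
  proof -
    have mo: "m \<^bold>\<in> om" using ord_trans[OF om_ord m] n by simp
    have "m \<^bold>\<in> suc n \<longrightarrow> visited (pr m (pr k n))"
    proof (rule om_induct[OF mo, where P = "\<lambda>m. m \<^bold>\<in> suc n \<longrightarrow> visited (pr m (pr k n))"])
      fix j assume IH: "j \<^bold>\<in> suc n \<longrightarrow> visited (pr j (pr k n))"
      show "suc j \<^bold>\<in> suc n \<longrightarrow> visited (pr (suc j) (pr k n))"
      proof
        assume "suc j \<^bold>\<in> suc n"
        then have "j \<^bold>\<in> n" using ord_trans[of n j "suc j"] om_ordD[OF n] by auto
        then show "visited (pr (suc j) (pr k n))" using visited_next_triple[of "pr j (pr k n)"] IH by (simp add: next_triple_def)
      qed
    qed (use v in \<open>auto intro!: defi\<close>)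
    then show ?thesis using m by blast
  qed
  have column: "visited (pr emp (pr k n))" if v: "visited (pr emp (pr emp n))" and n: "n \<^bold>\<in> om" and k: "k \<^bold>\<in> suc n" for k n
  proof -
    have ko: "k \<^bold>\<in> om" using ord_trans[OF om_ord k] n by simp
    have "k \<^bold>\<in> suc n \<longrightarrow> visited (pr emp (pr k n))"
    proof (rule om_induct[OF ko, where P = "\<lambda>k. k \<^bold>\<in> suc n \<longrightarrow> visited (pr emp (pr k n))"])
      fix j assume IH: "j \<^bold>\<in> suc n \<longrightarrow> visited (pr emp (pr j n))"
      show "suc j \<^bold>\<in> suc n \<longrightarrow> visited (pr emp (pr (suc j) n))"
      proof
        assume "suc j \<^bold>\<in> suc n"
        then have j: "j \<^bold>\<in> n" using ord_trans[of n j "suc j"] om_ordD[OF n] by auto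
        then have "visited (pr n (pr j n))" using row[of j n n] IH n by simp
        then show "visited (pr emp (pr (suc j) n))" using visited_next_triple[of "pr n (pr j n)"] j by (simp add: next_triple_def)
      qed
    qed (use v in \<open>auto intro!: defi\<close>)
    then show ?thesis using k by blast
  qed
  have "visited (pr emp (pr emp n))"
  proof (rule om_induct[OF n, where P = "\<lambda>n. visited (pr emp (pr emp n))"])
    fix j assume j: "j \<^bold>\<in> om" "visited (pr emp (pr emp j))"
    have "visited (pr j (pr j j))" using row[OF column[OF j(2,1)] j(1)] by simp
    then show "visited (pr emp (pr emp (suc j)))" using visited_next_triple[of "pr j (pr j j)"] by (simp add: next_triple_def)
  qed (intro defi visited_start)+
  then show ?thesis using row column n m k by blast
qed

lemma triple_surj: "i \<^bold>\<in> om \<Longrightarrow> j \<^bold>\<in> om \<Longrightarrow> \<exists>b k. b \<^bold>\<in> om \<and> second_turn b \<and> triple b = pr i (pr j k)"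
proof -
  assume i: "i \<^bold>\<in> om" and j: "j \<^bold>\<in> om"
  have o: "is_ordinal i" "is_ordinal j" using i j om_ordD by blast+
  have u: "un i j \<^bold>\<in> om" using un_cases[OF o] i j by auto
  have "i \<^bold>\<in> suc (un i j)" "j \<^bold>\<in> suc (un i j)"
    using ord_sub_iff[OF o(1) om_ordD[OF u]] ord_sub_iff[OF o(2) om_ordD[OF u]] un_left un_right by auto
  then have "visited (pr i (pr j (un i j)))" using visited_all[OF u] by blast
  then show ?thesis unfolding visited_def by blast
qed

text \<open>Choose a covering of each member; \<open>triple\<close> then enumerates the double
  sequence, its first two components serving as indices.\<close>

lemma countable_uni:
  assumes x: "is_countable x" and y: "\<And>y. y \<^bold>\<in> x \<Longrightarrow> is_countable y"
  shows "is_countable (uni x)"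
proof -
  obtain h where h: "\<forall>u. u \<^bold>\<in> x \<longrightarrow> (\<exists>n. n \<^bold>\<in> om \<and> app h n = u)" using x countable_iff by blast
  have D: "Df True (\<lambda>s. \<forall>u. u \<^bold>\<in> s 0 \<longrightarrow> (\<exists>n. n \<^bold>\<in> om \<and> app (s 1) n = u))" by (intro defi)
  obtain H where H: "\<And>y u. y \<^bold>\<in> x \<Longrightarrow> u \<^bold>\<in> y \<Longrightarrow> \<exists>n. n \<^bold>\<in> om \<and> app (app H y) n = u"
    using choice_function[of x "\<lambda>y f. \<forall>u. u \<^bold>\<in> y \<longrightarrow> (\<exists>n. n \<^bold>\<in> om \<and> app f n = u)", OF _ D] y
    unfolding countable_iff by blast
  show ?thesis
  proof (rule countable_cover[where F = "\<lambda>n. app (app H (app h (pfst (triple n)))) (pfst (psnd (triple n)))"])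
    show "Tf True (\<lambda>s. app (app H (app h (pfst (triple (s 0))))) (pfst (psnd (triple (s 0)))))" by (intro defi)
    fix u assume "u \<^bold>\<in> uni x"
    then obtain y where y: "y \<^bold>\<in> x" "u \<^bold>\<in> y" by auto
    obtain i j where i: "i \<^bold>\<in> om" "app h i = y" and j: "j \<^bold>\<in> om" "app (app H y) j = u" using h H y by blast
    obtain b k where "b \<^bold>\<in> om" "triple b = pr i (pr j k)" using triple_surj[OF i(1) j(1)] by blast
    then show "\<exists>n. n \<^bold>\<in> om \<and> app (app H (app h (pfst (triple n)))) (pfst (psnd (triple n))) = u"
      using i j by (intro exI[of _ b]) simp
  qed
qed

section \<open>The first uncountable ordinal and order types of unbounded sets\<close>

text \<open>The order type of the part of \<open>U\<close> below the ordinal \<open>a\<close>. Being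
  defined also for \<open>a\<close> outside \<open>U\<close>, it is a plain transfinite recursion;
  on a set \<open>U\<close> of ordinals it is the collapsing isomorphism.\<close>

definition collapse where "collapse U a = rec (\<lambda>f. img (sep U (\<lambda>c. c \<^bold>\<in> dom f)) (\<lambda>c. app f c)) a"

lemma Tf_collapse [defi]: "Tf b t \<Longrightarrow> Tf b u \<Longrightarrow> Tf b (\<lambda>s. collapse (t s) (u s))"
  by (rule Tf_comp2[where F = collapse]; (assumption | (unfold collapse_def, intro defi)))

lemma mem_collapse: "is_ordinal a \<Longrightarrow> z \<^bold>\<in> collapse U a \<longleftrightarrow> (\<exists>c. c \<^bold>\<in> U \<and> c \<^bold>\<in> a \<and> z = collapse U c)"
proof -
  assume a: "is_ordinal a"
  let ?G = "\<lambda>f. img (sep U (\<lambda>c. c \<^bold>\<in> dom f)) (\<lambda>c. app f c)"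
  have G: "Tf True (\<lambda>s. ?G (s 0))" by (intro defi)
  have R: "Tf True (\<lambda>s. rec ?G (s 0))" by (intro defi)
  have e: "collapse U a = ?G (Lam a (rec ?G))" unfolding collapse_def by (rule rec_eq[OF a G])
  have d: "dom (Lam a (rec ?G)) = a" by (rule dom_fun[OF is_fun_on_Lam[OF R]])
  have I: "Tf True (\<lambda>s. app (Lam a (rec ?G)) (s 0))" by (intro defi)
  have S: "c \<^bold>\<in> sep U (\<lambda>c. c \<^bold>\<in> a) \<longleftrightarrow> c \<^bold>\<in> U \<and> c \<^bold>\<in> a" for c by (rule mem_sep) (intro defi)
  have ap: "app (Lam a (rec ?G)) c = collapse U c" if "c \<^bold>\<in> a" for c
    unfolding collapse_def by (rule app_Lam[OF R that])
  show ?thesis unfolding e d mem_img[OF I] S using ap by auto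
qed

lemma collapse_mono: "is_ordinal a \<Longrightarrow> c \<^bold>\<in> U \<Longrightarrow> c \<^bold>\<in> a \<Longrightarrow> collapse U c \<^bold>\<in> collapse U a"
  using mem_collapse by blast

lemma ord_collapse: "is_ordinal a \<Longrightarrow> is_ordinal (collapse U a)"
proof (rule ord_induct[where P = "\<lambda>a. is_ordinal (collapse U a)"])
  fix x assume x: "is_ordinal x" and IH: "\<And>y. y \<^bold>\<in> x \<Longrightarrow> is_ordinal (collapse U y)"
  show "is_ordinal (collapse U x)"
  proof (rule ord_setI)
    fix y assume "y \<^bold>\<in> collapse U x"
    then obtain c where "c \<^bold>\<in> x" "y = collapse U c" unfolding mem_collapse[OF x] by blast
    then show "is_ordinal y" using IH by simp
  next
    fix y z assume y: "y \<^bold>\<in> collapse U x" "z \<^bold>\<in> y"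
    obtain c where c: "c \<^bold>\<in> U" "c \<^bold>\<in> x" "y = collapse U c" using y mem_collapse[OF x] by blast
    then obtain d where "d \<^bold>\<in> U" "d \<^bold>\<in> c" "z = collapse U d" using y mem_collapse ord_mem[OF x] by blast
    then show "z \<^bold>\<in> collapse U x" using mem_collapse[OF x] ord_trans[OF x _ c(2)] by blast
  qed
qed (assumption, intro defi)

lemma collapse_inject:
  assumes "is_ordinal a" "is_ordinal c" "a \<^bold>\<in> U" "c \<^bold>\<in> U" "collapse U c = collapse U a" shows "c = a"
  using collapse_mono[of a c U] collapse_mono[of c a U] ord_linear[of a c] assms mem_irrefl by metis

section \<open>Regularity of the first uncountable ordinal\<close>

context
  fixes w1 assumes w1: "is_omega1 w1"
begin

lemma w1_ord: "is_ordinal w1" and w1_uncountable: "\<not> is_countable w1" and w1_countable: "a \<^bold>\<in> w1 \<Longrightarrow> is_countable a"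
  using w1 unfolding is_omega1_def by auto

lemma w1_ordD: "a \<^bold>\<in> w1 \<Longrightarrow> is_ordinal a"
  using ord_mem[OF w1_ord] .

lemma countable_mem_w1: "is_ordinal c \<Longrightarrow> is_countable c \<Longrightarrow> c \<^bold>\<in> w1"
  using ord_linear[OF _ w1_ord, of c] w1_uncountable countable_sub[of c w1] ord_mem_sub[of c w1] by auto

lemma om_mem_w1: "om \<^bold>\<in> w1"
  by (rule countable_mem_w1) (simp_all add: countable_om)

lemma w1_suc: "a \<^bold>\<in> w1 \<Longrightarrow> suc a \<^bold>\<in> w1"
proof (rule countable_mem_w1)
  assume a: "a \<^bold>\<in> w1"
  then show "is_ordinal (suc a)" using w1_ordD by simp
  have "is_countable (uni (upair a (upair a a)))"
    by (rule countable_uni[OF countable_upair]) (auto intro: countable_upair w1_countable a)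
  moreover have "suc a \<^bold>\<subseteq> uni (upair a (upair a a))" unfolding sub_def mem_uni_upair by simp
  ultimately show "is_countable (suc a)" by (rule countable_sub)
qed

text \<open>The supremum is a countable union of countable ordinals, hence again countable.\<close>

lemma countable_bounded:
  assumes x: "is_countable x" "x \<^bold>\<subseteq> w1" shows "\<exists>b. b \<^bold>\<in> w1 \<and> x \<^bold>\<subseteq> b"
proof -
  have m: "y \<^bold>\<in> w1" if "y \<^bold>\<in> x" for y using x that subD by blast
  have o: "is_ordinal (uni x)" by (rule ord_uni) (use m w1_ordD in blast)
  have "is_countable (uni x)" by (rule countable_uni[OF x(1)]) (use m w1_countable in blast)
  then have u: "uni x \<^bold>\<in> w1" by (rule countable_mem_w1[OF o])
  have "y \<^bold>\<in> suc (uni x)" if y: "y \<^bold>\<in> x" for y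
  proof -
    have "y \<^bold>\<subseteq> uni x" using y by (auto simp: sub_def)
    then show ?thesis using ord_sub_iff[OF w1_ordD[OF m[OF y]] o] by simp
  qed
  then show ?thesis using w1_suc[OF u] by (intro exI[of _ "suc (uni x)"]) (simp add: sub_def)
qed

definition unbounded where "unbounded U \<longleftrightarrow> U \<^bold>\<subseteq> w1 \<and> (\<forall>b. b \<^bold>\<in> w1 \<longrightarrow> \<not> U \<^bold>\<subseteq> b)"

lemma collapse_mem_w1: "a \<^bold>\<in> w1 \<Longrightarrow> collapse U a \<^bold>\<in> w1"
proof (rule countable_mem_w1)
  assume a: "a \<^bold>\<in> w1"
  show "is_ordinal (collapse U a)" by (rule ord_collapse[OF w1_ordD[OF a]])
  have T: "Tf True (\<lambda>s. collapse U (s 0))" by (intro defi)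
  show "is_countable (collapse U a)"
    by (rule countable_image[OF w1_countable[OF a] T]) (use mem_collapse[OF w1_ordD[OF a]] in blast)
qed

text \<open>The image of \<open>U\<close> is an ordinal. Were it countable, injectivity of the
  collapse would make \<open>U\<close> countable and hence bounded.\<close>

lemma collapse_onto:
  assumes U: "unbounded U" and b: "b \<^bold>\<in> w1" shows "\<exists>a. a \<^bold>\<in> U \<and> collapse U a = b"
proof -
  have Uw: "a \<^bold>\<in> w1" if "a \<^bold>\<in> U" for a using U that subD unfolding unbounded_def by blast
  have T: "Tf True (\<lambda>s. collapse U (s 0))" by (intro defi)
  define g where "g = img U (collapse U)"
  have g: "z \<^bold>\<in> g \<longleftrightarrow> (\<exists>a. a \<^bold>\<in> U \<and> z = collapse U a)" for z
    unfolding g_def by (rule mem_img[where F = "collapse U", OF T])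
  have og: "is_ordinal g"
  proof (rule ord_setI)
    fix y assume "y \<^bold>\<in> g"
    then obtain a where "a \<^bold>\<in> U" "y = collapse U a" unfolding g by blast
    then show "is_ordinal y" using ord_collapse[OF w1_ordD[OF Uw]] by simp
  next
    fix y z assume y: "y \<^bold>\<in> g" "z \<^bold>\<in> y"
    then obtain a where a: "a \<^bold>\<in> U" "y = collapse U a" unfolding g by blast
    then show "z \<^bold>\<in> g" using y(2) unfolding a(2) mem_collapse[OF w1_ordD[OF Uw[OF a(1)]]] g by blast
  qed
  have "\<not> g \<^bold>\<in> w1"
  proof
    assume gw: "g \<^bold>\<in> w1"
    let ?F = "\<lambda>c. the1 (\<lambda>a. a \<^bold>\<in> U \<and> collapse U a = c)"
    have TF: "Tf True (\<lambda>s. ?F (s 0))" by (intro defi)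
    have "?F (collapse U a) = a" if a: "a \<^bold>\<in> U" for a
    proof (rule the1_eq)
      fix y assume y: "y \<^bold>\<in> U \<and> collapse U y = collapse U a"
      show "y = a" by (rule collapse_inject) (use y a Uw w1_ordD in blast)+
    qed (use a in blast)
    then have "is_countable U"
      by (intro countable_image[OF w1_countable[OF gw] TF]) (metis g)
    then show False using U countable_bounded unfolding unbounded_def by blast
  qed
  then have "w1 \<^bold>\<subseteq> g" using ord_not_mem[OF og w1_ord] by blast
  then have "b \<^bold>\<in> g" by (rule subD[OF _ b])
  then show ?thesis unfolding g by blast
qed

end

section \<open>Coding by countable sequences of ordinals\<close>

text \<open>
  The codable sets are those that are determined by a countable sequence of ordinals, and that
  the second player can therefore name.
\<close>

definition hered where "hered C \<longleftrightarrow> (\<forall>u. u \<^bold>\<in> C \<longrightarrow> is_ordinal u \<or> u \<^bold>\<subseteq> C)"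
definition codable where "codable t \<longleftrightarrow> (\<exists>C. is_countable C \<and> t \<^bold>\<in> C \<and> hered C)"

lemma Df_hered [defi]: "Tf b t \<Longrightarrow> Df b (\<lambda>s. hered (t s))"
  by (rule Df_comp1[where P = hered]; (assumption | (unfold hered_def, intro defi)))
lemma Df_codable [defi]: "Tf b t \<Longrightarrow> Df b (\<lambda>s. codable (t s))"
  by (rule Df_comp1[where P = codable]; (assumption | (unfold codable_def, intro defi)))

lemma countable_un: "is_countable a \<Longrightarrow> is_countable b \<Longrightarrow> is_countable (un a b)"
  unfolding un_def by (rule countable_uni[OF countable_upair]) auto

text \<open>Choose a witness for each element of \<open>t\<close>; their union, with
  \<open>t\<close> itself added, is a witness for \<open>t\<close>.\<close>

lemma codable_countable:
  assumes t: "is_countable t" and e: "\<And>u. u \<^bold>\<in> t \<Longrightarrow> codable u"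
  shows "codable t"
proof -
  let ?R = "\<lambda>u C. is_countable C \<and> u \<^bold>\<in> C \<and> hered C"
  have D: "Df True (\<lambda>s. ?R (s 0) (s 1))" by (intro defi)
  obtain H where H: "\<And>u. u \<^bold>\<in> t \<Longrightarrow> ?R u (app H u)"
    using choice_function[of t ?R, OF _ D] e unfolding codable_def by blast
  have T: "Tf True (\<lambda>s. app H (s 0))" by (intro defi)
  define B where "B = uni (img t (app H))"
  have B: "z \<^bold>\<in> B \<longleftrightarrow> (\<exists>u. u \<^bold>\<in> t \<and> z \<^bold>\<in> app H u)" for z
    unfolding B_def mem_uni mem_img[where F = "app H", OF T] by blast
  have cB: "is_countable B" unfolding B_def
  proof (rule countable_uni)
    show "is_countable (img t (app H))"
      by (rule countable_image[OF t T]) (simp add: mem_img[where F = "app H", OF T])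
    show "is_countable y" if "y \<^bold>\<in> img t (app H)" for y
      using that H unfolding mem_img[where F = "app H", OF T] by blast
  qed
  let ?C = "un (upair t t) B"
  have "is_countable ?C" by (rule countable_un[OF countable_upair cB])
  moreover have "t \<^bold>\<in> ?C" by simp
  moreover have "hered ?C" unfolding hered_def
  proof (intro allI impI)
    fix u assume "u \<^bold>\<in> ?C"
    then consider "u = t" | v where "v \<^bold>\<in> t" "u \<^bold>\<in> app H v" using B by auto
    then show "is_ordinal u \<or> u \<^bold>\<subseteq> ?C"
    proof cases
      case 1
      have "z \<^bold>\<in> B" if "z \<^bold>\<in> t" for z unfolding B using that H by blast
      then show ?thesis using 1 by (simp add: sub_def)
    next
      case (2 v)
      then have "is_ordinal u \<or> u \<^bold>\<subseteq> app H v" using H unfolding hered_def by blast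
      moreover have "app H v \<^bold>\<subseteq> ?C" using 2 by (auto simp: sub_def B)
      ultimately show ?thesis using sub_trans by blast
    qed
  qed
  ultimately show ?thesis unfolding codable_def by blast
qed

text \<open>Ordinals are atoms for \<open>hered\<close>, so a singleton is a witness even when the
  ordinal is uncountable: a single move can name it.\<close>

lemma codable_ordinal: "is_ordinal a \<Longrightarrow> codable a"
  unfolding codable_def hered_def by (intro exI[of _ "upair a a"]) (simp add: countable_upair)

lemma codable_upair: "codable a \<Longrightarrow> codable b \<Longrightarrow> codable (upair a b)"
  by (rule codable_countable[OF countable_upair]) auto

lemma codable_pr: "codable a \<Longrightarrow> codable b \<Longrightarrow> codable (pr a b)"
  unfolding pr_upair by (intro codable_upair)

lemma codable_fun:
  assumes f: "is_fun_on f d" and d: "is_countable d" and c: "\<And>a. a \<^bold>\<in> d \<Longrightarrow> codable a \<and> codable (app f a)"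
  shows "codable f"
proof (rule codable_countable)
  have T: "Tf True (\<lambda>s. pr (s 0) (app f (s 0)))" by (intro defi)
  show "is_countable f"
    by (rule countable_image[OF d T]) (simp add: fun_mem_iff[OF f])
  show "codable u" if "u \<^bold>\<in> f" for u
    using that c codable_pr unfolding fun_mem_iff[OF f] by blast
qed

lemma codable_om: "i \<^bold>\<in> om \<Longrightarrow> codable i"
  by (rule codable_ordinal[OF om_ordD])

lemma codable_formula: "is_formula p \<Longrightarrow> codable p"
proof (erule formula_induct[where P = codable])
  show "Df True (\<lambda>s. codable (s 0))" by (intro defi)
qed (assumption | rule codable_pr | rule codable_om num_om)+

text \<open>
  The moves of the second player below \<open>\<omega>\<close> form a matrix of ordinals indexed by pairs of natural
  numbers; a diagonal entry \<open>suc g\<close> names the ordinal \<open>g\<close>, and otherwise row \<open>i\<close> lists the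
  elements of the set named by \<open>i\<close>.
\<close>

definition entry where
  "entry p i j g \<longleftrightarrow> (\<exists>b k. b \<^bold>\<in> om \<and> second_turn b \<and> triple b = pr i (pr j k) \<and> app p b = suc g)"

lemma Df_entry0: "Df b (\<lambda>s. entry (s 0) (s 1) (s 2) (s 3))"
  unfolding entry_def by (intro defi)
lemmas Df_entry [defi] = Df_comp4[where P = entry, OF Df_entry0]

text \<open>A condition on \<open>f\<close> rather than a recursion: the moves of an arbitrary play
  may describe an ill-founded relation, and then nothing is decoded. Off the diagonal it is the
  presence of an entry that counts.\<close>

definition decodes where
  "decodes p f \<longleftrightarrow> is_fun_on f om \<and> (\<forall>i. i \<^bold>\<in> om \<longrightarrow>
     (\<forall>g. entry p i i g \<longrightarrow> app f i = g) \<and>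
     ((\<forall>g. \<not> entry p i i g) \<longrightarrow>
        (\<forall>u. u \<^bold>\<in> app f i \<longleftrightarrow> (\<exists>j. j \<^bold>\<in> om \<and> (\<exists>g. entry p i j g) \<and> u = app f j))))"

lemma Df_decodes [defi]: "Tf b t \<Longrightarrow> Tf b u \<Longrightarrow> Df b (\<lambda>s. decodes (t s) (u s))"
  by (rule Df_comp2[where P = decodes]; (assumption | (unfold decodes_def, intro defi)))

lemma entry_cong:
  assumes "\<And>b. b \<^bold>\<in> om \<Longrightarrow> second_turn b \<Longrightarrow> app p b = app p' b"
  shows "entry p i j g \<longleftrightarrow> entry p' i j g"
  unfolding entry_def using assms by metis

text \<open>As for the Mostowski collapse: at a minimal value of \<open>f\<close> where the two
  decodings differ, all elements come from smaller values, so extensionality gives a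
  contradiction.\<close>

lemma decodes_unique:
  assumes f: "decodes p f" and f': "decodes p f'" shows "f = f'"
proof -
  have fn: "is_fun_on f om" "is_fun_on f' om" using f f' unfolding decodes_def by blast+
  have e: "app f i = g" "app f' i = g" if "i \<^bold>\<in> om" "entry p i i g" for i g
    using f f' that unfolding decodes_def by blast+
  have m: "u \<^bold>\<in> app f i \<longleftrightarrow> (\<exists>j. j \<^bold>\<in> om \<and> (\<exists>g. entry p i j g) \<and> u = app f j)"
    "u \<^bold>\<in> app f' i \<longleftrightarrow> (\<exists>j. j \<^bold>\<in> om \<and> (\<exists>g. entry p i j g) \<and> u = app f' j)"
    if "i \<^bold>\<in> om" "\<forall>g. \<not> entry p i i g" for i u
    using f f' that unfolding decodes_def by blast+
  have T: "Tf True (\<lambda>s. app f (s 0))" by (intro defi)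
  let ?P = "\<lambda>a. \<exists>i. i \<^bold>\<in> om \<and> app f i = a \<and> app f' i \<noteq> a"
  have D: "Df True (\<lambda>s. ?P (s 0))" by (intro defi)
  have "app f i = app f' i" if i: "i \<^bold>\<in> om" for i
  proof (rule ccontr)
    assume "app f i \<noteq> app f' i"
    then have P: "?P (app f i)" using i by metis
    have mi: "app f i \<^bold>\<in> img om (app f)" unfolding mem_img[where F = "app f", OF T] using i by blast
    obtain a where a: "?P a" "\<And>z. z \<^bold>\<in> a \<Longrightarrow> z \<^bold>\<in> img om (app f) \<Longrightarrow> \<not> ?P z"
      by (rule mem_minimal[where P = ?P, OF mi P D]) (rule that; assumption)
    then obtain k where k: "k \<^bold>\<in> om" "app f k = a" "app f' k \<noteq> a" by blast
    have ne: "\<forall>g. \<not> entry p k k g" using e k by metis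
    have eq: "app f' j = app f j" if "j \<^bold>\<in> om" "entry p k j g" for j g
    proof -
      have "app f j \<^bold>\<in> a" using m(1)[OF k(1) ne] that k(2) by blast
      moreover have "app f j \<^bold>\<in> img om (app f)" unfolding mem_img[where F = "app f", OF T] using that by blast
      ultimately have "\<not> ?P (app f j)" using a(2) by blast
      then show ?thesis using that by blast
    qed
    have "app f k = app f' k"
    proof (rule set_ext)
      fix u show "u \<^bold>\<in> app f k \<longleftrightarrow> u \<^bold>\<in> app f' k"
        unfolding m[OF k(1) ne] using eq by metis
    qed
    then show False using k by simp
  qed
  then show ?thesis by (rule fun_ext[OF fn])
qed

section \<open>Spelling out a countable set\<close>

definition named where "named g C i = the1 (\<lambda>u. u \<^bold>\<in> C \<and> app g u = i)"
definition is_name where "is_name g C i \<longleftrightarrow> (\<exists>u. u \<^bold>\<in> C \<and> app g u = i)"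

text \<open>Every entry is a successor, so that the move \<open>emp\<close> can stand for the
  absence of an entry and the ordinal zero can still be named.\<close>

definition matrix where
  "matrix g C i j = (if i = j
     then if is_name g C i \<and> is_ordinal (named g C i) then suc (named g C i) else emp
     else if is_name g C i \<and> is_name g C j \<and> \<not> is_ordinal (named g C i) \<and> named g C j \<^bold>\<in> named g C i
       then suc emp else emp)"

lemma Df_is_name0: "Df b (\<lambda>s. is_name (s 0) (s 1) (s 2))"
  unfolding is_name_def by (intro defi)
lemmas Df_is_name [defi] = Df_comp3[where P = is_name, OF Df_is_name0]

lemma Tf_named0: "Tf b (\<lambda>s. named (s 0) (s 1) (s 2))"
  unfolding named_def by (intro defi)
lemmas Tf_named [defi] = Tf_comp3[where F = named, OF Tf_named0]

definition coding_move where "coding_move g C b = matrix g C (pfst (triple b)) (pfst (psnd (triple b)))"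

lemma Tf_coding_move0: "Tf b (\<lambda>s. coding_move (s 0) (s 1) (s 2))"
  unfolding coding_move_def matrix_def by (intro defi)
lemmas Tf_coding_move [defi] = Tf_comp3[where F = coding_move, OF Tf_coding_move0]

text \<open>Bounds the moves needed for naming, so that a single ordinal can serve as move
  set.\<close>

lemma coding_move_cases:
  "coding_move g C b = emp \<or> coding_move g C b = suc emp \<or>
    (\<exists>u. u \<^bold>\<in> C \<and> is_ordinal u \<and> coding_move g C b = suc u)" if g: "is_injection g C om"
proof -
  have "named g C (app g u) = u" if "u \<^bold>\<in> C" for u
    unfolding named_def by (rule the1_eq) (use that g in \<open>auto simp: is_injection_iff\<close>)
  then have "named g C i \<^bold>\<in> C" if "is_name g C i" for i using that unfolding is_name_def by auto
  then show ?thesis unfolding coding_move_def matrix_def by auto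
qed

lemma decodes_coding:
  assumes C: "hered C" and g: "is_injection g C om"
    and p: "\<And>b. b \<^bold>\<in> om \<Longrightarrow> second_turn b \<Longrightarrow> app p b = coding_move g C b"
  shows "\<exists>f. decodes p f \<and> (\<forall>u. u \<^bold>\<in> C \<longrightarrow> app f (app g u) = u)"
proof -
  have g1: "app g u \<^bold>\<in> om" if "u \<^bold>\<in> C" for u using g that unfolding is_injection_iff by blast
  have g2: "u = v" if "u \<^bold>\<in> C" "v \<^bold>\<in> C" "app g u = app g v" for u v
    using g that unfolding is_injection_iff by blast
  have nm: "named g C (app g u) = u" if "u \<^bold>\<in> C" for u
    unfolding named_def by (rule the1_eq) (use that g2 in blast)+
  have ent: "entry p i j h \<longleftrightarrow> matrix g C i j = suc h" if ij: "i \<^bold>\<in> om" "j \<^bold>\<in> om" for i j h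
  proof
    assume "entry p i j h"
    then obtain b k where "b \<^bold>\<in> om" "second_turn b" "triple b = pr i (pr j k)" "app p b = suc h"
      unfolding entry_def by blast
    then show "matrix g C i j = suc h" using p[of b] unfolding coding_move_def by simp
  next
    assume h: "matrix g C i j = suc h"
    obtain b k where b: "b \<^bold>\<in> om" "second_turn b" "triple b = pr i (pr j k)" using triple_surj[OF ij] by blast
    then have "app p b = suc h" using p[of b] h unfolding coding_move_def by simp
    then show "entry p i j h" unfolding entry_def using b by blast
  qed
  have T: "Tf True (\<lambda>s. named g C (s 0))" by (intro defi)
  define f where "f = Lam om (named g C)"
  have f: "is_fun_on f om" unfolding f_def by (rule is_fun_on_Lam[where F = "named g C", OF T])
  have ap: "app f i = named g C i" if "i \<^bold>\<in> om" for i
    unfolding f_def by (rule app_Lam[where F = "named g C", OF T that])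
  \<comment> \<open>A row without entries decodes to the empty set, and \<open>emp\<close> is also
    the default value of \<open>named\<close>; indices that name nothing therefore cause no
    conflict.\<close>
  have no: "named g C i = emp" if "\<not> is_name g C i" for i
    using that unfolding named_def the1_def is_name_def by auto
  have main: "(\<forall>h. entry p i i h \<longrightarrow> app f i = h) \<and>
     ((\<forall>h. \<not> entry p i i h) \<longrightarrow>
        (\<forall>u. u \<^bold>\<in> app f i \<longleftrightarrow> (\<exists>j. j \<^bold>\<in> om \<and> (\<exists>h. entry p i j h) \<and> u = app f j)))" if i: "i \<^bold>\<in> om" for i
  proof (cases "is_name g C i")
    case False
    have "\<not> entry p i j h" if "j \<^bold>\<in> om" for j h
      unfolding ent[OF i that] matrix_def by (cases "i = j") (use False in simp_all)
    then show ?thesis using ap[OF i] no[OF False] i by auto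
  next
    case True
    then obtain v where v: "v \<^bold>\<in> C" "i = app g v" unfolding is_name_def by blast
    have fi: "app f i = v" using ap[OF i] nm[OF v(1)] v(2) by simp
    have ni: "named g C i = v" using nm[OF v(1)] v(2) by simp
    show ?thesis
    proof (cases "is_ordinal v")
      case True': True
      have "matrix g C i i = suc v" unfolding matrix_def using True True' ni by simp
      then have "entry p i i h \<longleftrightarrow> v = h" for h unfolding ent[OF i i] by simp
      then show ?thesis using fi by blast
    next
      case False
      then have vC: "w \<^bold>\<in> C" if "w \<^bold>\<in> v" for w using C v(1) that subD unfolding hered_def by blast
      have ii: "\<not> entry p i i h" for h unfolding ent[OF i i] matrix_def using ni False by simp
      have ij: "(\<exists>h. entry p i j h) \<longleftrightarrow> (\<exists>w. w \<^bold>\<in> v \<and> j = app g w)" if j: "j \<^bold>\<in> om" for j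
      proof
        assume "\<exists>h. entry p i j h"
        then obtain h where h: "matrix g C i j = suc h" using ent[OF i j] by blast
        then have "is_name g C j" "named g C j \<^bold>\<in> v"
          unfolding matrix_def ni using False by (auto split: if_splits)
        then show "\<exists>w. w \<^bold>\<in> v \<and> j = app g w" unfolding is_name_def using nm by metis
      next
        assume "\<exists>w. w \<^bold>\<in> v \<and> j = app g w"
        then obtain w where w: "w \<^bold>\<in> v" "j = app g w" by blast
        have wC: "w \<^bold>\<in> C" by (rule vC[OF w(1)])
        \<comment> \<open>Foundation keeps membership entries off the diagonal, which is reserved
          for ordinals.\<close>
        have "i \<noteq> j" using g2[OF v(1) wC] v(2) w mem_irrefl by metis
        moreover have "is_name g C j" unfolding is_name_def using wC w by blast
        moreover have "named g C j = w" using nm[OF wC] w by simp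
        ultimately have "matrix g C i j = suc emp" unfolding matrix_def using True ni False w by simp
        then show "\<exists>h. entry p i j h" using ent[OF i j] by blast
      qed
      have "u \<^bold>\<in> v \<longleftrightarrow> (\<exists>j. j \<^bold>\<in> om \<and> (\<exists>h. entry p i j h) \<and> u = app f j)" for u
      proof
        assume u: "u \<^bold>\<in> v"
        have "app f (app g u) = u" using ap[OF g1[OF vC[OF u]]] nm[OF vC[OF u]] by simp
        then show "\<exists>j. j \<^bold>\<in> om \<and> (\<exists>h. entry p i j h) \<and> u = app f j"
          using u g1[OF vC[OF u]] ij[OF g1[OF vC[OF u]]] by (intro exI[of _ "app g u"]) auto
      next
        assume "\<exists>j. j \<^bold>\<in> om \<and> (\<exists>h. entry p i j h) \<and> u = app f j"
        then obtain j where j: "j \<^bold>\<in> om" "\<exists>h. entry p i j h" "u = app f j" by blast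
        then obtain w where w: "w \<^bold>\<in> v" "j = app g w" using ij by blast
        then have "u = w" using j ap nm[OF vC[OF w(1)]] by simp
        then show "u \<^bold>\<in> v" using w by simp
      qed
      then show ?thesis using ii fi by blast
    qed
  qed
  have "decodes p f" unfolding decodes_def using f main by blast
  then show ?thesis using ap g1 nm by (intro exI[of _ f]) simp
qed

section \<open>The game\<close>

text \<open>
  In the first \<open>\<omega>\<close> moves the second player names a pair \<open>(q, e)\<close> of a formula and an assignment,
  and hence the set \<open>X\<close> defined by them in \<open>V\<^sub>l\<close>. From then on one bit is produced in each round
  \<open>a, a + 1\<close>: the first player plays it himself (moves 0 and 1) or asks for it (any other move).
  If \<open>X\<close> is a counterexample to the theorem, the first player must produce an element of \<open>X\<close>
  and ask uncountably often. The round starting at \<open>a\<close> yields the bit with index \<open>collapse (rounds w1) a\<close>.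
\<close>

definition rounds where "rounds w1 = sep w1 (\<lambda>a. first_turn a \<and> \<not> a \<^bold>\<in> om)"

lemma Tf_rounds [defi]: "Tf b t \<Longrightarrow> Tf b (\<lambda>s. rounds (t s))"
  by (rule Tf_comp1[where F = rounds]; (assumption | (unfold rounds_def, intro defi)))

lemma mem_rounds: "a \<^bold>\<in> rounds w1 \<longleftrightarrow> a \<^bold>\<in> w1 \<and> first_turn a \<and> \<not> a \<^bold>\<in> om"
  unfolding rounds_def by (rule mem_sep) (intro defi)

definition asks where "asks p a \<longleftrightarrow> app p a \<noteq> emp \<and> app p a \<noteq> suc emp"

definition bit where
  "bit p a = (if asks p a then if app p (suc a) = emp then emp else suc emp else app p a)"

text \<open>The level \<open>l\<close> and the index \<open>n\<close> are ordinal parameters of the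
  game, not moves; \<open>ex_coding\<close> provides them.\<close>

definition defined_set where
  "defined_set n l p X \<longleftrightarrow> (\<exists>f q e. decodes p f \<and> app f n = pr q e \<and>
     (\<forall>z. z \<^bold>\<in> X \<longleftrightarrow> z \<^bold>\<in> V l \<and> (\<exists>e'. is_update (V l) e' e emp z \<and> satisfies (V l) q e')))"

definition counterexample where
  "counterexample w1 X \<longleftrightarrow> (\<forall>x. x \<^bold>\<in> X \<longrightarrow> is_binary_seq x w1) \<and>
     \<not> card_at_most_continuum X \<and> \<not> (\<exists>P. is_perfect_set w1 P \<and> P \<^bold>\<subseteq> X)"

text \<open>Asking uncountably often is expressed as unboundedness of the indices asked for. Its
  negation hands over the bound needed when the second player wins.\<close>

definition produces where
  "produces w1 p x \<longleftrightarrow> (\<forall>a. a \<^bold>\<in> rounds w1 \<longrightarrow> bit p a = app x (collapse (rounds w1) a)) \<and>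
     (\<forall>b. b \<^bold>\<in> w1 \<longrightarrow> (\<exists>a. a \<^bold>\<in> rounds w1 \<and> asks p a \<and> \<not> collapse (rounds w1) a \<^bold>\<in> b))"

text \<open>If nothing is decoded, or the set named is no counterexample, the first player wins. A
  winning strategy of the second player must therefore name a counterexample.\<close>

definition payoff where
  "payoff w1 n l p \<longleftrightarrow> (\<forall>X. defined_set n l p X \<and> counterexample w1 X \<longrightarrow> (\<exists>x. x \<^bold>\<in> X \<and> produces w1 p x))"

lemma Df_asks [defi]: "Tf b t \<Longrightarrow> Tf b u \<Longrightarrow> Df b (\<lambda>s. asks (t s) (u s))"
  by (rule Df_comp2[where P = asks]; (assumption | (unfold asks_def, intro defi)))
lemma Tf_bit [defi]: "Tf b t \<Longrightarrow> Tf b u \<Longrightarrow> Tf b (\<lambda>s. bit (t s) (u s))"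
  by (rule Tf_comp2[where F = bit]; (assumption | (unfold bit_def, intro defi)))
lemma Df_defined_set0: "Df b (\<lambda>s. defined_set (s 0) (s 1) (s 2) (s 3))"
  unfolding defined_set_def by (intro defi)
lemmas Df_defined_set [defi] = Df_comp4[where P = defined_set, OF Df_defined_set0]
lemma Df_counterexample [defi]: "Tf b t \<Longrightarrow> Tf b u \<Longrightarrow> Df b (\<lambda>s. counterexample (t s) (u s))"
  by (rule Df_comp2[where P = counterexample]; (assumption | (unfold counterexample_def, intro defi)))
lemma Df_produces0: "Df b (\<lambda>s. produces (s 0) (s 1) (s 2))"
  unfolding produces_def by (intro defi)
lemmas Df_produces [defi] = Df_comp3[where P = produces, OF Df_produces0]
lemma Df_payoff0: "Df b (\<lambda>s. payoff (s 0) (s 1) (s 2) (s 3))"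
  unfolding payoff_def by (intro defi)
lemmas Df_payoff [defi] = Df_comp4[where P = payoff, OF Df_payoff0]

definition payoff_set where "payoff_set w1 S n l = sep (Funs w1 S) (payoff w1 n l)"

lemma mem_payoff_set: "p \<^bold>\<in> payoff_set w1 S n l \<longleftrightarrow> is_function p w1 S \<and> payoff w1 n l p"
proof -
  have "p \<^bold>\<in> payoff_set w1 S n l \<longleftrightarrow> p \<^bold>\<in> Funs w1 S \<and> payoff w1 n l p"
    unfolding payoff_set_def by (rule mem_sep) (intro defi)
  then show ?thesis by simp
qed

text \<open>The named set is a bound variable of \<open>payoff\<close>; the parameters that remain
  are ordinals and enter through \<open>Tf_param\<close>.\<close>

lemma payoff_set_OD:
  assumes "is_ordinal w1" "is_ordinal S" "is_ordinal n" "is_ordinal l"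
  shows "ordinal_definable (payoff_set w1 S n l)"
proof (rule ordinal_definableI[OF _ mem_payoff_set])
  show "Df False (\<lambda>s. is_function (s 0) w1 S \<and> payoff w1 n l (s 0))"
    by (intro defi Tf_param disjI2 assms)
qed

lemma defined_set_unique: "defined_set n l p X \<Longrightarrow> defined_set n l p Y \<Longrightarrow> X = Y"
proof -
  assume "defined_set n l p X" "defined_set n l p Y"
  then obtain f q e f' q' e' where f: "decodes p f" "app f n = pr q e"
      "\<forall>z. z \<^bold>\<in> X \<longleftrightarrow> z \<^bold>\<in> V l \<and> (\<exists>e'. is_update (V l) e' e emp z \<and> satisfies (V l) q e')"
    and f': "decodes p f'" "app f' n = pr q' e'"
      "\<forall>z. z \<^bold>\<in> Y \<longleftrightarrow> z \<^bold>\<in> V l \<and> (\<exists>e''. is_update (V l) e'' e' emp z \<and> satisfies (V l) q' e'')"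
    unfolding defined_set_def by blast
  have "f = f'" by (rule decodes_unique[OF f(1) f'(1)])
  then have "q = q'" "e = e'" using f(2) f'(2) by auto
  then show "X = Y" using f(3) f'(3) by (intro set_ext) blast
qed

text \<open>Makes plays that share the naming phase comparable: they name the same set, whatever
  happens later.\<close>

lemma defined_set_cong:
  assumes "\<And>b. b \<^bold>\<in> om \<Longrightarrow> second_turn b \<Longrightarrow> app p b = app p' b"
  shows "defined_set n l p X \<longleftrightarrow> defined_set n l p' X"
proof -
  have "entry p = entry p'" using entry_cong[OF assms] by (simp add: fun_eq_iff)
  then show ?thesis unfolding defined_set_def decodes_def by simp
qed

text \<open>Formula and assignment form a codable pair, because the assignment takes as values only
  ordinals and the given sequence. \<open>C\<close> is a countable set containing this pair, and
  \<open>n\<close> is the number that \<open>g\<close> gives to it.\<close>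

lemma ex_coding:
  assumes X: "definable_from_countable_ordinal_seq X"
  shows "\<exists>l n g C. is_ordinal l \<and> is_ordinal n \<and> hered C \<and> is_injection g C om \<and>
    (\<forall>p. (\<forall>b. b \<^bold>\<in> om \<longrightarrow> second_turn b \<longrightarrow> app p b = coding_move g C b) \<longrightarrow> defined_set n l p X)"
proof -
  obtain x where x: "is_countable_ordinal_seq x" "ordinal_definable_from x X"
    using X unfolding definable_from_countable_ordinal_seq_def by blast
  obtain d where d: "is_ordinal d" "is_countable d" "is_fun_on x d" and xo: "\<And>i a. pair_in x i a \<Longrightarrow> is_ordinal a"
    using x(1) unfolding is_countable_ordinal_seq_def by blast
  have cx: "codable x"
  proof (rule codable_fun[OF d(3,2)])
    fix a assume a: "a \<^bold>\<in> d"
    have "is_ordinal (app x a)" using xo[of a "app x a"] app_mem[OF d(3) a] by simp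
    then show "codable a \<and> codable (app x a)" using codable_ordinal ord_mem[OF d(1) a] by blast
  qed
  obtain l where l: "is_ordinal l" "definable_in (V l) (\<lambda>a. is_ordinal a \<or> a = x) X"
    using x(2) unfolding ordinal_definable_from_def is_V_iff by blast
  obtain q e where q: "is_formula q" and e: "e \<^bold>\<in> Funs om (V l)" and eo: "\<And>i a. pair_in e i a \<Longrightarrow> is_ordinal a \<or> a = x"
    and Xq: "\<forall>z. z \<^bold>\<in> X \<longleftrightarrow> z \<^bold>\<in> V l \<and> (\<exists>o' e'. is_empty o' \<and> is_update (V l) e' e o' z \<and> satisfies (V l) q e')"
    using l(2) unfolding definable_in_def is_assignment_iff by blast
  have fe: "is_fun_on e om" using e by (simp add: is_function_iff)
  have "codable e"
  proof (rule codable_fun[OF fe countable_om])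
    fix a assume a: "a \<^bold>\<in> om"
    have "is_ordinal (app e a) \<or> app e a = x" using eo[of a "app e a"] app_mem[OF fe a] by simp
    then show "codable a \<and> codable (app e a)" using codable_ordinal cx codable_om[OF a] by blast
  qed
  then have "codable (pr q e)" using codable_pr codable_formula[OF q] by blast
  then obtain C where C: "is_countable C" "pr q e \<^bold>\<in> C" "hered C" unfolding codable_def by blast
  obtain g where g: "is_injection g C om" using C(1) unfolding is_countable_def is_omega_iff by blast
  define n where "n = app g (pr q e)"
  have "n \<^bold>\<in> om" using g C(2) unfolding is_injection_iff n_def by blast
  then have n: "is_ordinal n" by (rule om_ordD)
  have "defined_set n l p X" if p: "\<forall>b. b \<^bold>\<in> om \<longrightarrow> second_turn b \<longrightarrow> app p b = coding_move g C b" for p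
  proof -
    obtain f where f: "decodes p f" "\<forall>u. u \<^bold>\<in> C \<longrightarrow> app f (app g u) = u"
      using decodes_coding[OF C(3) g, of p] p by blast
    then have fn: "app f n = pr q e" unfolding n_def using C(2) by blast
    show ?thesis unfolding defined_set_def
    proof (intro exI conjI)
      show "\<forall>z. z \<^bold>\<in> X \<longleftrightarrow> z \<^bold>\<in> V l \<and> (\<exists>e'. is_update (V l) e' e emp z \<and> satisfies (V l) q e')"
        using Xq unfolding is_empty_iff by simp
    qed (fact f(1), fact fn)
  qed
  then show ?thesis using l(1) n C(3) g by blast
qed

section \<open>Perfect sets\<close>

lemma mem_two [simp]: "v \<^bold>\<in> num 2 \<longleftrightarrow> v = emp \<or> v = suc emp"
  by (auto simp: numeral_2_eq_2)

lemma binary_seq_iff: "is_binary_seq x d \<longleftrightarrow> is_fun_on x d \<and> (\<forall>a. a \<^bold>\<in> d \<longrightarrow> app x a = emp \<or> app x a = suc emp)"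
  unfolding is_binary_seq_def is_function_iff is_numeral_iff by simp

lemma initial_segmentsD:
  assumes "closed_under_initial_segments T" "t \<^bold>\<in> T" "is_fun_on t a" "is_ordinal a" "c \<^bold>\<in> a"
  shows "restr t c \<^bold>\<in> T"
  using assms unfolding closed_under_initial_segments_def is_restriction_iff by blast

section \<open>Initial segments and paths\<close>

definition segs where "segs w x = img w (\<lambda>a. restr x a)"

lemma Tf_segs [defi]: "Tf b t \<Longrightarrow> Tf b u \<Longrightarrow> Tf b (\<lambda>s. segs (t s) (u s))"
  by (rule Tf_comp2[where F = segs]; (assumption | (unfold segs_def, intro defi)))

lemma mem_segs: "t \<^bold>\<in> segs w x \<longleftrightarrow> (\<exists>a. a \<^bold>\<in> w \<and> t = restr x a)"
  unfolding segs_def by (rule mem_img) (intro defi)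

context
  fixes w x assumes w: "is_ordinal w" and x: "is_fun_on x w"
begin

lemma segs_fun: "a \<^bold>\<in> w \<Longrightarrow> is_fun_on (restr x a) a"
  by (rule is_fun_on_restr[OF x ord_mem_sub[OF w]])

lemma segs_app: "a \<^bold>\<in> w \<Longrightarrow> c \<^bold>\<in> a \<Longrightarrow> app (restr x a) c = app x c"
  by (rule app_restr[OF x ord_mem_sub[OF w]])

lemma segs_inject: "a \<^bold>\<in> w \<Longrightarrow> c \<^bold>\<in> w \<Longrightarrow> restr x a = restr x c \<Longrightarrow> a = c"
  using fun_dom_unique segs_fun by metis

lemma segs_mono: "a \<^bold>\<subseteq> c \<Longrightarrow> restr x a \<^bold>\<subseteq> restr x c"
  by (rule subI) (auto simp: sub_def)

lemma segs_restr: "a \<^bold>\<in> w \<Longrightarrow> c \<^bold>\<in> a \<Longrightarrow> restr (restr x a) c = restr x c"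
  by (rule restr_restr[OF ord_mem_sub[OF ord_mem[OF w]]])

lemma segs_less_iff:
  assumes a: "a \<^bold>\<in> w" and c: "c \<^bold>\<in> w"
  shows "a \<^bold>\<in> c \<longleftrightarrow> restr x a \<^bold>\<subseteq> restr x c \<and> restr x a \<noteq> restr x c"
proof
  assume ac: "a \<^bold>\<in> c"
  then have "a \<noteq> c" by auto
  then show "restr x a \<^bold>\<subseteq> restr x c \<and> restr x a \<noteq> restr x c"
    using segs_mono[OF ord_mem_sub[OF ord_mem[OF w c] ac]] segs_inject[OF a c] by blast
next
  assume r: "restr x a \<^bold>\<subseteq> restr x c \<and> restr x a \<noteq> restr x c"
  show "a \<^bold>\<in> c"
  proof (rule ccontr)
    assume "\<not> a \<^bold>\<in> c"
    then have "c \<^bold>\<subseteq> a" using ord_not_mem[OF ord_mem[OF w a] ord_mem[OF w c]] by blast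
    then have "restr x c \<^bold>\<subseteq> restr x a" by (rule segs_mono)
    then show False using r sub_antisym by blast
  qed
qed

lemma segs_path:
  assumes T: "\<And>a. a \<^bold>\<in> w \<Longrightarrow> restr x a \<^bold>\<in> T"
  shows "is_path w T (segs w x)"
  unfolding is_path_def
proof (intro conjI)
  show "segs w x \<^bold>\<subseteq> T" by (rule subI) (use T in \<open>auto simp: mem_segs\<close>)
  show "is_chain (segs w x)" unfolding is_chain_def
  proof (intro allI impI)
    fix s t assume "s \<^bold>\<in> segs w x \<and> t \<^bold>\<in> segs w x"
    then obtain a c where ac: "a \<^bold>\<in> w" "c \<^bold>\<in> w" "s = restr x a" "t = restr x c" using mem_segs by blast
    have "a \<^bold>\<subseteq> c \<or> c \<^bold>\<subseteq> a"
      using ord_not_mem[OF ord_mem[OF w ac(1)] ord_mem[OF w ac(2)]] ord_mem_sub[OF ord_mem[OF w ac(2)]] by blast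
    then show "s \<^bold>\<subseteq> t \<or> t \<^bold>\<subseteq> s" using segs_mono ac by blast
  qed
  show "closed_under_initial_segments (segs w x)"
    unfolding closed_under_initial_segments_def is_restriction_iff
  proof (intro allI impI)
    fix t a c r assume h: "t \<^bold>\<in> segs w x \<and> is_ordinal a \<and> is_fun_on t a \<and> c \<^bold>\<in> a \<and> r = restr t c"
    then obtain d where d: "d \<^bold>\<in> w" "t = restr x d" using mem_segs by blast
    have "a = d" using fun_dom_unique[of t a d] h segs_fun[OF d(1)] d(2) by blast
    then have "r = restr x c" "c \<^bold>\<in> w" using h d segs_restr[OF d(1)] ord_trans[OF w _ d(1)] by auto
    then show "r \<^bold>\<in> segs w x" unfolding mem_segs by blast
  qed
  have T': "Tf True (\<lambda>s. restr x (s 0))" by (intro defi)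
  have ap: "app (Lam w (\<lambda>a. restr x a)) a = restr x a" if "a \<^bold>\<in> w" for a by (rule app_Lam[OF T' that])
  have f: "is_fun_on (Lam w (\<lambda>a. restr x a)) w" by (rule is_fun_on_Lam[OF T'])
  show "\<exists>f. is_bijection f w (segs w x) \<and>
      (\<forall>\<alpha> \<beta> s t. pair_in f \<alpha> s \<and> pair_in f \<beta> t \<longrightarrow> (\<alpha> \<^bold>\<in> \<beta> \<longleftrightarrow> s \<^bold>\<subseteq> t \<and> s \<noteq> t))"
  proof (rule exI[of _ "Lam w (\<lambda>a. restr x a)"], rule conjI)
    show "is_bijection (Lam w (\<lambda>a. restr x a)) w (segs w x)"
      unfolding is_bijection_iff is_injection_iff
    proof (intro conjI allI impI f)
      show "app (Lam w (\<lambda>a. restr x a)) a \<^bold>\<in> segs w x" if "a \<^bold>\<in> w" for a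
        unfolding ap[OF that] mem_segs using that by blast
      show "a = a'" if "a \<^bold>\<in> w \<and> a' \<^bold>\<in> w \<and> app (Lam w (\<lambda>a. restr x a)) a = app (Lam w (\<lambda>a. restr x a)) a'" for a a'
        using that segs_inject ap by metis
      show "\<exists>a. a \<^bold>\<in> w \<and> y = app (Lam w (\<lambda>a. restr x a)) a" if "y \<^bold>\<in> segs w x" for y
        using that ap unfolding mem_segs by metis
    qed
    show "\<forall>\<alpha> \<beta> s t. pair_in (Lam w (\<lambda>a. restr x a)) \<alpha> s \<and> pair_in (Lam w (\<lambda>a. restr x a)) \<beta> t \<longrightarrow>
        (\<alpha> \<^bold>\<in> \<beta> \<longleftrightarrow> s \<^bold>\<subseteq> t \<and> s \<noteq> t)"
      unfolding pair_in_iff fun_pr_iff[OF f] using ap segs_less_iff by metis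
  qed
qed

lemma uni_segs: "is_limit w \<Longrightarrow> uni (segs w x) = x"
proof (rule set_ext)
  fix p assume l: "is_limit w"
  have "p \<^bold>\<in> uni (segs w x) \<longleftrightarrow> (\<exists>a. a \<^bold>\<in> w \<and> p \<^bold>\<in> restr x a)" unfolding mem_uni mem_segs by blast
  also have "\<dots> \<longleftrightarrow> p \<^bold>\<in> x"
  proof
    assume p: "p \<^bold>\<in> x"
    then obtain a where a: "a \<^bold>\<in> w" "p = pr a (app x a)" unfolding fun_mem_iff[OF x] by blast
    then have "suc a \<^bold>\<in> w" using l unfolding is_limit_iff by blast
    then show "\<exists>a. a \<^bold>\<in> w \<and> p \<^bold>\<in> restr x a" using p a by (intro exI[of _ "suc a"]) simp
  qed auto
  finally show "p \<^bold>\<in> uni (segs w x) \<longleftrightarrow> p \<^bold>\<in> x" .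
qed

end

lemma w1_limit: "is_omega1 w1 \<Longrightarrow> is_limit w1"
  unfolding is_limit_iff using w1_ord w1_suc om_mem_w1 by fastforce

lemma chain_agree:
  assumes "is_chain b" "s \<^bold>\<in> b" "t \<^bold>\<in> b" "pr a u \<^bold>\<in> s" "pr a v \<^bold>\<in> t" "is_fun_on s c" "is_fun_on t d"
  shows "u = v"
proof -
  have "s \<^bold>\<subseteq> t \<or> t \<^bold>\<subseteq> s" using assms(1-3) unfolding is_chain_def by blast
  then show ?thesis using assms(4-7) app_eqI subD by metis
qed

text \<open>Distinct elements of a chain have distinct lengths, so a bijection with
  \<open>w1\<close> forces the lengths to be unbounded, and closure under initial segments fills the
  gaps.\<close>

lemma path_is_segs:
  assumes w1: "is_omega1 w1" and b: "is_path w1 T b"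
    and T: "\<And>t. t \<^bold>\<in> T \<Longrightarrow> \<exists>a. a \<^bold>\<in> w1 \<and> is_fun_on t a"
  shows "is_fun_on (uni b) w1" "b = segs w1 (uni b)"
proof -
  note o = w1_ord[OF w1]
  have bT: "b \<^bold>\<subseteq> T" and ch: "is_chain b" and cl: "closed_under_initial_segments b"
    using b unfolding is_path_def by blast+
  obtain f where f: "is_bijection f w1 b" using b unfolding is_path_def by blast
  have fd: "dom t \<^bold>\<in> w1" "is_fun_on t (dom t)" if "t \<^bold>\<in> b" for t
    using T[OF subD[OF bT that]] dom_fun by metis+
  have uq: "s = t" if s: "s \<^bold>\<in> b" and t: "t \<^bold>\<in> b" and st: "dom s = dom t" for s t
  proof (rule fun_ext[OF fd(2)[OF s]])
    show ft: "is_fun_on t (dom s)" using fd(2)[OF t] st by simp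
    fix a assume a: "a \<^bold>\<in> dom s"
    show "app s a = app t a"
      by (rule chain_agree[OF ch s t app_mem[OF fd(2)[OF s] a] app_mem[OF ft a] fd(2)[OF s] ft])
  qed
  have down: "\<exists>s. s \<^bold>\<in> b \<and> dom s = a" if t: "t \<^bold>\<in> b" and a: "a \<^bold>\<in> dom t" for t a
  proof -
    have od: "is_ordinal (dom t)" by (rule ord_mem[OF o fd(1)[OF t]])
    have "restr t a \<^bold>\<in> b" by (rule initial_segmentsD[OF cl t fd(2)[OF t] od a])
    moreover have "dom (restr t a) = a" by (rule dom_fun[OF is_fun_on_restr[OF fd(2)[OF t] ord_mem_sub[OF od a]]])
    ultimately show ?thesis by blast
  qed
  have Td: "Tf True (\<lambda>s. dom (s 0))" by (intro defi)
  define L where "L = img b dom"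
  have L: "a \<^bold>\<in> L \<longleftrightarrow> (\<exists>t. t \<^bold>\<in> b \<and> a = dom t)" for a unfolding L_def by (rule mem_img[where F = dom, OF Td])
  have nL: "\<not> L \<^bold>\<subseteq> a" if a: "a \<^bold>\<in> w1" for a
  proof
    assume La: "L \<^bold>\<subseteq> a"
    have cL: "is_countable L" by (rule countable_sub[OF w1_countable[OF w1 a] La])
    have T1: "Tf True (\<lambda>s. the1 (\<lambda>t. t \<^bold>\<in> b \<and> dom t = s 0))" by (intro defi)
    have cb: "is_countable b"
    proof (rule countable_image[OF cL T1])
      fix t assume t: "t \<^bold>\<in> b"
      have "the1 (\<lambda>s. s \<^bold>\<in> b \<and> dom s = dom t) = t" by (rule the1_eq) (use t uq in blast)+
      then show "\<exists>a. a \<^bold>\<in> L \<and> t = the1 (\<lambda>t. t \<^bold>\<in> b \<and> dom t = a)"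
        using t L by (intro exI[of _ "dom t"]) auto
    qed
    have T2: "Tf True (\<lambda>s. the1 (\<lambda>a. a \<^bold>\<in> w1 \<and> app f a = s 0))" by (intro defi)
    have "is_countable w1"
    proof (rule countable_image[OF cb T2])
      fix c assume c: "c \<^bold>\<in> w1"
      have "the1 (\<lambda>a. a \<^bold>\<in> w1 \<and> app f a = app f c) = c"
        by (rule the1_eq) (use c f in \<open>unfold is_bijection_iff is_injection_iff, blast\<close>)+
      moreover have "app f c \<^bold>\<in> b" using f c unfolding is_bijection_iff is_injection_iff by blast
      ultimately show "\<exists>t. t \<^bold>\<in> b \<and> c = the1 (\<lambda>a. a \<^bold>\<in> w1 \<and> app f a = t)" by (intro exI[of _ "app f c"]) simp
    qed
    then show False using w1_uncountable[OF w1] by blast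
  qed
  have ex: "\<exists>t. t \<^bold>\<in> b \<and> dom t = a" if a: "a \<^bold>\<in> w1" for a
  proof -
    obtain c where c: "c \<^bold>\<in> L" "\<not> c \<^bold>\<in> suc a" using nL[OF w1_suc[OF w1 a]] unfolding sub_def by blast
    then obtain t where t: "t \<^bold>\<in> b" "c = dom t" using L by blast
    have "is_ordinal c" "is_ordinal (suc a)" using ord_mem[OF o] fd(1)[OF t(1)] t(2) a by simp_all
    then have "suc a \<^bold>\<subseteq> c" using ord_not_mem c(2) by blast
    then have "a \<^bold>\<in> c" by (simp add: sub_def)
    then show ?thesis using down[OF t(1)] t(2) by blast
  qed
  let ?x = "uni b"
  have px: "pr a v \<^bold>\<in> ?x \<longleftrightarrow> v = app t a" if t: "t \<^bold>\<in> b" and a: "a \<^bold>\<in> dom t" for a v t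
  proof
    assume "pr a v \<^bold>\<in> ?x"
    then obtain s where s: "s \<^bold>\<in> b" "pr a v \<^bold>\<in> s" by auto
    show "v = app t a"
      by (rule chain_agree[OF ch s(1) t s(2) app_mem[OF fd(2)[OF t] a] fd(2)[OF s(1)] fd(2)[OF t]])
  next
    assume "v = app t a"
    then show "pr a v \<^bold>\<in> ?x" using app_mem[OF fd(2)[OF t] a] t by auto
  qed
  show x: "is_fun_on ?x w1" unfolding is_fun_on_iff
  proof (intro conjI allI impI)
    fix p assume "p \<^bold>\<in> ?x"
    then obtain t where t: "t \<^bold>\<in> b" "p \<^bold>\<in> t" by auto
    then obtain a where "a \<^bold>\<in> dom t" "p = pr a (app t a)" using fun_mem_iff[OF fd(2)[OF t(1)]] by blast
    then show "\<exists>a v. a \<^bold>\<in> w1 \<and> p = pr a v" using ord_trans[OF o _ fd(1)[OF t(1)]] by blast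
  next
    fix a assume a: "a \<^bold>\<in> w1"
    obtain t where t: "t \<^bold>\<in> b" "dom t = suc a" using ex[OF w1_suc[OF w1 a]] by blast
    then show "\<exists>!v. pr a v \<^bold>\<in> ?x" using px[OF t(1), of a] by simp
  qed
  have seg: "restr ?x (dom t) = t" if t: "t \<^bold>\<in> b" for t
  proof (rule fun_ext[OF segs_fun[OF o x fd(1)[OF t]] fd(2)[OF t]])
    fix a assume a: "a \<^bold>\<in> dom t"
    have "app ?x a = app t a" by (rule app_eqI[OF x]) (use px[OF t a] in simp)
    then show "app (restr ?x (dom t)) a = app t a" using segs_app[OF o x fd(1)[OF t] a] by simp
  qed
  show "b = segs w1 ?x"
  proof (rule set_ext)
    fix t show "t \<^bold>\<in> b \<longleftrightarrow> t \<^bold>\<in> segs w1 ?x" unfolding mem_segs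
    proof
      assume t: "t \<^bold>\<in> b"
      then show "\<exists>a. a \<^bold>\<in> w1 \<and> t = restr ?x a" using seg[OF t] fd(1)[OF t] by metis
    next
      assume "\<exists>a. a \<^bold>\<in> w1 \<and> t = restr ?x a"
      then obtain a where a: "a \<^bold>\<in> w1" "t = restr ?x a" by blast
      obtain s where "s \<^bold>\<in> b" "dom s = a" using ex[OF a(1)] by blast
      then show "t \<^bold>\<in> b" using seg a by metis
    qed
  qed
qed

text \<open>The inverse of the collapse carries \<open>w1\<close> onto \<open>U\<close>, and
  \<open>F\<close> carries \<open>U\<close> onto \<open>B\<close>. This is how the branching points
  of a path are counted.\<close>

lemma unbounded_bijection:
  assumes w1: "is_omega1 w1" and U: "unbounded w1 U"
    and F: "Tf True (\<lambda>s. F (s 0))" and inj: "\<And>a c. a \<^bold>\<in> U \<Longrightarrow> c \<^bold>\<in> U \<Longrightarrow> F a = F c \<Longrightarrow> a = c"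
    and B: "\<And>t. t \<^bold>\<in> B \<longleftrightarrow> (\<exists>a. a \<^bold>\<in> U \<and> t = F a)"
  shows "\<exists>f. is_bijection f w1 B"
proof -
  let ?h = "\<lambda>c. the1 (\<lambda>a. a \<^bold>\<in> U \<and> collapse U a = c)"
  have Uw: "a \<^bold>\<in> w1" if "a \<^bold>\<in> U" for a using U that subD unfolding unbounded_def[OF w1] by blast
  have cinj: "a = c" if "a \<^bold>\<in> U" "c \<^bold>\<in> U" "collapse U a = collapse U c" for a c
    by (rule collapse_inject[OF _ _ _ _ that(3)]) (use that Uw w1_ordD[OF w1] in blast)+
  have hc: "?h (collapse U a) = a" if "a \<^bold>\<in> U" for a by (rule the1_eq) (use that cinj in blast)+
  have h: "?h c \<^bold>\<in> U" "collapse U (?h c) = c" if c: "c \<^bold>\<in> w1" for c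
  proof -
    obtain a where "a \<^bold>\<in> U" "collapse U a = c" using collapse_onto[OF w1 U c] by blast
    then show "?h c \<^bold>\<in> U" "collapse U (?h c) = c" using hc by auto
  qed
  have T: "Tf True (\<lambda>s. F (?h (s 0)))" by (intro defi Tf_comp1[where F = F, OF F])
  have ap: "app (Lam w1 (\<lambda>c. F (?h c))) c = F (?h c)" if "c \<^bold>\<in> w1" for c by (rule app_Lam[OF T that])
  have "is_bijection (Lam w1 (\<lambda>c. F (?h c))) w1 B" unfolding is_bijection_iff is_injection_iff
  proof (intro conjI allI impI is_fun_on_Lam[OF T])
    show "app (Lam w1 (\<lambda>c. F (?h c))) c \<^bold>\<in> B" if "c \<^bold>\<in> w1" for c
      unfolding ap[OF that] B using h(1)[OF that] by blast
    fix c d assume "c \<^bold>\<in> w1 \<and> d \<^bold>\<in> w1 \<and> app (Lam w1 (\<lambda>c. F (?h c))) c = app (Lam w1 (\<lambda>c. F (?h c))) d"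
    then have c: "c \<^bold>\<in> w1" and d: "d \<^bold>\<in> w1" and e: "F (?h c) = F (?h d)" using ap by auto
    have "?h c = ?h d" by (rule inj[OF h(1)[OF c] h(1)[OF d] e])
    then have "collapse U (?h c) = collapse U (?h d)" by (rule arg_cong)
    then show "c = d" unfolding h(2)[OF c] h(2)[OF d] .
  next
    fix t assume "t \<^bold>\<in> B"
    then obtain a where a: "a \<^bold>\<in> U" "t = F a" using B by blast
    show "\<exists>c. c \<^bold>\<in> w1 \<and> t = app (Lam w1 (\<lambda>c. F (?h c))) c"
    proof (rule exI[of _ "collapse U a"], rule conjI)
      show cw: "collapse U a \<^bold>\<in> w1" by (rule collapse_mem_w1[OF w1 Uw[OF a(1)]])
      show "t = app (Lam w1 (\<lambda>c. F (?h c))) (collapse U a)" unfolding ap[OF cw] hc[OF a(1)] by (rule a(2))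
    qed
  qed
  then show ?thesis by blast
qed

text \<open>
  \<open>H z\<close> is the sequence produced when the answers are taken from \<open>z\<close>, and \<open>K z b\<close> says
  that bit \<open>b\<close> is asked for.
\<close>

theorem perfect_set_of_answers:
  fixes H :: "'a \<Rightarrow> 'a" and K :: "'a \<Rightarrow> 'a \<Rightarrow> bool"
  assumes w1: "is_omega1 w1" and TH: "Tf True (\<lambda>s. H (s 0))" and DK: "Df True (\<lambda>s. K (s 0) (s 1))"
    and bin: "\<And>z. is_binary_seq z w1 \<Longrightarrow> is_binary_seq (H z) w1"
    and loc: "\<And>z z' b. is_binary_seq z w1 \<Longrightarrow> is_binary_seq z' w1 \<Longrightarrow> b \<^bold>\<in> w1 \<Longrightarrow>
       (\<And>c. c \<^bold>\<in> b \<Longrightarrow> K z c \<Longrightarrow> app z c = app z' c) \<Longrightarrow>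
       (K z b \<longleftrightarrow> K z' b) \<and> (\<not> K z b \<longrightarrow> app (H z) b = app (H z') b)"
    and hit: "\<And>z b. is_binary_seq z w1 \<Longrightarrow> b \<^bold>\<in> w1 \<Longrightarrow> K z b \<Longrightarrow> app (H z) b = app z b"
    and unb: "\<And>z b. is_binary_seq z w1 \<Longrightarrow> b \<^bold>\<in> w1 \<Longrightarrow> \<exists>c. c \<^bold>\<in> w1 \<and> K z c \<and> \<not> c \<^bold>\<in> b"
  shows "\<exists>P. is_perfect_set w1 P \<and> (\<forall>x. x \<^bold>\<in> P \<longrightarrow> (\<exists>z. is_binary_seq z w1 \<and> x = H z))"
proof -
  note o = w1_ord[OF w1] and lim = w1_limit[OF w1]
  have fn: "is_fun_on z w1" if "is_binary_seq z w1" for z using that binary_seq_iff by blast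
  \<comment> \<open>\<open>H z\<close> agrees with \<open>z\<close> at the bits asked for, so
    answering from \<open>H z\<close> instead of \<open>z\<close> changes nothing: \<open>H\<close>
    is idempotent.\<close>
  have KH: "K (H z) b \<longleftrightarrow> K z b" and HH: "app (H (H z)) b = app (H z) b"
    if z: "is_binary_seq z w1" and b: "b \<^bold>\<in> w1" for z b
  proof -
    have *: "(K z b \<longleftrightarrow> K (H z) b) \<and> (\<not> K z b \<longrightarrow> app (H z) b = app (H (H z)) b)"
      by (rule loc[OF z bin[OF z] b]) (use hit[OF z] ord_trans[OF o _ b] in metis)
    then show "K (H z) b \<longleftrightarrow> K z b" by blast
    show "app (H (H z)) b = app (H z) b" using * hit[OF bin[OF z] b] by (cases "K z b") auto
  qed
  define P where "P = img (Funs w1 (num 2)) H"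
  have memB: "z \<^bold>\<in> Funs w1 (num 2) \<longleftrightarrow> is_binary_seq z w1" for z
    unfolding mem_Funs is_binary_seq_def is_numeral_iff by blast
  \<comment> \<open>By idempotence the range of \<open>H\<close> is its set of fixed points, a
    condition that can be verified bit by bit.\<close>
  have P: "x \<^bold>\<in> P \<longleftrightarrow> is_binary_seq x w1 \<and> H x = x" for x
  proof -
    have "x \<^bold>\<in> P \<longleftrightarrow> (\<exists>z. is_binary_seq z w1 \<and> x = H z)"
      unfolding P_def mem_img[where F = H, OF TH] memB ..
    moreover have "H (H z) = H z" if "is_binary_seq z w1" for z
      by (rule fun_ext[OF fn[OF bin[OF bin[OF that]]] fn[OF bin[OF that]]]) (rule HH[OF that])
    ultimately show ?thesis using bin by metis
  qed
  have HP: "H z \<^bold>\<in> P" if "is_binary_seq z w1" for z unfolding P_def mem_img[where F = H, OF TH] memB using that by blast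
  define T where "T = uni (img P (segs w1))"
  have T: "t \<^bold>\<in> T \<longleftrightarrow> (\<exists>x a. x \<^bold>\<in> P \<and> a \<^bold>\<in> w1 \<and> t = restr x a)" for t
  proof -
    have TT: "Tf True (\<lambda>s. segs w1 (s 0))" by (intro defi)
    show ?thesis unfolding T_def mem_uni mem_img[where F = "segs w1", OF TT] using mem_segs by blast
  qed
  have fP: "is_fun_on x w1" if "x \<^bold>\<in> P" for x using that fn P by blast
  have cT: "closed_under_initial_segments T"
    unfolding closed_under_initial_segments_def is_restriction_iff
  proof (intro allI impI)
    fix t a c r assume h: "t \<^bold>\<in> T \<and> is_ordinal a \<and> is_fun_on t a \<and> c \<^bold>\<in> a \<and> r = restr t c"
    then obtain x d where d: "x \<^bold>\<in> P" "d \<^bold>\<in> w1" "t = restr x d" using T by blast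
    have "a = d" using fun_dom_unique[of t a d] h segs_fun[OF o fP[OF d(1)] d(2)] d(3) by blast
    then have "r = restr x c" "c \<^bold>\<in> w1" using h d segs_restr[OF o fP[OF d(1)] d(2)] ord_trans[OF o _ d(2)] by auto
    then show "r \<^bold>\<in> T" unfolding T using d(1) by blast
  qed
  have binT: "is_binary_seq (restr x a) a" if x: "x \<^bold>\<in> P" and a: "a \<^bold>\<in> w1" for x a
  proof -
    have "app (restr x a) c = emp \<or> app (restr x a) c = suc emp" if "c \<^bold>\<in> a" for c
      using x P segs_app[OF o fP[OF x] a that] ord_trans[OF o that a] unfolding binary_seq_iff by simp
    then show ?thesis unfolding binary_seq_iff using segs_fun[OF o fP[OF x] a] by blast
  qed
  have zero: "is_binary_seq (Lam w1 (\<lambda>_. emp)) w1"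
    using is_fun_on_Lam[OF Tf_const] app_Lam[OF Tf_const] unfolding binary_seq_iff by simp
  have tree: "is_binary_tree w1 T" unfolding is_binary_tree_def
  proof (intro conjI cT allI impI)
    show "\<exists>a. a \<^bold>\<in> w1 \<and> is_binary_seq t a" if "t \<^bold>\<in> T" for t using that binT unfolding T by blast
    show "\<exists>t. t \<^bold>\<in> T \<and> is_binary_seq t a" if "a \<^bold>\<in> w1" for a
      using HP[OF zero] binT[OF HP[OF zero] that] that unfolding T by blast
  qed
  have Tfun: "\<exists>a. a \<^bold>\<in> w1 \<and> is_fun_on t a" if "t \<^bold>\<in> T" for t
    using that segs_fun[OF o fP] unfolding T by blast
  \<comment> \<open>Two elements of \<open>P\<close> can separate only at a bit asked for.\<close>
  have agree: "app x b = app x' b"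
    if x: "x \<^bold>\<in> P" "x' \<^bold>\<in> P" and b: "b \<^bold>\<in> w1" and c: "\<And>c. c \<^bold>\<in> b \<Longrightarrow> app x c = app x' c" and k: "\<not> K x b" for x x' b
    using loc[of x x' b] x b c k P by metis
  have path_segs: "is_path w1 T (segs w1 x)" if "x \<^bold>\<in> P" for x
    by (rule segs_path[OF o fP[OF that]]) (use T that in blast)
  have path: "b = segs w1 (uni b) \<and> uni b \<^bold>\<in> P" if b: "is_path w1 T b" for b
  proof -
    let ?x = "uni b"
    have x: "is_fun_on ?x w1" and bs: "b = segs w1 ?x" using path_is_segs[OF w1 b Tfun] by blast+
    have ex: "\<exists>x'. x' \<^bold>\<in> P \<and> (\<forall>c. c \<^bold>\<in> suc a \<longrightarrow> app ?x c = app x' c)" if a: "a \<^bold>\<in> w1" for a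
    proof -
      have sa: "suc a \<^bold>\<in> w1" by (rule w1_suc[OF w1 a])
      have "restr ?x (suc a) \<^bold>\<in> b" by (subst bs) (use mem_segs sa in blast)
      then have "restr ?x (suc a) \<^bold>\<in> T" using b subD unfolding is_path_def by blast
      then obtain x' d where x': "x' \<^bold>\<in> P" "d \<^bold>\<in> w1" "restr ?x (suc a) = restr x' d" using T by blast
      have "suc a = d" using fun_dom_unique[OF segs_fun[OF o x sa]] segs_fun[OF o fP[OF x'(1)] x'(2)] x'(3) by simp
      then have "app ?x c = app x' c" if "c \<^bold>\<in> suc a" for c
        using segs_app[OF o x sa that] segs_app[OF o fP[OF x'(1)] x'(2), of c] that x'(3) by simp
      then show ?thesis using x'(1) by blast
    qed
    have bx: "is_binary_seq ?x w1" unfolding binary_seq_iff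
    proof (intro conjI x allI impI)
      fix a assume a: "a \<^bold>\<in> w1"
      obtain x' where x': "x' \<^bold>\<in> P" "\<forall>c. c \<^bold>\<in> suc a \<longrightarrow> app ?x c = app x' c" using ex[OF a] by blast
      then show "app ?x a = emp \<or> app ?x a = suc emp" using P[of x'] a unfolding binary_seq_iff by simp
    qed
    \<comment> \<open>An unasked bit is determined by the earlier ones, and the segment up to it is
      shared with some fixed point \<open>x'\<close>; an asked bit is right by
      \<open>hit\<close>.\<close>
    have "H ?x = ?x"
    proof (rule fun_ext[OF fn[OF bin[OF bx]] x])
      fix a assume a: "a \<^bold>\<in> w1"
      show "app (H ?x) a = app ?x a"
      proof (cases "K ?x a")
        case True then show ?thesis by (rule hit[OF bx a])
      next
        case False
        obtain x' where x': "x' \<^bold>\<in> P" "\<forall>c. c \<^bold>\<in> suc a \<longrightarrow> app ?x c = app x' c" using ex[OF a] by blast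
        have "(K ?x a \<longleftrightarrow> K x' a) \<and> (\<not> K ?x a \<longrightarrow> app (H ?x) a = app (H x') a)"
          by (rule loc[OF bx _ a]) (use x' P in auto)
        then show ?thesis using False x' P by simp
      qed
    qed
    then show ?thesis using bs bx P by blast
  qed
  have chains: "\<exists>b. is_path w1 T b \<and> c \<^bold>\<subseteq> b" if c: "c \<^bold>\<subseteq> T \<and> is_chain c" for c
  proof -
    \<comment> \<open>Answers are read off the union of the chain, with default \<open>emp\<close>
      beyond it; \<open>H\<close> then completes them to a fixed point that runs through the whole
      chain.\<close>
    let ?F = "\<lambda>a. the1 (\<lambda>v. pr a v \<^bold>\<in> uni c)"
    have TF: "Tf True (\<lambda>s. ?F (s 0))" by (intro defi)
    have mc: "?F a = app s a" if s: "s \<^bold>\<in> c" and d: "is_fun_on s d" and a: "a \<^bold>\<in> d" for s a d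
    proof (rule the1_eq)
      show "pr a (app s a) \<^bold>\<in> uni c" using s app_mem[OF d a] by auto
      fix v assume "pr a v \<^bold>\<in> uni c"
      then obtain t where t: "t \<^bold>\<in> c" "pr a v \<^bold>\<in> t" by auto
      obtain e where "is_fun_on t e" using Tfun c subD t(1) by blast
      then show "v = app s a" using chain_agree[OF conjunct2[OF c] t(1) s t(2) app_mem[OF d a] _ d] by blast
    qed
    have in2: "?F a = emp \<or> ?F a = suc emp" for a
    proof (cases "\<exists>s. s \<^bold>\<in> c \<and> (\<exists>v. pr a v \<^bold>\<in> s)")
      case True
      then obtain s v where s: "s \<^bold>\<in> c" "pr a v \<^bold>\<in> s" by blast
      then obtain x d where x: "x \<^bold>\<in> P" "d \<^bold>\<in> w1" "s = restr x d" using c T subD by blast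
      have bs: "is_binary_seq s d" using binT[OF x(1,2)] x(3) by simp
      have fs: "is_fun_on s d" using bs unfolding binary_seq_iff by blast
      have ad: "a \<^bold>\<in> d" using s(2) unfolding fun_pr_iff[OF fs] by blast
      show ?thesis unfolding mc[OF s(1) fs ad] using bs ad unfolding binary_seq_iff by blast
    next
      case False
      then show ?thesis unfolding the1_def by auto
    qed
    define z where "z = Lam w1 ?F"
    have z: "is_binary_seq z w1" unfolding binary_seq_iff z_def
      using is_fun_on_Lam[OF TF] in2 app_Lam[OF TF] by simp
    have "s \<^bold>\<in> segs w1 (H z)" if s: "s \<^bold>\<in> c" for s
    proof -
      obtain x d where x: "x \<^bold>\<in> P" "d \<^bold>\<in> w1" "s = restr x d" using c T subD s by blast
      have fs: "is_fun_on s d" using segs_fun[OF o fP[OF x(1)] x(2)] x(3) by simp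
      have zs: "app z a = app x a" if a: "a \<^bold>\<in> d" for a
        unfolding z_def app_Lam[OF TF ord_trans[OF o a x(2)]] mc[OF s fs a] x(3)
        by (rule segs_app[OF o fP[OF x(1)] x(2) a])
      have "a \<^bold>\<in> d \<longrightarrow> app (H z) a = app x a" if "is_ordinal a" for a
      proof (rule ord_induct[OF that, where P = "\<lambda>a. a \<^bold>\<in> d \<longrightarrow> app (H z) a = app x a"])
        show "Df True (\<lambda>s. s 0 \<^bold>\<in> d \<longrightarrow> app (H z) (s 0) = app x (s 0))" by (intro defi)
        fix a assume IH: "\<And>y. y \<^bold>\<in> a \<Longrightarrow> y \<^bold>\<in> d \<longrightarrow> app (H z) y = app x y"
        show "a \<^bold>\<in> d \<longrightarrow> app (H z) a = app x a"
        proof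
          assume a: "a \<^bold>\<in> d"
          have aw: "a \<^bold>\<in> w1" by (rule ord_trans[OF o a x(2)])
          have od: "is_ordinal d" by (rule ord_mem[OF o x(2)])
          show "app (H z) a = app x a"
          proof (cases "K z a")
            case True
            then show ?thesis using hit[OF z aw] zs[OF a] by simp
          next
            case False
            then have "\<not> K (H z) a" using KH[OF z aw] by blast
            then show ?thesis
              by (intro agree[OF HP[OF z] x(1) aw]) (use IH ord_trans[OF od _ a] in blast)+
          qed
        qed
      qed
      then have "app (H z) a = app x a" if "a \<^bold>\<in> d" for a using that ord_mem[OF ord_mem[OF o x(2)]] by blast
      then have "restr (H z) d = restr x d"
        by (subst restr_eq_iff[OF fn[OF bin[OF z]] ord_mem_sub[OF o x(2)] fP[OF x(1)] ord_mem_sub[OF o x(2)]]) blast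
      then show ?thesis unfolding mem_segs using x by metis
    qed
    then have "c \<^bold>\<subseteq> segs w1 (H z)" by (rule subI)
    then show ?thesis using path_segs[OF HP[OF z]] by blast
  qed
  have branch: "branches_at T (restr x a)" if x: "x \<^bold>\<in> P" and a: "a \<^bold>\<in> w1" and k: "K x a" for x a
  proof -
    have bx: "is_binary_seq x w1" and Hx: "H x = x" using x P by blast+
    \<comment> \<open>To split at \<open>a\<close>, the bit asked for there is flipped. The altered
      sequence itself might leave \<open>P\<close>, but its image under \<open>H\<close> is in
      \<open>P\<close> and agrees with \<open>x\<close> below \<open>a\<close>.\<close>
    let ?v = "if app x a = emp then suc emp else emp"
    let ?G = "\<lambda>c. if c = a then ?v else app x c"
    have TG: "Tf True (\<lambda>s. ?G (s 0))" by (intro defi)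
    define y where "y = Lam w1 ?G"
    have ay: "app y c = ?G c" if "c \<^bold>\<in> w1" for c unfolding y_def by (rule app_Lam[OF TG that])
    have y: "is_binary_seq y w1" unfolding binary_seq_iff
    proof (intro conjI allI impI)
      show "is_fun_on y w1" unfolding y_def by (rule is_fun_on_Lam[OF TG])
      show "app y c = emp \<or> app y c = suc emp" if "c \<^bold>\<in> w1" for c
        using ay[OF that] bx that unfolding binary_seq_iff by auto
    qed
    have yx: "app y c = app x c" if "c \<^bold>\<in> a" for c
      using ay[OF ord_trans[OF o that a]] that by auto
    have l: "(K x b \<longleftrightarrow> K y b) \<and> (\<not> K x b \<longrightarrow> app (H x) b = app (H y) b)" if b: "b \<^bold>\<in> suc a" for b
    proof (rule loc[OF bx y])
      show "b \<^bold>\<in> w1" using b a ord_trans[OF o _ a] by auto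
      fix c assume "c \<^bold>\<in> b"
      then have "c \<^bold>\<in> a" using b ord_trans[OF ord_mem[OF o a]] by auto
      then show "app x c = app y c" using yx by simp
    qed
    have Hy: "app (H y) c = app x c" if c: "c \<^bold>\<in> a" for c
    proof -
      have cw: "c \<^bold>\<in> w1" by (rule ord_trans[OF o c a])
      have *: "(K x c \<longleftrightarrow> K y c) \<and> (\<not> K x c \<longrightarrow> app (H x) c = app (H y) c)" by (rule l) (simp add: c)
      show ?thesis
      proof (cases "K y c")
        case True then show ?thesis using hit[OF y cw] yx[OF c] by simp
      next
        case False then show ?thesis using * Hx by simp
      qed
    qed
    have "K y a" using l[of a] k by simp
    then have "app (H y) a = ?v" using hit[OF y a] ay[OF a] by simp
    then have ne: "app (H y) a \<noteq> app x a" by (auto split: if_splits)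
    have sa: "suc a \<^bold>\<in> w1" by (rule w1_suc[OF w1 a])
    have as: "a \<^bold>\<subseteq> suc a" by (simp add: sub_def)
    have fy: "is_fun_on (H y) w1" by (rule fn[OF bin[OF y]])
    have ra: "restr (H y) a = restr x a"
      by (subst restr_eq_iff[OF fy ord_mem_sub[OF o a] fP[OF x] ord_mem_sub[OF o a]]) (use Hy in blast)
    show ?thesis unfolding branches_at_def
    proof (rule exI[of _ a], rule exI[of _ "suc a"], rule exI[of _ "restr x (suc a)"], rule exI[of _ "restr (H y) (suc a)"], intro conjI)
      show "is_ordinal a" by (rule ord_mem[OF o a])
      show "is_fun_on (restr x a) a" by (rule segs_fun[OF o fP[OF x] a])
      show "restr x (suc a) \<^bold>\<in> T" "restr (H y) (suc a) \<^bold>\<in> T" unfolding T using x HP[OF y] sa by blast+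
      show "is_fun_on (restr x (suc a)) (suc a)" "is_fun_on (restr (H y) (suc a)) (suc a)"
        by (rule segs_fun[OF o fP[OF x] sa], rule segs_fun[OF o fy sa])
      show "restr x a \<^bold>\<subseteq> restr x (suc a)" by (rule segs_mono[OF o fP[OF x] as])
      show "restr x a \<^bold>\<subseteq> restr (H y) (suc a)" unfolding ra[symmetric] by (rule segs_mono[OF o fy as])
      show "restr x (suc a) \<noteq> restr (H y) (suc a)"
        using segs_app[OF o fP[OF x] sa, of a] segs_app[OF o fy sa, of a] ne by auto
    qed simp
  qed
  have bij: "\<exists>B f. (\<forall>t. t \<^bold>\<in> B \<longleftrightarrow> t \<^bold>\<in> b \<and> branches_at T t) \<and> is_bijection f w1 B" if b: "is_path w1 T b" for b
  proof -
    define x where "x = uni b"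
    have bs: "b = segs w1 x" and x: "x \<^bold>\<in> P" using path[OF b] unfolding x_def by blast+
    define U where "U = sep w1 (\<lambda>a. branches_at T (restr x a))"
    have U: "a \<^bold>\<in> U \<longleftrightarrow> a \<^bold>\<in> w1 \<and> branches_at T (restr x a)" for a unfolding U_def by (rule mem_sep) (intro defi)
    define B where "B = sep b (branches_at T)"
    have B: "t \<^bold>\<in> B \<longleftrightarrow> t \<^bold>\<in> b \<and> branches_at T t" for t unfolding B_def by (rule mem_sep) (intro defi)
    have ub: "unbounded w1 U" unfolding unbounded_def[OF w1]
    proof (intro conjI allI impI)
      show "U \<^bold>\<subseteq> w1" by (rule subI) (simp add: U)
      fix c assume c: "c \<^bold>\<in> w1"
      obtain a where "a \<^bold>\<in> w1" "K x a" "\<not> a \<^bold>\<in> c" using unb[of x c] c x P by blast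
      then show "\<not> U \<^bold>\<subseteq> c" using U branch[OF x] subD by blast
    qed
    have "\<exists>f. is_bijection f w1 B"
    proof (rule unbounded_bijection[OF w1 ub])
      show "Tf True (\<lambda>s. restr x (s 0))" by (intro defi)
      show "a = c" if "a \<^bold>\<in> U" "c \<^bold>\<in> U" "restr x a = restr x c" for a c
        using segs_inject[OF o fP[OF x]] that U by blast
      show "t \<^bold>\<in> B \<longleftrightarrow> (\<exists>a. a \<^bold>\<in> U \<and> t = restr x a)" for t
        unfolding B U bs mem_segs by blast
    qed
    then show ?thesis using B by blast
  qed
  have "is_perfect_tree w1 T" unfolding is_perfect_tree_def using tree chains bij by blast
  moreover have "x \<^bold>\<in> P \<longleftrightarrow> (\<exists>b. is_path w1 T b \<and> is_union x b)" for x
    unfolding is_union_iff using path path_segs uni_segs[OF o fP lim] by metis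
  ultimately have "is_perfect_set w1 P" unfolding is_perfect_set_def by blast
  then show ?thesis using P by metis
qed

section \<open>Plays and strategies\<close>

text \<open>\<open>G\<close> gives the next move at every position, whichever player is to move; the
  domain of a position reveals whose turn it is. Both players are thus merged into one transfinite
  recursion.\<close>

definition play where "play w G = Lam w (rec G)"

lemma Tf_play:
  assumes "Tf b t" "Tf b (\<lambda>s. G (\<lambda>i. s (Suc i)) (s 0))" shows "Tf b (\<lambda>s. play (t s) (G s))"
proof -
  have 1: "Tf b (\<lambda>s. G (\<lambda>i. s (h i)) (u s))" if "Tf b u" for h u
    by (rule Tf_let[where F = "\<lambda>s. G (\<lambda>i. s (h i))"]) (use Tf_bind[where F = G, OF assms(2)] that in auto)
  show ?thesis unfolding play_def by (intro defi assms(1) 1)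
qed

lemma
  assumes w: "is_ordinal w" and T: "Tf True (\<lambda>s. G (s 0))"
  shows play_fun: "is_fun_on (play w G) w"
    and play_app: "a \<^bold>\<in> w \<Longrightarrow> app (play w G) a = G (restr (play w G) a)"
  using rec_aux[OF w T] unfolding play_def recfun_def by blast+

lemma play_function:
  assumes w: "is_ordinal w" and T: "Tf True (\<lambda>s. G (s 0))"
    and S: "\<And>q a. a \<^bold>\<in> w \<Longrightarrow> is_function q a S \<Longrightarrow> G q \<^bold>\<in> S"
  shows "is_function (play w G) w S"
proof -
  have f: "is_fun_on (play w G) w" by (rule play_fun[OF w T])
  have "a \<^bold>\<in> w \<longrightarrow> app (play w G) a \<^bold>\<in> S" if "is_ordinal a" for a
  proof (rule ord_induct[OF that, where P = "\<lambda>a. a \<^bold>\<in> w \<longrightarrow> app (play w G) a \<^bold>\<in> S"])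
    show "Df True (\<lambda>s. s 0 \<^bold>\<in> w \<longrightarrow> app (play w G) (s 0) \<^bold>\<in> S)" by (intro defi)
    fix x assume IH: "\<And>y. y \<^bold>\<in> x \<Longrightarrow> y \<^bold>\<in> w \<longrightarrow> app (play w G) y \<^bold>\<in> S"
    show "x \<^bold>\<in> w \<longrightarrow> app (play w G) x \<^bold>\<in> S"
    proof
      assume x: "x \<^bold>\<in> w"
      have "app (restr (play w G) x) y \<^bold>\<in> S" if y: "y \<^bold>\<in> x" for y
        unfolding segs_app[OF w f x y] using IH[OF y] ord_trans[OF w y x] by blast
      then have "is_function (restr (play w G) x) x S" unfolding is_function_iff using segs_fun[OF w f x] by blast
      then show "app (play w G) x \<^bold>\<in> S" unfolding play_app[OF w T x] by (rule S[OF x])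
    qed
  qed
  then show ?thesis unfolding is_function_iff using f ord_mem[OF w] by blast
qed

text \<open>The two rules are compared along the play of the first one only, where it is known at
  which stages they consult their data.\<close>

lemma play_agree:
  assumes w: "is_ordinal w" and T: "Tf True (\<lambda>s. G (s 0))" "Tf True (\<lambda>s. G' (s 0))" and a: "a \<^bold>\<in> w"
    and e: "\<And>c. c \<^bold>\<in> a \<Longrightarrow> G (restr (play w G) c) = G' (restr (play w G) c)"
  shows "restr (play w G) a = restr (play w G') a"
proof -
  let ?p = "play w G" and ?p' = "play w G'"
  have f: "is_fun_on ?p w" "is_fun_on ?p' w" using play_fun[OF w] T by blast+
  have oa: "is_ordinal a" by (rule ord_mem[OF w a])
  have "c \<^bold>\<in> a \<longrightarrow> app ?p c = app ?p' c" if "is_ordinal c" for c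
  proof (rule ord_induct[OF that, where P = "\<lambda>c. c \<^bold>\<in> a \<longrightarrow> app ?p c = app ?p' c"])
    show "Df True (\<lambda>s. s 0 \<^bold>\<in> a \<longrightarrow> app ?p (s 0) = app ?p' (s 0))" by (intro defi)
    fix x assume IH: "\<And>y. y \<^bold>\<in> x \<Longrightarrow> y \<^bold>\<in> a \<longrightarrow> app ?p y = app ?p' y"
    show "x \<^bold>\<in> a \<longrightarrow> app ?p x = app ?p' x"
    proof
      assume x: "x \<^bold>\<in> a"
      have xw: "x \<^bold>\<in> w" by (rule ord_trans[OF w x a])
      have "restr ?p x = restr ?p' x"
        by (subst restr_eq_iff[OF f(1) ord_mem_sub[OF w xw] f(2) ord_mem_sub[OF w xw]])
          (use IH ord_trans[OF oa _ x] in blast)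
      then show "app ?p x = app ?p' x"
        unfolding play_app[OF w T(1) xw] play_app[OF w T(2) xw] using e[OF x] by simp
    qed
  qed
  then show ?thesis
    by (subst restr_eq_iff[OF f(1) ord_mem_sub[OF w a] f(2) ord_mem_sub[OF w a]]) (use ord_mem[OF oa] in blast)
qed

lemma strategy_move:
  assumes s: "is_strategy turn w S \<sigma>" and a: "a \<^bold>\<in> w" "turn a" and q: "is_function q a S"
  shows "pr q (app \<sigma> q) \<^bold>\<in> \<sigma>" "app \<sigma> q \<^bold>\<in> S"
proof -
  have "is_position turn w S q" unfolding is_position_def using a q by blast
  then have "\<exists>!m. pr q m \<^bold>\<in> \<sigma>" using s unfolding is_strategy_def pair_in_iff by blast
  then obtain m where m: "pr q m \<^bold>\<in> \<sigma>" "\<And>m'. pr q m' \<^bold>\<in> \<sigma> \<Longrightarrow> m' = m" by blast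
  have e: "app \<sigma> q = m" unfolding app_def by (rule the1_eq) (use m in blast)+
  obtain q' m' where "m' \<^bold>\<in> S" "is_pair (pr q m) q' m'" using s m(1) unfolding is_strategy_def by blast
  then show "pr q (app \<sigma> q) \<^bold>\<in> \<sigma>" "app \<sigma> q \<^bold>\<in> S" using m(1) e by simp_all
qed

lemma followsI:
  assumes s: "is_strategy turn w S \<sigma>" and w: "is_ordinal w" and p: "is_function p w S"
    and e: "\<And>a. a \<^bold>\<in> w \<Longrightarrow> turn a \<Longrightarrow> app p a = app \<sigma> (restr p a)"
  shows "follows turn w \<sigma> p"
  unfolding follows_def is_restriction_iff pair_in_iff
proof (intro allI impI)
  fix a q m assume h: "a \<^bold>\<in> w \<and> turn a \<and> q = restr p a \<and> pr a m \<^bold>\<in> p"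
  have f: "is_fun_on p w" using p unfolding is_function_iff by blast
  have m: "m = app p a" using h unfolding fun_pr_iff[OF f] by blast
  have "app (restr p a) c \<^bold>\<in> S" if "c \<^bold>\<in> a" for c
    using segs_app[OF w f _ that] p h ord_trans[OF w that] unfolding is_function_iff by simp
  then have "is_function (restr p a) a S" unfolding is_function_iff using segs_fun[OF w f] h by blast
  then have "pr (restr p a) (app \<sigma> (restr p a)) \<^bold>\<in> \<sigma>" using strategy_move[OF s] h by blast
  then show "pr q m \<^bold>\<in> \<sigma>" using h m e by simp
qed

context
  fixes w1 assumes w1: "is_omega1 w1"
begin

section \<open>Rounds and the bits they produce\<close>

abbreviation E where "E \<equiv> rounds w1"

lemma E_w1: "a \<^bold>\<in> E \<Longrightarrow> a \<^bold>\<in> w1" and E_first: "a \<^bold>\<in> E \<Longrightarrow> first_turn a" and E_om: "a \<^bold>\<in> E \<Longrightarrow> \<not> a \<^bold>\<in> om"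
  using mem_rounds by blast+

lemma E_ord: "a \<^bold>\<in> E \<Longrightarrow> is_ordinal a"
  using E_w1 w1_ordD[OF w1] by blast

text \<open>The larger of \<open>b\<close> and \<open>om\<close>, or else its successor, is a first
  turn.\<close>

lemma E_unbounded: "unbounded w1 E"
  unfolding unbounded_def[OF w1]
proof (intro conjI allI impI notI)
  show "E \<^bold>\<subseteq> w1" by (rule subI) (rule E_w1)
  fix b assume b: "b \<^bold>\<in> w1" and s: "E \<^bold>\<subseteq> b"
  let ?c = "un b om"
  have ob: "is_ordinal b" by (rule w1_ordD[OF w1 b])
  have oc: "is_ordinal ?c" by (rule ord_un[OF ob om_ord])
  have cw: "?c \<^bold>\<in> w1" using un_cases[OF ob om_ord] b om_mem_w1[OF w1] by auto
  have "\<exists>a. a \<^bold>\<in> E \<and> ?c \<^bold>\<subseteq> a"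
  proof (cases "first_turn ?c")
    case True
    have "\<not> ?c \<^bold>\<in> om" using ord_not_mem[OF oc om_ord] un_right by blast
    then show ?thesis using True cw mem_rounds sub_refl by blast
  next
    case False
    then obtain d where d: "first_turn d" "?c = suc d" using first_or_second[OF oc] second_turn_iff by blast
    have "first_turn (suc ?c)" using d by simp
    moreover have "\<not> suc ?c \<^bold>\<in> om" using ord_not_mem[OF oc om_ord] un_right by simp
    ultimately show ?thesis using w1_suc[OF w1 cw] mem_rounds
      by (intro exI[of _ "suc ?c"]) (simp add: sub_def)
  qed
  then obtain a where a: "a \<^bold>\<in> E" "?c \<^bold>\<subseteq> a" by blast
  then have "a \<^bold>\<in> b" "b \<^bold>\<subseteq> a" using s subD un_left sub_trans by blast+
  then show False using subD mem_irrefl by blast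
qed

text \<open>The stage at which the round for bit \<open>c\<close> starts; inverse to the collapse of
  the rounds.\<close>

definition round where "round c = the1 (\<lambda>a. a \<^bold>\<in> E \<and> collapse E a = c)"

lemma Tf_round [defi]: "Tf True t \<Longrightarrow> Tf True (\<lambda>s. round (t s))"
  by (rule Tf_comp1[where F = round]; (assumption | (unfold round_def, intro defi)))

lemma round_collapse: "a \<^bold>\<in> E \<Longrightarrow> round (collapse E a) = a"
  unfolding round_def by (rule the1_eq) (use collapse_inject E_ord in blast)+

lemma round: "c \<^bold>\<in> w1 \<Longrightarrow> round c \<^bold>\<in> E" "c \<^bold>\<in> w1 \<Longrightarrow> collapse E (round c) = c"
  using collapse_onto[OF w1 E_unbounded] round_collapse by metis+

lemma collapse_E_w1: "a \<^bold>\<in> E \<Longrightarrow> collapse E a \<^bold>\<in> w1"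
  by (rule collapse_mem_w1[OF w1 E_w1])

lemma bit_binary: "bit p a = emp \<or> bit p a = suc emp"
  unfolding bit_def asks_def by simp

subsection \<open>The first player wins\<close>

text \<open>\<open>z\<close> is consulted at the index of the bit, not at the number of requests so
  far, so it has an influence only at bits asked for. At the later turns of the second player,
  \<open>uni a\<close> is the start of the round that \<open>a\<close> completes.\<close>

definition reply where
  "reply \<sigma> g C z q = (let a = dom q in if first_turn a then app \<sigma> q
     else if a \<^bold>\<in> om then coding_move g C a
     else if asks q (uni a) then app z (collapse E (uni a)) else emp)"

lemma Tf_reply: "Tf True t \<Longrightarrow> Tf True u \<Longrightarrow> Tf True (\<lambda>s. reply \<sigma> g C (t s) (u s))"
  by (rule Tf_comp2[where F = "reply \<sigma> g C"]; (assumption | (unfold reply_def Let_def, intro defi)))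

text \<open>All these plays are won by the first player, so they produce elements of
  \<open>X\<close> and ask unboundedly often. Whether a bit is asked for, and its value if not,
  depends on earlier answers only. These are the hypotheses of
  \<open>perfect_set_of_answers\<close>.\<close>

lemma first_wins_perfect:
  assumes S: "is_ordinal S" and num2: "num 2 \<^bold>\<in> S" and SC: "\<And>u. u \<^bold>\<in> C \<Longrightarrow> is_ordinal u \<Longrightarrow> suc u \<^bold>\<in> S"
    and g: "is_injection g C om"
    and cod: "\<And>p. (\<And>b. b \<^bold>\<in> om \<Longrightarrow> second_turn b \<Longrightarrow> app p b = coding_move g C b) \<Longrightarrow> defined_set n l p X"
    and cex: "counterexample w1 X"
    and str: "is_strategy first_turn w1 S \<sigma>"
    and win: "\<And>p. is_function p w1 S \<Longrightarrow> follows first_turn w1 \<sigma> p \<Longrightarrow> payoff w1 n l p"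
  shows "\<exists>P. is_perfect_set w1 P \<and> P \<^bold>\<subseteq> X"
proof -
  note o = w1_ord[OF w1]
  let ?G = "reply \<sigma> g C"
  let ?p = "\<lambda>z. play w1 (?G z)"
  have e01: "emp \<^bold>\<in> S" "suc emp \<^bold>\<in> S"
    using ord_trans[OF S _ num2] by simp_all
  have TG: "Tf True (\<lambda>s. ?G z (s 0))" for z by (intro Tf_reply defi)
  have Tp: "Tf True (\<lambda>s. ?p (t s))" if "Tf True t" for t
    by (rule Tf_play) (intro defi, intro Tf_reply Tf_subst[OF that] defi)
  have fn: "is_fun_on (?p z) w1" for z by (rule play_fun[OF o TG])
  have dm: "dom (restr (?p z) a) = a" if "a \<^bold>\<in> w1" for a z by (rule dom_fun[OF segs_fun[OF o fn that]])
  have ap: "app (?p z) a = ?G z (restr (?p z) a)" if "a \<^bold>\<in> w1" for a z by (rule play_app[OF o TG that])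
  have pred: "\<exists>c. a = suc c \<and> c \<^bold>\<in> E \<and> uni a = c" if a: "a \<^bold>\<in> w1" "\<not> first_turn a" "\<not> a \<^bold>\<in> om" for a
  proof -
    have oa: "is_ordinal a" by (rule w1_ordD[OF w1 a(1)])
    then obtain c where c: "first_turn c" "a = suc c" using first_or_second a(2) second_turn_iff by blast
    have "c \<^bold>\<in> w1" using ord_trans[OF o _ a(1)] c by simp
    then have "c \<^bold>\<in> E" using c a(3) mem_rounds by simp
    then show ?thesis using c ord_uni_suc[OF E_ord] by blast
  qed
  have fS: "is_function (?p z) w1 S" if z: "is_binary_seq z w1" for z
  proof (rule play_function[OF o TG])
    fix q a assume a: "a \<^bold>\<in> w1" and q: "is_function q a S"
    have d: "dom q = a" using q dom_fun unfolding is_function_iff by blast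
    consider "first_turn a" | "\<not> first_turn a" "a \<^bold>\<in> om" | "\<not> first_turn a" "\<not> a \<^bold>\<in> om" by blast
    then show "?G z q \<^bold>\<in> S"
    proof cases
      case 1 then show ?thesis unfolding reply_def Let_def d using strategy_move(2)[OF str a 1 q] by simp
    next
      case 2
      have "coding_move g C a \<^bold>\<in> S" using coding_move_cases[OF g, of a] e01 SC by auto
      then show ?thesis unfolding reply_def Let_def d using 2 by simp
    next
      case 3
      obtain c where "c \<^bold>\<in> E" "uni a = c" using pred[OF a 3] by blast
      then have "app z (collapse E (uni a)) \<^bold>\<in> S" using z collapse_E_w1 e01 unfolding binary_seq_iff by metis
      then show ?thesis unfolding reply_def Let_def d using 3 e01 by simp
    qed
  qed
  have answer: "app (?p z) (suc a) = app z (collapse E a)" if a: "a \<^bold>\<in> E" "asks (?p z) a" for z a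
  proof -
    have sw: "suc a \<^bold>\<in> w1" by (rule w1_suc[OF w1 E_w1[OF a(1)]])
    have "\<not> first_turn (suc a)" using first_turn_not_suc[OF E_ord[OF a(1)]] E_first[OF a(1)] by blast
    moreover have "\<not> suc a \<^bold>\<in> om" using E_om[OF a(1)] by simp
    moreover have "uni (suc a) = a" by (rule ord_uni_suc[OF E_ord[OF a(1)]])
    moreover have "asks (restr (?p z) (suc a)) a" using a(2) segs_app[OF o fn sw, of a] unfolding asks_def by simp
    ultimately show ?thesis unfolding ap[OF sw] by (simp add: reply_def Let_def dm[OF sw])
  qed
  define H where "H z = Lam w1 (\<lambda>c. bit (?p z) (round c))" for z
  define K where "K z c = asks (?p z) (round c)" for z c
  have TH: "Tf True (\<lambda>s. H (s 0))" unfolding H_def by (intro defi Tp)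
  have DK: "Df True (\<lambda>s. K (s 0) (s 1))" unfolding K_def by (intro defi Tp)
  have TH1: "Tf True (\<lambda>s. bit (?p z) (round (s 0)))" for z by (intro defi)
  have aH: "app (H z) c = bit (?p z) (round c)" if "c \<^bold>\<in> w1" for z c unfolding H_def by (rule app_Lam[OF TH1 that])
  have fH: "is_fun_on (H z) w1" for z unfolding H_def by (rule is_fun_on_Lam[OF TH1])
  have bin: "is_binary_seq (H z) w1" for z
    unfolding binary_seq_iff using fH aH bit_binary by metis
  \<comment> \<open>The answer of round \<open>c\<close> is given at \<open>suc c\<close>, so it
    belongs to the position at \<open>a\<close> only if \<open>suc c\<close> lies below
    \<open>a\<close>.\<close>
  have loc: "restr (?p z) a = restr (?p z') a"
    if a: "a \<^bold>\<in> w1" and e: "\<And>c. c \<^bold>\<in> E \<Longrightarrow> suc c \<^bold>\<in> a \<Longrightarrow> asks (?p z) c \<Longrightarrow> app z (collapse E c) = app z' (collapse E c)" for z z' a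
  proof (rule play_agree[OF o TG TG a])
    fix c assume c: "c \<^bold>\<in> a"
    have cw: "c \<^bold>\<in> w1" by (rule ord_trans[OF o c a])
    show "?G z (restr (?p z) c) = ?G z' (restr (?p z) c)"
    proof (cases "first_turn c \<or> c \<^bold>\<in> om")
      case True then show ?thesis unfolding reply_def Let_def dm[OF cw] by auto
    next
      case False
      then obtain d where d: "c = suc d" "d \<^bold>\<in> E" "uni c = d" using pred[OF cw] by blast
      have "asks (restr (?p z) c) d \<longleftrightarrow> asks (?p z) d"
        unfolding asks_def using segs_app[OF o fn cw, of d] d(1) by simp
      moreover have "asks (?p z) d \<Longrightarrow> app z (collapse E d) = app z' (collapse E d)" using e[OF d(2)] c d(1) by simp
      moreover have "?G y q = (if first_turn c then app \<sigma> q else if c \<^bold>\<in> om then coding_move g C c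
          else if asks q d then app y (collapse E d) else emp)" if "dom q = c" for y q
        unfolding reply_def Let_def that d(3) ..
      ultimately show ?thesis using dm[OF cw] False by simp
    qed
  qed
  have HX: "H z \<^bold>\<in> X \<and> (\<forall>b. b \<^bold>\<in> w1 \<longrightarrow> (\<exists>c. c \<^bold>\<in> w1 \<and> K z c \<and> \<not> c \<^bold>\<in> b))" if z: "is_binary_seq z w1" for z
  proof -
    have "follows first_turn w1 \<sigma> (?p z)"
    proof (rule followsI[OF str o fS[OF z]])
      fix a assume a: "a \<^bold>\<in> w1" "first_turn a"
      show "app (?p z) a = app \<sigma> (restr (?p z) a)"
        unfolding ap[OF a(1)] using a(2) by (simp add: reply_def Let_def dm[OF a(1)])
    qed
    then have pay: "payoff w1 n l (?p z)" by (rule win[OF fS[OF z]])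
    have "defined_set n l (?p z) X"
    proof (rule cod)
      fix b assume b: "b \<^bold>\<in> om" "second_turn b"
      have bw: "b \<^bold>\<in> w1" by (rule ord_trans[OF o b(1) om_mem_w1[OF w1]])
      have "\<not> first_turn b" using first_not_second[OF w1_ordD[OF w1 bw]] b(2) by blast
      then show "app (?p z) b = coding_move g C b"
        unfolding ap[OF bw] using b(1) by (simp add: reply_def Let_def dm[OF bw])
    qed
    then obtain x where x: "x \<^bold>\<in> X" "produces w1 (?p z) x" using pay cex unfolding payoff_def by blast
    have bx: "is_fun_on x w1" using x(1) cex binary_seq_iff unfolding counterexample_def by blast
    have "H z = x"
    proof (rule fun_ext[OF fH bx])
      fix c assume c: "c \<^bold>\<in> w1"
      show "app (H z) c = app x c"
        unfolding aH[OF c] using x(2) round[OF c] unfolding produces_def by metis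
    qed
    moreover have "\<exists>c. c \<^bold>\<in> w1 \<and> K z c \<and> \<not> c \<^bold>\<in> b" if b: "b \<^bold>\<in> w1" for b
    proof -
      obtain a where a: "a \<^bold>\<in> E" "asks (?p z) a" "\<not> collapse E a \<^bold>\<in> b" using x(2) b unfolding produces_def by blast
      then show ?thesis using collapse_E_w1[OF a(1)] round_collapse[OF a(1)] unfolding K_def by (intro exI[of _ "collapse E a"]) simp
    qed
    ultimately show ?thesis using x(1) by blast
  qed
  have "\<exists>P. is_perfect_set w1 P \<and> (\<forall>x. x \<^bold>\<in> P \<longrightarrow> (\<exists>z. is_binary_seq z w1 \<and> x = H z))"
  proof (rule perfect_set_of_answers[OF w1 TH DK])
    show "is_binary_seq (H z) w1" for z by (rule bin)
    show "\<exists>c. c \<^bold>\<in> w1 \<and> K z c \<and> \<not> c \<^bold>\<in> b" if "is_binary_seq z w1" "b \<^bold>\<in> w1" for z b using HX that by blast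
    fix z z' b assume z: "is_binary_seq z w1" "is_binary_seq z' w1" and b: "b \<^bold>\<in> w1"
      and e: "\<And>c. c \<^bold>\<in> b \<Longrightarrow> K z c \<Longrightarrow> app z c = app z' c"
    let ?a = "round b"
    have aE: "?a \<^bold>\<in> E" by (rule round(1)[OF b])
    have r: "restr (?p z) ?a = restr (?p z') ?a"
    proof (rule loc[OF E_w1[OF aE]])
      fix c assume c: "c \<^bold>\<in> E" "suc c \<^bold>\<in> ?a" "asks (?p z) c"
      have "c \<^bold>\<in> ?a" using ord_trans[OF E_ord[OF aE] _ c(2)] by simp
      then have "collapse E c \<^bold>\<in> b" using collapse_mono[OF E_ord[OF aE] c(1)] round(2)[OF b] by simp
      moreover have "K z (collapse E c)" unfolding K_def round_collapse[OF c(1)] by (rule c(3))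
      ultimately show "app z (collapse E c) = app z' (collapse E c)" by (rule e)
    qed
    \<comment> \<open>A round starts with a first turn, so the strategy decides from the common
      position whether bit \<open>b\<close> is asked for, and what it is otherwise.\<close>
    have "app (?p z) ?a = app (?p z') ?a"
      unfolding ap[OF E_w1[OF aE]] r using E_first[OF aE]
      by (simp add: reply_def Let_def dm[OF E_w1[OF aE]])
    then have k: "asks (?p z) ?a \<longleftrightarrow> asks (?p z') ?a" "\<not> asks (?p z) ?a \<longrightarrow> bit (?p z) ?a = bit (?p z') ?a"
      unfolding asks_def bit_def by auto
    then show "(K z b \<longleftrightarrow> K z' b) \<and> (\<not> K z b \<longrightarrow> app (H z) b = app (H z') b)"
      unfolding K_def aH[OF b] by blast
  next
    fix z b assume z: "is_binary_seq z w1" and b: "b \<^bold>\<in> w1" and k: "K z b"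
    have "app (?p z) (suc (round b)) = app z b"
      using answer[OF round(1)[OF b]] k round(2)[OF b] unfolding K_def by simp
    then show "app (H z) b = app z b"
      unfolding aH[OF b] bit_def using k z b unfolding K_def binary_seq_iff by auto
  qed
  then obtain P where P: "is_perfect_set w1 P" "\<forall>x. x \<^bold>\<in> P \<longrightarrow> (\<exists>z. is_binary_seq z w1 \<and> x = H z)" by blast
  have "P \<^bold>\<subseteq> X" by (rule subI) (use P(2) HX in blast)
  then show ?thesis using P(1) by blast
qed

subsection \<open>Sets of sequences determined by countable initial segments\<close>

text \<open>A well-order on a set of numbers determines both its order type and its numbering. It is
  \<open>suc b\<close> that is coded, so that each element of \<open>b\<close> lies below another
  one and shows up in the relation. The diagonal is left free for the bits of a sequence.\<close>

lemma coded_initial_segments: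
  assumes b: "is_ordinal b" and b': "is_ordinal b'" and g: "is_injection g (suc b) om"
    and g': "is_injection g' (suc b') om"
    and e: "\<And>i j. i \<^bold>\<in> om \<Longrightarrow> j \<^bold>\<in> om \<Longrightarrow> i \<noteq> j \<Longrightarrow>
      (\<exists>a c. a \<^bold>\<in> c \<and> c \<^bold>\<in> suc b \<and> i = app g a \<and> j = app g c) \<longleftrightarrow>
      (\<exists>a c. a \<^bold>\<in> c \<and> c \<^bold>\<in> suc b' \<and> i = app g' a \<and> j = app g' c)"
    and a: "a \<^bold>\<in> b"
  shows "a \<^bold>\<in> b' \<and> app g a = app g' a"
proof -
  have ob: "is_ordinal (suc b)" "is_ordinal (suc b')" using b b' by simp_all
  have go: "app g c \<^bold>\<in> om" if "c \<^bold>\<in> suc b" for c using g that unfolding is_injection_iff by blast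
  have go': "app g' c \<^bold>\<in> om" if "c \<^bold>\<in> suc b'" for c using g' that unfolding is_injection_iff by blast
  have gi: "c = d" if "c \<^bold>\<in> suc b" "d \<^bold>\<in> suc b" "app g c = app g d" for c d
    using g that unfolding is_injection_iff by blast
  have gi': "c = d" if "c \<^bold>\<in> suc b'" "d \<^bold>\<in> suc b'" "app g' c = app g' d" for c d
    using g' that unfolding is_injection_iff by blast
  have tr: "\<exists>c d. c \<^bold>\<in> d \<and> d \<^bold>\<in> suc b' \<and> app g x = app g' c \<and> app g y = app g' d"
    if xy: "x \<^bold>\<in> y" "y \<^bold>\<in> suc b" for x y
  proof -
    have x: "x \<^bold>\<in> suc b" by (rule ord_trans[OF ob(1) xy])
    have "app g x \<noteq> app g y" using gi[OF x xy(2)] xy(1) mem_irrefl by metis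
    then show ?thesis using e[OF go[OF x] go[OF xy(2)]] xy by blast
  qed
  have tr': "\<exists>c d. c \<^bold>\<in> d \<and> d \<^bold>\<in> suc b \<and> app g' x = app g c \<and> app g' y = app g d"
    if xy: "x \<^bold>\<in> y" "y \<^bold>\<in> suc b'" for x y
  proof -
    have x: "x \<^bold>\<in> suc b'" by (rule ord_trans[OF ob(2) xy])
    have "app g' x \<noteq> app g' y" using gi'[OF x xy(2)] xy(1) mem_irrefl by metis
    then show ?thesis using e[OF go'[OF x] go'[OF xy(2)]] xy by blast
  qed
  have "a \<^bold>\<in> b \<longrightarrow> a \<^bold>\<in> b' \<and> app g a = app g' a" if "is_ordinal a" for a
  proof (rule ord_induct[OF that, where P = "\<lambda>a. a \<^bold>\<in> b \<longrightarrow> a \<^bold>\<in> b' \<and> app g a = app g' a"])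
    show "Df True (\<lambda>s. s 0 \<^bold>\<in> b \<longrightarrow> s 0 \<^bold>\<in> b' \<and> app g (s 0) = app g' (s 0))" by (intro defi)
    fix a assume IH0: "\<And>y. y \<^bold>\<in> a \<Longrightarrow> y \<^bold>\<in> b \<longrightarrow> y \<^bold>\<in> b' \<and> app g y = app g' y"
    show "a \<^bold>\<in> b \<longrightarrow> a \<^bold>\<in> b' \<and> app g a = app g' a"
    proof
      assume a: "a \<^bold>\<in> b"
      have IH: "y \<^bold>\<in> b' \<and> app g y = app g' y \<and> y \<^bold>\<in> suc b" if "y \<^bold>\<in> a" for y
        using IH0[OF that] ord_trans[OF b that a] by simp
      have as: "a \<^bold>\<in> suc b" using a by simp
      obtain a' d where a': "a' \<^bold>\<in> d" "d \<^bold>\<in> suc b'" "app g a = app g' a'" using tr[OF a] by auto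
      have ab': "a' \<^bold>\<in> b'" using a'(1,2) ord_trans[OF b' a'(1)] by auto
      then have as': "a' \<^bold>\<in> suc b'" by simp
      have "a' = a"
      proof (rule set_ext)
        fix y show "y \<^bold>\<in> a' \<longleftrightarrow> y \<^bold>\<in> a"
        proof
          assume y: "y \<^bold>\<in> a"
          obtain c d where cd: "c \<^bold>\<in> d" "d \<^bold>\<in> suc b'" "app g y = app g' c" "app g a = app g' d" using tr[OF y as] by blast
          have "c = y" using gi'[of c y] cd IH[OF y] ord_trans[OF ob(2) cd(1,2)] by simp
          moreover have "d = a'" using gi'[OF cd(2) as'] cd(4) a'(3) by simp
          ultimately show "y \<^bold>\<in> a'" using cd(1) by simp
        next
          assume y: "y \<^bold>\<in> a'"
          obtain c d where cd: "c \<^bold>\<in> d" "d \<^bold>\<in> suc b" "app g' y = app g c" "app g' a' = app g d" using tr'[OF y as'] by blast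
          have da: "d = a" using gi[OF cd(2) as] cd(4) a'(3) by simp
          then have c: "c \<^bold>\<in> a" using cd(1) by simp
          have "y \<^bold>\<in> suc b'" by (rule ord_trans[OF ob(2) y as'])
          moreover have "c \<^bold>\<in> suc b'" using IH[OF c] by simp
          ultimately have "c = y" using gi'[of c y] IH[OF c] cd(3) by simp
          then show "y \<^bold>\<in> a" using c by simp
        qed
      qed
      then show "a \<^bold>\<in> b' \<and> app g a = app g' a" using ab' a'(3) by simp
    qed
  qed
  then show ?thesis using a ord_mem[OF b a] by blast
qed

text \<open>An element is recovered from the countable ordinal \<open>bd x\<close> and its bits
  below that ordinal. Both fit into one relation on \<open>om\<close> once a numbering of each
  countable ordinal has been chosen.\<close>

lemma card_at_most_continuumI:
  assumes X: "\<And>x. x \<^bold>\<in> X \<Longrightarrow> is_binary_seq x w1" and Tb: "Tf True (\<lambda>s. bd (s 0))"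
    and bw: "\<And>x. x \<^bold>\<in> X \<Longrightarrow> bd x \<^bold>\<in> w1"
    and inj: "\<And>x y. x \<^bold>\<in> X \<Longrightarrow> y \<^bold>\<in> X \<Longrightarrow> bd x = bd y \<Longrightarrow>
      (\<And>a. a \<^bold>\<in> bd x \<Longrightarrow> app x a = app y a) \<Longrightarrow> x = y"
  shows "card_at_most_continuum X"
proof -
  note o = w1_ord[OF w1]
  have D: "Df True (\<lambda>s. is_injection (s 1) (suc (s 0)) om)" by (intro defi)
  have "\<exists>g. is_injection g (suc b) om" if "b \<^bold>\<in> w1" for b
    using w1_countable[OF w1 w1_suc[OF w1 that]] unfolding is_countable_def is_omega_iff by blast
  then obtain gg where gg: "\<And>b. b \<^bold>\<in> w1 \<Longrightarrow> is_injection (app gg b) (suc b) om"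
    using choice_function[of w1 "\<lambda>b g. is_injection g (suc b) om", OF _ D] by blast
  \<comment> \<open>Off the diagonal the relation codes \<open>suc (bd x)\<close>, on the diagonal
    the bits of \<open>x\<close> below \<open>bd x\<close>.\<close>
  define Q where "Q x i j \<longleftrightarrow>
    (\<exists>a c. a \<^bold>\<in> c \<and> c \<^bold>\<in> suc (bd x) \<and> i = app (app gg (bd x)) a \<and> j = app (app gg (bd x)) c) \<or>
    (\<exists>a. a \<^bold>\<in> bd x \<and> i = app (app gg (bd x)) a \<and> i = j \<and> app x a \<noteq> emp)" for x i j
  have DQ: "Df True (\<lambda>s. Q (t s) (u s) (v s))" if "Tf True t" "Tf True u" "Tf True v" for t u v
  proof -
    have Tb': "Tf True (\<lambda>s. bd (t s))" if "Tf True t" for t by (rule Tf_comp1[where F = bd, OF Tb that])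
    have "Df True (\<lambda>s. Q (s 0) (s 1) (s 2))" unfolding Q_def by (intro defi Tb')
    then show ?thesis using that by (rule Df_comp3[where P = Q])
  qed
  let ?F = "\<lambda>x n. if Q x (pfst (triple n)) (pfst (psnd (triple n))) then suc emp else emp"
  have TF: "Tf True (\<lambda>s. ?F x (s 0))" for x by (intro defi DQ)
  have TL: "Tf True (\<lambda>s. Lam om (?F (s 0)))" by (intro defi DQ)
  let ?f = "Lam X (\<lambda>x. Lam om (?F x))"
  have af: "app ?f x = Lam om (?F x)" if "x \<^bold>\<in> X" for x by (rule app_Lam[OF TL that])
  have QQ: "Q x i j \<longleftrightarrow> Q y i j" if e: "Lam om (?F x) = Lam om (?F y)" and ij: "i \<^bold>\<in> om" "j \<^bold>\<in> om" for x y i j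
  proof -
    obtain b k where b: "b \<^bold>\<in> om" "triple b = pr i (pr j k)" using triple_surj[OF ij] by blast
    have "app (Lam om (?F x)) b = app (Lam om (?F y)) b" using e by simp
    then have "?F x b = ?F y b" unfolding app_Lam[OF TF b(1)] .
    then show ?thesis using b(2) by (simp split: if_splits)
  qed
  have main: "x = y" if x: "x \<^bold>\<in> X" and y: "y \<^bold>\<in> X" and e: "Lam om (?F x) = Lam om (?F y)" for x y
  proof -
    let ?g = "app gg (bd x)" and ?g' = "app gg (bd y)"
    have ob: "is_ordinal (bd x)" "is_ordinal (bd y)" using w1_ordD[OF w1] bw x y by blast+
    have g: "is_injection ?g (suc (bd x)) om" "is_injection ?g' (suc (bd y)) om" using gg bw x y by blast+
    have ee: "(\<exists>a c. a \<^bold>\<in> c \<and> c \<^bold>\<in> suc (bd x) \<and> i = app ?g a \<and> j = app ?g c) \<longleftrightarrow>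
        (\<exists>a c. a \<^bold>\<in> c \<and> c \<^bold>\<in> suc (bd y) \<and> i = app ?g' a \<and> j = app ?g' c)"
      if "i \<^bold>\<in> om" "j \<^bold>\<in> om" "i \<noteq> j" for i j
      using QQ[OF e that(1,2)] that(3) unfolding Q_def by blast
    have 1: "a \<^bold>\<in> bd y \<and> app ?g a = app ?g' a" if "a \<^bold>\<in> bd x" for a
      by (rule coded_initial_segments[OF ob g ee that])
    have 2: "a \<^bold>\<in> bd x" if "a \<^bold>\<in> bd y" for a
      using coded_initial_segments[OF ob(2,1) g(2,1) ee[symmetric] that] by blast
    have bb: "bd x = bd y" by (rule set_ext) (use 1 2 in blast)
    have gi: "c = d" if "c \<^bold>\<in> suc (bd x)" "d \<^bold>\<in> suc (bd x)" "app ?g c = app ?g d" for c d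
      using g(1) that unfolding is_injection_iff by blast
    show "x = y"
    proof (rule inj[OF x y bb])
      fix a assume a: "a \<^bold>\<in> bd x"
      have diag: "Q z (app ?g a) (app ?g a) \<longleftrightarrow> app z a \<noteq> emp" if bz: "bd z = bd x" for z
      proof -
        have sa: "a \<^bold>\<in> suc (bd x)" using a by simp
        have n: "\<not> (c \<^bold>\<in> d \<and> d \<^bold>\<in> suc (bd x) \<and> app ?g a = app ?g c \<and> app ?g a = app ?g d)" for c d
        proof
          assume h: "c \<^bold>\<in> d \<and> d \<^bold>\<in> suc (bd x) \<and> app ?g a = app ?g c \<and> app ?g a = app ?g d"
          then have h1: "c \<^bold>\<in> d" and h2: "d \<^bold>\<in> suc (bd x)" and h3: "app ?g a = app ?g c" "app ?g a = app ?g d"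
            by blast+
          have os: "is_ordinal (suc (bd x))" using ob by simp
          have "c = a" by (rule gi[OF ord_trans[OF os h1 h2] sa h3(1)[symmetric]])
          moreover have "d = a" by (rule gi[OF h2 sa h3(2)[symmetric]])
          ultimately show False using h1 by simp
        qed
        have m: "c = a" if "c \<^bold>\<in> bd x" "app ?g a = app ?g c" for c using gi[of c a] that sa by simp
        show ?thesis unfolding Q_def bz using n m a by blast
      qed
      have gom: "app ?g a \<^bold>\<in> om" using g(1) a unfolding is_injection_iff by simp
      have "app x a \<noteq> emp \<longleftrightarrow> app y a \<noteq> emp"
        using QQ[OF e gom gom] diag[OF refl] diag[OF bb[symmetric]] by blast
      moreover have "a \<^bold>\<in> w1" by (rule ord_trans[OF o a bw[OF x]])
      ultimately show "app x a = app y a" using X[OF x] X[OF y] unfolding binary_seq_iff by metis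
    qed
  qed
  have "is_injection ?f X (Funs om (num 2))" unfolding is_injection_iff
  proof (intro conjI allI impI is_fun_on_Lam[OF TL])
    fix x assume x: "x \<^bold>\<in> X"
    have "app (Lam om (?F x)) a \<^bold>\<in> num 2" if "a \<^bold>\<in> om" for a
      unfolding app_Lam[OF TF that] mem_two by presburger
    then show "app ?f x \<^bold>\<in> Funs om (num 2)"
      unfolding af[OF x] mem_Funs is_function_iff using is_fun_on_Lam[OF TF] by blast
  next
    fix x y assume h: "x \<^bold>\<in> X \<and> y \<^bold>\<in> X \<and> app ?f x = app ?f y"
    then have x: "x \<^bold>\<in> X" and y: "y \<^bold>\<in> X" and e: "app ?f x = app ?f y" by blast+
    show "x = y" by (rule main[OF x y]) (use e in \<open>unfold af[OF x] af[OF y]\<close>)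
  qed
  then show ?thesis unfolding card_at_most_continuum_def is_omega_iff is_binary_seq_def is_numeral_iff
    by (intro exI[of _ om] exI[of _ "Funs om (num 2)"] exI[of _ ?f]) (simp del: mem_two)
qed

subsection \<open>The second player wins\<close>

text \<open>
  The first player asks exactly when the answer will be the next bit of \<open>z\<close>; the bits that
  are not asked for are thus determined by the position.
\<close>

definition extend where "extend q m = un q (upair (pr (dom q) m) (pr (dom q) m))"

definition greedy where
  "greedy \<tau> z q = (let a = dom q in if second_turn a then app \<tau> q
     else if a \<^bold>\<in> om then emp
     else if app \<tau> (extend q (num 2)) = emp \<longleftrightarrow> app z (collapse E a) = emp then num 2 else app z (collapse E a))"

lemma Tf_extend: "Tf b t \<Longrightarrow> Tf b u \<Longrightarrow> Tf b (\<lambda>s. extend (t s) (u s))"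
  by (rule Tf_comp2[where F = extend]; (assumption | (unfold extend_def, intro defi)))

lemma Tf_greedy: "Tf True t \<Longrightarrow> Tf True u \<Longrightarrow> Tf True (\<lambda>s. greedy \<tau> (t s) (u s))"
  by (rule Tf_comp2[where F = "greedy \<tau>"]; (assumption | (unfold greedy_def Let_def, intro defi Tf_extend)))

lemma second_wins_small:
  assumes S: "is_ordinal S" and num2: "num 2 \<^bold>\<in> S"
    and str: "is_strategy second_turn w1 S \<tau>"
    and win: "\<And>p. is_function p w1 S \<Longrightarrow> follows second_turn w1 \<tau> p \<Longrightarrow> \<not> payoff w1 n l p"
  shows False
proof -
  note o = w1_ord[OF w1]
  let ?G = "greedy \<tau>"
  let ?p = "\<lambda>z. play w1 (?G z)"
  have e01: "emp \<^bold>\<in> S" "suc emp \<^bold>\<in> S" using ord_trans[OF S _ num2] by simp_all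
  have TG: "Tf True (\<lambda>s. ?G z (s 0))" for z by (intro Tf_greedy defi)
  have Tp: "Tf True (\<lambda>s. ?p (t s))" if "Tf True t" for t
    by (rule Tf_play) (intro defi, intro Tf_greedy Tf_subst[OF that] defi)
  have fn: "is_fun_on (?p z) w1" for z by (rule play_fun[OF o TG])
  have dm: "dom (restr (?p z) a) = a" if "a \<^bold>\<in> w1" for a z by (rule dom_fun[OF segs_fun[OF o fn that]])
  have ap: "app (?p z) a = ?G z (restr (?p z) a)" if "a \<^bold>\<in> w1" for a z by (rule play_app[OF o TG that])
  have E: "a \<^bold>\<in> E" if "a \<^bold>\<in> w1" "\<not> second_turn a" "\<not> a \<^bold>\<in> om" for a
    using that first_or_second[OF w1_ordD[OF w1 that(1)]] mem_rounds by blast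
  have nE: "\<not> second_turn a" if "a \<^bold>\<in> E" for a using first_not_second[OF E_ord[OF that] E_first[OF that]] .
  have fS: "is_function (?p z) w1 S" if z: "is_binary_seq z w1" for z
  proof (rule play_function[OF o TG])
    fix q a assume a: "a \<^bold>\<in> w1" and q: "is_function q a S"
    have d: "dom q = a" using q dom_fun unfolding is_function_iff by blast
    show "?G z q \<^bold>\<in> S"
    proof (cases "second_turn a")
      case True then show ?thesis unfolding greedy_def Let_def d using strategy_move(2)[OF str a True q] by simp
    next
      case False
      have "app z (collapse E a) \<^bold>\<in> S" if "\<not> a \<^bold>\<in> om"
        using collapse_E_w1[OF E[OF a False that]] z e01 unfolding binary_seq_iff by metis
      then show ?thesis unfolding greedy_def Let_def d using False e01 num2 by simp
    qed
  qed
  \<comment> \<open>The move \<open>num 2\<close> is a request. The strategy is consulted on the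
    position that a request would create; the test is whether its reply is \<open>emp\<close>, since
    \<open>bit\<close> reads every other reply as 1.\<close>
  have move: "app (?p z) a = (if app \<tau> (extend (restr (?p z) a) (num 2)) = emp \<longleftrightarrow> app z (collapse E a) = emp then num 2 else app z (collapse E a))"
    if a: "a \<^bold>\<in> E" for z a
    unfolding ap[OF E_w1[OF a]] using nE[OF a] E_om[OF a] by (simp add: greedy_def Let_def dm[OF E_w1[OF a]])
  have asks_iff: "asks (?p z) a \<longleftrightarrow> (app \<tau> (extend (restr (?p z) a) (num 2)) = emp \<longleftrightarrow> app z (collapse E a) = emp)"
    if z: "is_binary_seq z w1" and a: "a \<^bold>\<in> E" for z a
  proof -
    have "num 2 \<noteq> emp" "num 2 \<noteq> suc emp" by (simp_all add: numeral_2_eq_2)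
    moreover have "app z (collapse E a) = emp \<or> app z (collapse E a) = suc emp" using z collapse_E_w1[OF a] unfolding binary_seq_iff by blast
    ultimately show ?thesis unfolding asks_def move[OF a] by auto
  qed
  \<comment> \<open>A bit is requested when the reply will be right and played otherwise, so the
    sequence produced is \<open>z\<close> in either case.\<close>
  have bits: "bit (?p z) a = app z (collapse E a)" if z: "is_binary_seq z w1" and a: "a \<^bold>\<in> E" for z a
  proof (cases "asks (?p z) a")
    case False
    then show ?thesis unfolding bit_def using asks_iff[OF z a] move[OF a, of z] by auto
  next
    case True
    have aw: "a \<^bold>\<in> w1" by (rule E_w1[OF a])
    have sw: "suc a \<^bold>\<in> w1" by (rule w1_suc[OF w1 aw])
    have m: "app (?p z) a = num 2" using True asks_iff[OF z a] move[OF a, of z] by simp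
    have "restr (?p z) (suc a) = extend (restr (?p z) a) (num 2)"
    proof (rule set_ext)
      fix p
      show "p \<^bold>\<in> restr (?p z) (suc a) \<longleftrightarrow> p \<^bold>\<in> extend (restr (?p z) a) (num 2)"
        unfolding extend_def dm[OF aw] mem_un mem_upair mem_restr fun_mem_iff[OF fn] m[symmetric] using aw by auto
    qed
    moreover have "app (?p z) (suc a) = app \<tau> (restr (?p z) (suc a))"
      unfolding ap[OF sw] using E_first[OF a] by (simp add: greedy_def Let_def dm[OF sw])
    ultimately have "app (?p z) (suc a) = emp \<longleftrightarrow> app z (collapse E a) = emp"
      using asks_iff[OF z a] True by simp
    moreover have "app z (collapse E a) = emp \<or> app z (collapse E a) = suc emp" using z collapse_E_w1[OF a] unfolding binary_seq_iff by blast
    ultimately show ?thesis unfolding bit_def using True by auto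
  qed
  have npay: "\<not> payoff w1 n l (?p z)" if z: "is_binary_seq z w1" for z
  proof (rule win[OF fS[OF z]], rule followsI[OF str o fS[OF z]])
    fix a assume a: "a \<^bold>\<in> w1" "second_turn a"
    show "app (?p z) a = app \<tau> (restr (?p z) a)"
      unfolding ap[OF a(1)] using a(2) by (simp add: greedy_def Let_def dm[OF a(1)])
  qed
  have loc: "restr (?p z) a = restr (?p z') a"
    if a: "a \<^bold>\<in> w1" and e: "\<And>c. c \<^bold>\<in> E \<Longrightarrow> c \<^bold>\<in> a \<Longrightarrow> app z (collapse E c) = app z' (collapse E c)" for z z' a
  proof (rule play_agree[OF o TG TG a])
    fix c assume c: "c \<^bold>\<in> a"
    have cw: "c \<^bold>\<in> w1" by (rule ord_trans[OF o c a])
    show "?G z (restr (?p z) c) = ?G z' (restr (?p z) c)"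
    proof (cases "second_turn c \<or> c \<^bold>\<in> om")
      case True then show ?thesis unfolding greedy_def Let_def dm[OF cw] by auto
    next
      case False
      then show ?thesis unfolding greedy_def Let_def dm[OF cw] using e[OF E[OF cw] c] by simp
    qed
  qed
  \<comment> \<open>A sample sequence: below \<open>om\<close> the greedy player does not look at
    \<open>z\<close>, so the set named is the same in all these plays.\<close>
  define z0 where "z0 = Lam w1 (\<lambda>_. emp)"
  have z0: "is_binary_seq z0 w1" unfolding z0_def
    using is_fun_on_Lam[OF Tf_const] app_Lam[OF Tf_const] unfolding binary_seq_iff by simp
  obtain X where X: "defined_set n l (?p z0) X" "counterexample w1 X"
    using npay[OF z0] unfolding payoff_def by blast
  have Xbin: "is_binary_seq x w1" if "x \<^bold>\<in> X" for x using X(2) that unfolding counterexample_def by blast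
  have Xz: "defined_set n l (?p z) Y \<longleftrightarrow> Y = X" for z Y
  proof -
    have omw: "om \<^bold>\<in> w1" by (rule om_mem_w1[OF w1])
    have r: "restr (?p z) om = restr (?p z0) om" by (rule loc[OF omw]) (use E_om in blast)
    have "app (?p z) b = app (?p z0) b" if "b \<^bold>\<in> om" for b
      using segs_app[OF o fn omw that, of z] segs_app[OF o fn omw that, of z0] r by simp
    then have "defined_set n l (?p z) Y \<longleftrightarrow> defined_set n l (?p z0) Y" for Y by (rule defined_set_cong)
    then show ?thesis using X(1) defined_set_unique by blast
  qed
  let ?B = "\<lambda>x b. b \<^bold>\<in> w1 \<and> (\<forall>a. a \<^bold>\<in> E \<and> asks (?p x) a \<longrightarrow> collapse E a \<^bold>\<in> b)"
  have DB: "Df True (\<lambda>s. ?B x (s 0))" for x by (intro defi)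
  have exB: "\<exists>b. ?B x b" if x: "x \<^bold>\<in> X" for x
  proof -
    \<comment> \<open>The play against \<open>x\<close> does produce the bits of \<open>x\<close>,
      so it can be lost only through too few requests.\<close>
    have "\<not> produces w1 (?p x) x"
      using npay[OF Xbin[OF x]] x X(2) unfolding payoff_def Xz by blast
    then show ?thesis unfolding produces_def using bits[OF Xbin[OF x]] by blast
  qed
  \<comment> \<open>Two elements are compared when these bounds coincide, so that past the common
    bound neither play makes a request.\<close>
  define bd where "bd x = leastord (?B x)" for x
  have bd: "?B x (bd x)" if x: "x \<^bold>\<in> X" for x
  proof -
    obtain b where b: "?B x b" using exB[OF x] by blast
    have "is_ordinal b" using b w1_ordD[OF w1] by blast
    from leastord(2)[OF this b DB] show ?thesis unfolding bd_def .
  qed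
  have "card_at_most_continuum X"
  proof (rule card_at_most_continuumI[OF Xbin])
    show "Tf True (\<lambda>s. bd (s 0))" unfolding bd_def by (intro defi Tp)
    show "bd x \<^bold>\<in> w1" if "x \<^bold>\<in> X" for x using bd[OF that] by blast
    fix x y assume x: "x \<^bold>\<in> X" and y: "y \<^bold>\<in> X" and b: "bd x = bd y"
      and e: "\<And>a. a \<^bold>\<in> bd x \<Longrightarrow> app x a = app y a"
    have fx: "is_fun_on x w1" "is_fun_on y w1" using Xbin x y unfolding binary_seq_iff by blast+
    have "c \<^bold>\<in> w1 \<longrightarrow> app x c = app y c" if "is_ordinal c" for c
    proof (rule ord_induct[OF that, where P = "\<lambda>c. c \<^bold>\<in> w1 \<longrightarrow> app x c = app y c"])
      show "Df True (\<lambda>s. s 0 \<^bold>\<in> w1 \<longrightarrow> app x (s 0) = app y (s 0))" by (intro defi)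
      fix c assume IH: "\<And>d. d \<^bold>\<in> c \<Longrightarrow> d \<^bold>\<in> w1 \<longrightarrow> app x d = app y d"
      show "c \<^bold>\<in> w1 \<longrightarrow> app x c = app y c"
      proof
        assume c: "c \<^bold>\<in> w1"
        let ?a = "round c"
        have aE: "?a \<^bold>\<in> E" and ca: "collapse E ?a = c" using round[OF c] by blast+
        have r: "restr (?p x) ?a = restr (?p y) ?a"
        proof (rule loc[OF E_w1[OF aE]])
          fix d assume d: "d \<^bold>\<in> E" "d \<^bold>\<in> ?a"
          have "collapse E d \<^bold>\<in> c" using collapse_mono[OF E_ord[OF aE] d] ca by simp
          then show "app x (collapse E d) = app y (collapse E d)" using IH collapse_E_w1[OF d(1)] by blast
        qed
        show "app x c = app y c"
        proof (cases "c \<^bold>\<in> bd x")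
          case True then show ?thesis by (rule e)
        next
          case False
          \<comment> \<open>Without a request, each bit is the opposite of the reply that the
            strategy would give, and both plays have reached the same position.\<close>
          then have "\<not> asks (?p x) ?a" "\<not> asks (?p y) ?a" using bd[OF x] bd[OF y] aE ca b by auto
          then have "app x c = emp \<longleftrightarrow> app y c = emp"
            unfolding asks_iff[OF Xbin[OF x] aE] asks_iff[OF Xbin[OF y] aE] ca r by blast
          then show ?thesis using Xbin[OF x] Xbin[OF y] c unfolding binary_seq_iff by metis
        qed
      qed
    qed
    then show "x = y" using fun_ext[OF fx] w1_ordD[OF w1] by blast
  qed
  then show False using X(2) unfolding counterexample_def by blast
qed

theorem perfect_set_theorem:
  assumes dm: determinacy_maximum and X: "\<And>x. x \<^bold>\<in> X \<Longrightarrow> is_binary_seq x w1"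
    and def: "definable_from_countable_ordinal_seq X"
  shows "card_at_most_continuum X \<or> (\<exists>P. is_perfect_set w1 P \<and> P \<^bold>\<subseteq> X)"
proof (rule ccontr)
  assume "\<not> ?thesis"
  then have cex: "counterexample w1 X" unfolding counterexample_def using X by blast
  obtain l n g C where l: "is_ordinal l" and n: "is_ordinal n" and g: "is_injection g C om"
    and cod: "\<forall>p. (\<forall>b. b \<^bold>\<in> om \<longrightarrow> second_turn b \<longrightarrow> app p b = coding_move g C b) \<longrightarrow> defined_set n l p X"
    using ex_coding[OF def] by blast
  have Ts: "Tf True (\<lambda>s. suc (s 0))" by (intro defi)
  \<comment> \<open>The moves must suffice to spell out \<open>C\<close> and to make requests:
    successors of the ordinals in \<open>C\<close>, and 2; the bits 0 and 1 lie below 2.\<close>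
  obtain S where S: "is_ordinal S" "\<forall>a. a \<^bold>\<in> un (img C suc) (upair (num 2) (num 2)) \<and> is_ordinal a \<longrightarrow> a \<^bold>\<in> S"
    using ord_bound by blast
  have num2: "num 2 \<^bold>\<in> S" using S(2) om_ordD[OF num_om] by simp
  have SC: "suc u \<^bold>\<in> S" if "u \<^bold>\<in> C" "is_ordinal u" for u
  proof -
    have "suc u \<^bold>\<in> img C suc" unfolding mem_img[where F = suc, OF Ts] using that(1) by blast
    then show ?thesis using S(2) that(2) by simp
  qed
  let ?A = "payoff_set w1 S n l"
  have "is_game w1 S ?A" unfolding is_game_def
    using w1_ord[OF w1] num2 mem_payoff_set by auto
  moreover have "ordinal_definable ?A" by (rule payoff_set_OD[OF w1_ord[OF w1] S(1) n l])
  ultimately have "determined w1 S ?A" using dm w1 S(1) unfolding determinacy_maximum_def by blast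
  then consider "first_has_winning_strategy w1 S ?A" | "second_has_winning_strategy w1 S ?A"
    unfolding determined_def by blast
  then show False
  proof cases
    case 1
    then obtain \<sigma> where s: "is_strategy first_turn w1 S \<sigma>"
      "\<And>p. is_function p w1 S \<Longrightarrow> follows first_turn w1 \<sigma> p \<Longrightarrow> payoff w1 n l p"
      unfolding first_has_winning_strategy_def mem_payoff_set by blast
    have "\<exists>P. is_perfect_set w1 P \<and> P \<^bold>\<subseteq> X"
      by (rule first_wins_perfect[OF S(1) num2 SC g _ cex s]) (use cod in blast)+
    then show False using cex unfolding counterexample_def by blast
  next
    case 2
    then obtain \<tau> where t: "is_strategy second_turn w1 S \<tau>"
      "\<And>p. is_function p w1 S \<Longrightarrow> follows second_turn w1 \<tau> p \<Longrightarrow> \<not> payoff w1 n l p"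
      unfolding second_has_winning_strategy_def mem_payoff_set by blast
    show False by (rule second_wins_small[OF S(1) num2 t])
  qed
qed

end

end

theorem theorem7:
  fixes mem :: "'v \<Rightarrow> 'v \<Rightarrow> bool" and w1 X :: 'v
  assumes "zfc mem"
    and "set_universe.determinacy_maximum mem"
    and "set_universe.is_omega1 mem w1"
    and "\<And>x. mem x X \<Longrightarrow> set_universe.is_binary_seq mem x w1"
    and "set_universe.definable_from_countable_ordinal_seq mem X"
  shows "set_universe.card_at_most_continuum mem X \<or>
    (\<exists>P. set_universe.is_perfect_set mem w1 P \<and> set_universe.sub mem P X)"
  by (rule zfc.perfect_set_theorem[OF assms(1,3,2) assms(4,5)])

end
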